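(* Let $K$ be an oriented knot in $S^3$ and let $F$ be a field. Assume that the right representation $\rho:\pi_1K\to SL(n,F)$ is obtained from a right representation $\rho_0:\pi_1K\to SL(n,\mathbf{Z})$ via the tautological homomorphism $\mathbf{Z}\to F$, $1\mapsto 1$. Assume that the chain complex $C_*(K;\rho)$ is acyclic, and that the twisted Novikov homology $\widehat H_*(K,\rho_0)$ (with $R=\mathbf{Z}$) vanishes. Then the twisted Alexander invariant $\tau(K;\rho)\in F((t))$ is monic, i.e. the coefficient of its term of lowest degree in $t$ equals $1$ or $-1$.
   Context: Write $C_K=S^3\setminus K$, $G=\pi_1K=\pi_1(C_K)$, $\xi:G\to\mathbf{Z}$ for the homomorphism sending positively oriented meridians to $1$, and $\widetilde C_K$ for the universal cover of (a finite CW complex model of) $C_K$; $C_*(\widetilde C_K)$ is its cellular complex of free left $\mathbf{Z}G$-modules. A right representation satisfies $\rho(g_1g_2)=\rho(g_2)\rho(g_1)$. For a commutative ring $R$, $R[t,t^{-1}]$ is identified with $R[\mathbf{Z}]$ via $t\mapsto-1\in\mathbf{Z}$, and for a right representation $\rho:G\to GL(n,R)$ one puts $\rho_\xi(g)=t^{-\xi(g)}\rho(g)\in GL(n,R[t,t^{-1}])$. Twisted Novikov homology: for $\rho_0:G\to GL(n,\mathbf{Z})$, $\widehat Q=\mathbf{Z}((t))=\mathbf{Z}[[t]][t^{-1}]$, let $\widehat H_*(K,\rho_0)=H_*\big(\widehat Q^n\otimes_{\mathbf{Z}G}C_*(\widetilde C_K)\big)$, where $\widehat Q^n$ is a right $\mathbf{Z}G$-module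 via $(\rho_0)_\xi$. Twisted Alexander invariant: for $\rho:G\to GL(n,F)$ let $S=F(t)$ and $C_*(K;\rho)=S^n\otimes_{\mathbf{Z}G}C_*(\widetilde C_K)$, with $S^n$ a right $\mathbf{Z}G$-module via $\rho_\xi$. When this complex of $S$-vector spaces is acyclic, the twisted Alexander invariant is its Reidemeister torsion (with respect to bases coming from lifts of cells and the standard basis of $S^n$), an element of $S$ well defined modulo multiplication by $\pm t^k$, $k\in\mathbf{Z}$. Regarding $S$ as a subfield of $F((t))$, it is a Laurent series, well defined up to multiplication by $\pm t^k$, denoted $\tau(K;\rho)$. *)

theory Defs
  imports
    "HOL-Analysis.Analysis"
    "HOL-Homology.Homology"
    "HOL-Computational_Algebra.Computational_Algebra"
    "Jordan_Normal_Form.Determinant"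
begin

type_synonym 'a frag = "'a \<Rightarrow>\<^sub>0 int"

section \<open>Knots, knot groups and meridians\<close>

text \<open>
  A (smooth) oriented knot is a closed \<open>C\<^sup>\<infinity>\<close> curve of period 1 in the unit sphere of \<open>\<real>\<^sup>4\<close>, regular and
  simple; the orientation is the direction of the parametrisation.  \<open>D j\<close> is the \<open>j\<close>-th derivative.
\<close>

definition oriented_knot :: "(real \<Rightarrow> real^4) \<Rightarrow> bool" where
  "oriented_knot K \<longleftrightarrow>
     range K \<subseteq> sphere 0 1 \<and> (\<forall>s. K (s + 1) = K s) \<and> inj_on K {0..<1} \<and>
     (\<exists>D :: nat \<Rightarrow> real \<Rightarrow> real^4. D 0 = K \<and>
        (\<forall>j s. (D j has_vector_derivative D (Suc j) s) (at s)) \<and> (\<forall>s. D 1 s \<noteq> 0))"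

definition knot_complement :: "(real \<Rightarrow> real^4) \<Rightarrow> (real^4) set" where
  "knot_complement K = sphere 0 1 - range K"

definition fundamental_group :: "'a::topological_space set \<Rightarrow> 'a \<Rightarrow> (real \<Rightarrow> 'a) set monoid" where
  "fundamental_group S a =
     \<lparr>carrier = {{q. homotopic_paths S p q} | p.
                   path p \<and> path_image p \<subseteq> S \<and> pathstart p = a \<and> pathfinish p = a},
      monoid.mult = (\<lambda>A B. {r. \<exists>p\<in>A. \<exists>q\<in>B. homotopic_paths S (p +++ q) r}),
      one = {q. homotopic_paths S (\<lambda>u. a) q}\<rparr>"

abbreviation knot_group :: "(real \<Rightarrow> real^4) \<Rightarrow> real^4 \<Rightarrow> (real \<Rightarrow> real^4) set monoid" where
  "knot_group K x \<equiv> fundamental_group (knot_complement K) x"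

text \<open>
  A positively oriented meridian is a class freely homotopic to all sufficiently small circles
  around a point \<open>K s\<close> of the knot, traversed from \<open>e1\<close> to \<open>e2\<close> in the plane normal to the knot in
  the tangent space of the sphere, where \<open>(K' s, e1, e2)\<close> is a positive frame of that tangent space
  (right-hand rule).  The sphere is oriented as the boundary of the ball, outward normal \<open>K s\<close> first.
\<close>

definition positive_meridian :: "(real \<Rightarrow> real^4) \<Rightarrow> (real \<Rightarrow> real^4) set \<Rightarrow> bool" where
  "positive_meridian K g \<longleftrightarrow>
     (\<exists>\<gamma>\<in>g. \<exists>s e1 e2.
        norm e1 = 1 \<and> norm e2 = 1 \<and> inner e1 e2 = 0 \<and>
        inner e1 (K s) = 0 \<and> inner e2 (K s) = 0 \<and>
        inner e1 (vector_derivative K (at s)) = 0 \<and> inner e2 (vector_derivative K (at s)) = 0 \<and>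
        Determinants.det (vector [K s, vector_derivative K (at s), e1, e2] :: real^4^4) > 0 \<and>
        (\<forall>\<^sub>F \<epsilon> in at_right 0. homotopic_loops (knot_complement K) \<gamma>
           (\<lambda>u. sgn (K s + \<epsilon> *\<^sub>R (cos (2 * pi * u) *\<^sub>R e1 + sin (2 * pi * u) *\<^sub>R e2)))))"

definition meridian_hom ::
    "(real \<Rightarrow> real^4) \<Rightarrow> real^4 \<Rightarrow> ((real \<Rightarrow> real^4) set \<Rightarrow> int) \<Rightarrow> bool" where
  "meridian_hom K x \<xi> \<longleftrightarrow> \<xi> \<in> hom (knot_group K x) integer_group \<and>
     (\<forall>g\<in>carrier (knot_group K x). positive_meridian K g \<longrightarrow> \<xi> g = 1)"

section \<open>A finite CW complex model of the complement and its universal cover\<close>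

text \<open>
  The closed \<open>k\<close>-disc is modelled by the standard \<open>k\<close>-simplex, so that the characteristic map
  \<open>char_map M k i\<close> of the \<open>i\<close>-th \<open>k\<close>-cell, \<open>i < ncells M k\<close>, is a singular simplex.
  \<open>equiv_map\<close> is a homotopy equivalence from the knot complement to the complex.
\<close>

record ('a, 'b) cw_model =
  base_pt :: "real^4"
  space :: "'a set"
  ncells :: "nat \<Rightarrow> nat"
  char_map :: "nat \<Rightarrow> nat \<Rightarrow> (nat \<Rightarrow> real) \<Rightarrow> 'a"
  equiv_map :: "real^4 \<Rightarrow> 'a"
  cover :: "'b set"
  cover_proj :: "'b \<Rightarrow> 'a"
  cover_base_pt :: 'b
  deck :: "(real \<Rightarrow> real^4) set \<Rightarrow> 'b \<Rightarrow> 'b"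

definition simplex_frontier :: "nat \<Rightarrow> (nat \<Rightarrow> real) set" where
  "simplex_frontier k = {x \<in> standard_simplex k. \<exists>i\<le>k. x i = 0}"

definition skeleton :: "('a, 'b) cw_model \<Rightarrow> int \<Rightarrow> 'a set" where
  "skeleton M k = (\<Union>j\<in>{j. int j \<le> k}. \<Union>i<ncells M j. char_map M j i ` standard_simplex j)"

definition open_cell :: "('a, 'b) cw_model \<Rightarrow> nat \<Rightarrow> nat \<Rightarrow> 'a set" where
  "open_cell M k i = char_map M k i ` (standard_simplex k - simplex_frontier k)"

text \<open>For finitely many cells, closure-finiteness and the weak topology are automatic.\<close>

definition finite_CW_complex :: "('a::topological_space, 'b) cw_model \<Rightarrow> bool" where
  "finite_CW_complex M \<longleftrightarrow>
     Hausdorff_space (top_of_set (space M)) \<and> finite {k. ncells M k \<noteq> 0} \<and>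
     (\<forall>k. \<forall>i<ncells M k.
        singular_simplex k (top_of_set (space M)) (char_map M k i) \<and>
        inj_on (char_map M k i) (standard_simplex k - simplex_frontier k) \<and>
        char_map M k i ` simplex_frontier k \<subseteq> skeleton M (int k - 1)) \<and>
     (\<forall>k l. \<forall>i<ncells M k. \<forall>j<ncells M l.
        (k, i) \<noteq> (l, j) \<longrightarrow> open_cell M k i \<inter> open_cell M l j = {}) \<and>
     space M = (\<Union>k. \<Union>i<ncells M k. open_cell M k i)"

definition homotopy_equivalence :: "'a topology \<Rightarrow> 'b topology \<Rightarrow> ('a \<Rightarrow> 'b) \<Rightarrow> bool" where
  "homotopy_equivalence X Y f \<longleftrightarrow> continuous_map X Y f \<and>
     (\<exists>g. continuous_map Y X g \<and>
        homotopic_with (\<lambda>x. True) X X (g \<circ> f) id \<and> homotopic_with (\<lambda>x. True) Y Y (f \<circ> g) id)"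

text \<open>
  The knot group acts from the left on the universal cover by deck transformations: \<open>[\<gamma>]\<close> moves the
  base point to the end point of the lift, starting at the base point, of the image of \<open>\<gamma>\<close> in the
  complex.  This determines the action.
\<close>

definition deck_action :: "(real \<Rightarrow> real^4) \<Rightarrow>
    ('a::topological_space, 'b::topological_space) cw_model \<Rightarrow> bool" where
  "deck_action K M \<longleftrightarrow>
     (\<forall>g\<in>carrier (knot_group K (base_pt M)).
        (\<exists>f. homeomorphism (cover M) (cover M) (deck M g) f) \<and>
        (\<forall>x\<in>cover M. cover_proj M (deck M g x) = cover_proj M x) \<and>
        (\<forall>\<gamma>\<in>g. \<exists>l. path l \<and> path_image l \<subseteq> cover M \<and> pathstart l = cover_base_pt M \<and>
           (\<forall>u\<in>{0..1}. cover_proj M (l u) = equiv_map M (\<gamma> u)) \<and>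
           pathfinish l = deck M g (cover_base_pt M)) \<and>
        (\<forall>h\<in>carrier (knot_group K (base_pt M)). \<forall>x\<in>cover M.
           deck M (g \<otimes>\<^bsub>knot_group K (base_pt M)\<^esub> h) x = deck M g (deck M h x)))"

definition complement_model :: "(real \<Rightarrow> real^4) \<Rightarrow>
    ('a::topological_space, 'b::topological_space) cw_model \<Rightarrow> bool" where
  "complement_model K M \<longleftrightarrow>
     base_pt M \<in> knot_complement K \<and> finite_CW_complex M \<and>
     homotopy_equivalence (top_of_set (knot_complement K)) (top_of_set (space M)) (equiv_map M) \<and>
     covering_space (cover M) (cover_proj M) (space M) \<and> simply_connected (cover M) \<and>
     cover_base_pt M \<in> cover M \<and> cover_proj M (cover_base_pt M) = equiv_map M (base_pt M) \<and>
     deck_action K M"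

section \<open>The cellular complex of the universal cover\<close>

definition cover_skeleton :: "('a, 'b) cw_model \<Rightarrow> int \<Rightarrow> 'b set" where
  "cover_skeleton M k = {x \<in> cover M. cover_proj M x \<in> skeleton M k}"

definition cell_chain :: "('a, 'b::topological_space) cw_model \<Rightarrow> int \<Rightarrow> 'b chain set monoid" where
  "cell_chain M k =
     relative_homology_group k (top_of_set (cover_skeleton M k)) (cover_skeleton M (k - 1))"

text \<open>The boundary map of the triple of consecutive skeleta.\<close>

definition cell_boundary ::
    "('a, 'b::topological_space) cw_model \<Rightarrow> int \<Rightarrow> 'b chain set \<Rightarrow> 'b chain set" where
  "cell_boundary M k =
     hom_induced (k - 1)
       (subtopology (top_of_set (cover_skeleton M k)) (cover_skeleton M (k - 1))) {}
       (top_of_set (cover_skeleton M (k - 1))) (cover_skeleton M (k - 2)) id \<circ>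
     hom_boundary k (top_of_set (cover_skeleton M k)) (cover_skeleton M (k - 1))"

definition cell_act :: "('a, 'b::topological_space) cw_model \<Rightarrow> int \<Rightarrow>
    (real \<Rightarrow> real^4) set \<Rightarrow> 'b chain set \<Rightarrow> 'b chain set" where
  "cell_act M k g =
     hom_induced k (top_of_set (cover_skeleton M k)) (cover_skeleton M (k - 1))
       (top_of_set (cover_skeleton M k)) (cover_skeleton M (k - 1)) (deck M g)"

text \<open>Elements of \<open>\<int>G\<close> are finitely supported functions from \<open>G\<close> to \<open>\<int>\<close>.\<close>

definition group_ring_act :: "('c, 'z) monoid_scheme \<Rightarrow> ('g \<Rightarrow> 'c \<Rightarrow> 'c) \<Rightarrow> 'g frag \<Rightarrow> 'c \<Rightarrow> 'c" where
  "group_ring_act N act a x =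
     finprod N (\<lambda>g. act g x [^]\<^bsub>N\<^esub> Poly_Mapping.lookup a g) (Poly_Mapping.keys a)"

text \<open>
  A basis of the free left \<open>\<int>G\<close>-modules \<open>C\<^sub>k\<close> coming from lifts of cells: \<open>b k i\<close> is the class of a
  lift of the characteristic map of the \<open>i\<close>-th \<open>k\<close>-cell.  That such classes are a basis is a
  general fact on cellular chains; it is recorded here as part of the notion.
\<close>

definition cell_basis :: "(real \<Rightarrow> real^4) \<Rightarrow>
    ('a::topological_space, 'b::topological_space) cw_model \<Rightarrow> (nat \<Rightarrow> nat \<Rightarrow> 'b chain set) \<Rightarrow> bool" where
  "cell_basis K M b \<longleftrightarrow>
     (\<forall>k. \<forall>i<ncells M k. \<exists>\<phi>. singular_simplex k (top_of_set (cover M)) \<phi> \<and>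
        simplex_map k (cover_proj M) \<phi> = char_map M k i \<and>
        b k i = homologous_rel_set k (top_of_set (cover_skeleton M (int k)))
                  (cover_skeleton M (int k - 1)) (frag_of \<phi>)) \<and>
     (\<forall>k. \<forall>x\<in>carrier (cell_chain M (int k)).
        \<exists>!a. a \<in> {..<ncells M k} \<rightarrow>\<^sub>E {a. Poly_Mapping.keys a \<subseteq> carrier (knot_group K (base_pt M))} \<and>
             x = finprod (cell_chain M (int k))
                   (\<lambda>i. group_ring_act (cell_chain M (int k)) (cell_act M (int k)) (a i) (b k i))
                   {..<ncells M k})"

section \<open>Tensor products over a group ring\<close>

text \<open>
  \<open>M \<otimes>\<^bsub>\<int>G\<^esub> N\<close> for a right \<open>\<int>G\<close>-module \<open>M\<close> and a left \<open>\<int>G\<close>-module \<open>N\<close>, both given as abelian groups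
  with an action of \<open>G\<close>: the free abelian group on pairs modulo the biadditive and balanced
  relations.  As \<open>G\<close> spans \<open>\<int>G\<close> additively, balancing over \<open>G\<close> is balancing over \<open>\<int>G\<close>.
\<close>

definition tensor_relations :: "'g set \<Rightarrow> ('m, 'y) monoid_scheme \<Rightarrow> ('m \<Rightarrow> 'g \<Rightarrow> 'm) \<Rightarrow>
    ('c, 'z) monoid_scheme \<Rightarrow> ('g \<Rightarrow> 'c \<Rightarrow> 'c) \<Rightarrow> ('m \<times> 'c) frag set" where
  "tensor_relations G M ract N lact =
     generate (free_Abelian_group (carrier M \<times> carrier N))
       ({frag_of (u \<otimes>\<^bsub>M\<^esub> v, x) - frag_of (u, x) - frag_of (v, x) | u v x.
           u \<in> carrier M \<and> v \<in> carrier M \<and> x \<in> carrier N} \<union>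
        {frag_of (u, x \<otimes>\<^bsub>N\<^esub> y) - frag_of (u, x) - frag_of (u, y) | u x y.
           u \<in> carrier M \<and> x \<in> carrier N \<and> y \<in> carrier N} \<union>
        {frag_of (ract u g, x) - frag_of (u, lact g x) | u g x.
           u \<in> carrier M \<and> g \<in> G \<and> x \<in> carrier N})"

definition tensor_product :: "'g set \<Rightarrow> ('m, 'y) monoid_scheme \<Rightarrow> ('m \<Rightarrow> 'g \<Rightarrow> 'm) \<Rightarrow>
    ('c, 'z) monoid_scheme \<Rightarrow> ('g \<Rightarrow> 'c \<Rightarrow> 'c) \<Rightarrow> ('m \<times> 'c) frag set monoid" where
  "tensor_product G M ract N lact =
     free_Abelian_group (carrier M \<times> carrier N) Mod tensor_relations G M ract N lact"

definition pure_tensor :: "'g set \<Rightarrow> ('m, 'y) monoid_scheme \<Rightarrow> ('m \<Rightarrow> 'g \<Rightarrow> 'm) \<Rightarrow>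
    ('c, 'z) monoid_scheme \<Rightarrow> ('g \<Rightarrow> 'c \<Rightarrow> 'c) \<Rightarrow> 'm \<Rightarrow> 'c \<Rightarrow> ('m \<times> 'c) frag set" where
  "pure_tensor G M ract N lact u x =
     tensor_relations G M ract N lact #>\<^bsub>free_Abelian_group (carrier M \<times> carrier N)\<^esub> frag_of (u, x)"

text \<open>
  The map induced by \<open>u \<otimes> x \<mapsto> f u \<otimes> h x\<close>, with values in the tensor product described by the
  first five arguments.
\<close>

definition tensor_map :: "'g set \<Rightarrow> ('m, 'y) monoid_scheme \<Rightarrow> ('m \<Rightarrow> 'g \<Rightarrow> 'm) \<Rightarrow>
    ('c, 'z) monoid_scheme \<Rightarrow> ('g \<Rightarrow> 'c \<Rightarrow> 'c) \<Rightarrow> ('m \<Rightarrow> 'm) \<Rightarrow> ('c \<Rightarrow> 'c) \<Rightarrow>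
    ('m \<times> 'c) frag set \<Rightarrow> ('m \<times> 'c) frag set" where
  "tensor_map G M ract N lact f h X =
     tensor_relations G M ract N lact <#>\<^bsub>free_Abelian_group (carrier M \<times> carrier N)\<^esub>
       (frag_extend (\<lambda>(u, x). frag_of (f u, h x)) ` X)"

section \<open>Twisted chain complexes and their homology\<close>

text \<open>
  A right representation \<open>A\<close> (an antihomomorphism) makes column vectors a right module via
  \<open>v \<cdot> g = A g v\<close>.
\<close>

definition right_SL_representation ::
    "('g, 'z) monoid_scheme \<Rightarrow> nat \<Rightarrow> ('g \<Rightarrow> 'r::comm_ring_1 Matrix.mat) \<Rightarrow> bool" where
  "right_SL_representation G n A \<longleftrightarrow>
     (\<forall>g\<in>carrier G. A g \<in> carrier_mat n n \<and> Determinant.det (A g) = 1) \<and>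
     (\<forall>g\<in>carrier G. \<forall>h\<in>carrier G. A (g \<otimes>\<^bsub>G\<^esub> h) = A h * A g)"

definition col_vectors :: "nat \<Rightarrow> 'r::comm_ring_1 Matrix.vec monoid" where
  "col_vectors n = \<lparr>carrier = carrier_vec n, monoid.mult = (+), one = 0\<^sub>v n\<rparr>"

definition twisted_chain :: "(real \<Rightarrow> real^4) \<Rightarrow> ('a, 'b::topological_space) cw_model \<Rightarrow> nat \<Rightarrow>
    ((real \<Rightarrow> real^4) set \<Rightarrow> 'r::comm_ring_1 Matrix.mat) \<Rightarrow> int \<Rightarrow>
    ('r Matrix.vec \<times> 'b chain set) frag set monoid" where
  "twisted_chain K M n A k =
     tensor_product (carrier (knot_group K (base_pt M))) (col_vectors n) (\<lambda>v g. A g *\<^sub>v v)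
       (cell_chain M k) (cell_act M k)"

definition twisted_boundary :: "(real \<Rightarrow> real^4) \<Rightarrow> ('a, 'b::topological_space) cw_model \<Rightarrow> nat \<Rightarrow>
    ((real \<Rightarrow> real^4) set \<Rightarrow> 'r::comm_ring_1 Matrix.mat) \<Rightarrow> int \<Rightarrow>
    ('r Matrix.vec \<times> 'b chain set) frag set \<Rightarrow> ('r Matrix.vec \<times> 'b chain set) frag set" where
  "twisted_boundary K M n A k =
     tensor_map (carrier (knot_group K (base_pt M))) (col_vectors n) (\<lambda>v g. A g *\<^sub>v v)
       (cell_chain M (k - 1)) (cell_act M (k - 1)) id (cell_boundary M k)"

definition twisted_scale :: "(real \<Rightarrow> real^4) \<Rightarrow> ('a, 'b::topological_space) cw_model \<Rightarrow> nat \<Rightarrow>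
    ((real \<Rightarrow> real^4) set \<Rightarrow> 'r::comm_ring_1 Matrix.mat) \<Rightarrow> int \<Rightarrow> 'r \<Rightarrow>
    ('r Matrix.vec \<times> 'b chain set) frag set \<Rightarrow> ('r Matrix.vec \<times> 'b chain set) frag set" where
  "twisted_scale K M n A k s =
     tensor_map (carrier (knot_group K (base_pt M))) (col_vectors n) (\<lambda>v g. A g *\<^sub>v v)
       (cell_chain M k) (cell_act M k) (\<lambda>v. s \<cdot>\<^sub>v v) id"

definition twisted_tensor :: "(real \<Rightarrow> real^4) \<Rightarrow> ('a, 'b::topological_space) cw_model \<Rightarrow> nat \<Rightarrow>
    ((real \<Rightarrow> real^4) set \<Rightarrow> 'r::comm_ring_1 Matrix.mat) \<Rightarrow> int \<Rightarrow>
    'r Matrix.vec \<Rightarrow> 'b chain set \<Rightarrow> ('r Matrix.vec \<times> 'b chain set) frag set" where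
  "twisted_tensor K M n A k =
     pure_tensor (carrier (knot_group K (base_pt M))) (col_vectors n) (\<lambda>v g. A g *\<^sub>v v)
       (cell_chain M k) (cell_act M k)"

definition complex_homology :: "(int \<Rightarrow> 'c monoid) \<Rightarrow> (int \<Rightarrow> 'c \<Rightarrow> 'c) \<Rightarrow> int \<Rightarrow> 'c set monoid" where
  "complex_homology C d k =
     (C k)\<lparr>carrier := kernel (C k) (C (k - 1)) (d k)\<rparr> Mod (d (k + 1) ` carrier (C (k + 1)))"

definition acyclic_complex :: "(int \<Rightarrow> 'c monoid) \<Rightarrow> (int \<Rightarrow> 'c \<Rightarrow> 'c) \<Rightarrow> bool" where
  "acyclic_complex C d \<longleftrightarrow> (\<forall>k. trivial_group (complex_homology C d k))"

section \<open>Twisted Novikov homology\<close>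

text \<open>\<open>\<rho>\<^sub>\<xi>(g) = t\<^bsup>-\<xi>(g)\<^esup> \<rho>(g)\<close>, regarded as a matrix over \<open>\<int>((t))\<close>.\<close>

definition novikov_rep :: "('g \<Rightarrow> int) \<Rightarrow> ('g \<Rightarrow> int Matrix.mat) \<Rightarrow> 'g \<Rightarrow> int fls Matrix.mat" where
  "novikov_rep \<xi> \<rho> g = fls_X_intpow (- \<xi> g) \<cdot>\<^sub>m map_mat fls_const (\<rho> g)"

definition twisted_novikov_homology :: "(real \<Rightarrow> real^4) \<Rightarrow> ('a, 'b::topological_space) cw_model \<Rightarrow>
    nat \<Rightarrow> ((real \<Rightarrow> real^4) set \<Rightarrow> int) \<Rightarrow> ((real \<Rightarrow> real^4) set \<Rightarrow> int Matrix.mat) \<Rightarrow> int \<Rightarrow>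
    (int fls Matrix.vec \<times> 'b chain set) frag set set monoid" where
  "twisted_novikov_homology K M n \<xi> \<rho> =
     complex_homology (twisted_chain K M n (novikov_rep \<xi> \<rho>)) (twisted_boundary K M n (novikov_rep \<xi> \<rho>))"

section \<open>The twisted Alexander invariant\<close>

text \<open>The field \<open>F(t)\<close> is \<^typ>\<open>'f::field poly fract\<close>.\<close>

definition ratfun_t :: "'f::field poly fract" where
  "ratfun_t = Fract [:0, 1:] 1"

definition alexander_rep ::
    "('g \<Rightarrow> int) \<Rightarrow> ('g \<Rightarrow> 'f::field Matrix.mat) \<Rightarrow> 'g \<Rightarrow> 'f poly fract Matrix.mat" where
  "alexander_rep \<xi> \<rho> g = (ratfun_t powi (- \<xi> g)) \<cdot>\<^sub>m map_mat (\<lambda>a. Fract [:a:] 1) (\<rho> g)"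

definition fls_of_ratfun :: "'f::field poly fract \<Rightarrow> 'f fls" where
  "fls_of_ratfun r =
     (THE f. \<forall>p q. q \<noteq> 0 \<and> r = Fract p q \<longrightarrow> f = fps_to_fls (fps_of_poly p) / fps_to_fls (fps_of_poly q))"

lemma fls_of_ratfun_Fract:
  fixes p q :: "'f::field poly"
  assumes "q \<noteq> 0"
  shows "fls_of_ratfun (Fract p q) = fps_to_fls (fps_of_poly p) / fps_to_fls (fps_of_poly q)"
  unfolding fls_of_ratfun_def
proof (rule the_equality)
  let ?e = "\<lambda>p :: 'f poly. fps_to_fls (fps_of_poly p)"
  show "\<forall>p' q'. q' \<noteq> 0 \<and> Fract p q = Fract p' q' \<longrightarrow> ?e p / ?e q = ?e p' / ?e q'"
  proof (intro allI impI)
    fix p' q' :: "'f poly"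
    assume *: "q' \<noteq> 0 \<and> Fract p q = Fract p' q'"
    then have "p * q' = p' * q"
      using assms by (metis eq_fract(1))
    then have "?e p * ?e q' = ?e p' * ?e q"
      by (metis fls_times_fps_to_fls fps_of_poly_mult)
    moreover have "?e q \<noteq> 0" "?e q' \<noteq> 0"
      using assms * by simp_all
    ultimately show "?e p / ?e q = ?e p' / ?e q'"
      by (simp add: frac_eq_eq)
  qed
qed (use assms in blast)

text \<open>
  In the following, a vector space is a commutative group \<open>V\<close>, written multiplicatively, with a
  scalar multiplication; \<open>W\<close> is the underlying set of a subspace.
\<close>

definition lin_comb :: "('c, 'z) monoid_scheme \<Rightarrow> ('s \<Rightarrow> 'c \<Rightarrow> 'c) \<Rightarrow> 'c list \<Rightarrow> 's Matrix.vec \<Rightarrow> 'c" where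
  "lin_comb V scl bs v = finprod V (\<lambda>i. scl (vec_index v i) (bs ! i)) {..<length bs}"

definition is_basis :: "('c, 'z) monoid_scheme \<Rightarrow> ('s \<Rightarrow> 'c \<Rightarrow> 'c) \<Rightarrow> 'c set \<Rightarrow> 'c list \<Rightarrow> bool" where
  "is_basis V scl W bs \<longleftrightarrow> set bs \<subseteq> W \<and>
     (\<forall>x\<in>W. \<exists>!v. v \<in> carrier_vec (length bs) \<and> x = lin_comb V scl bs v)"

definition coordinates :: "('c, 'z) monoid_scheme \<Rightarrow> ('s \<Rightarrow> 'c \<Rightarrow> 'c) \<Rightarrow> 'c list \<Rightarrow> 'c \<Rightarrow> 's Matrix.vec" where
  "coordinates V scl cs x = (THE v. v \<in> carrier_vec (length cs) \<and> x = lin_comb V scl cs v)"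

definition transition_det ::
    "('c, 'z) monoid_scheme \<Rightarrow> ('s::comm_ring_1 \<Rightarrow> 'c \<Rightarrow> 'c) \<Rightarrow> 'c list \<Rightarrow> 'c list \<Rightarrow> 's" where
  "transition_det V scl bs cs =
     Determinant.det (mat_of_cols (length cs) (map (coordinates V scl cs) bs))"

text \<open>
  \<open>\<tau>\<close> is the Reidemeister torsion \<open>\<Prod>\<^sub>k [\<partial>b\<^sub>k\<^sub>+\<^sub>1 b\<^sub>k / c\<^sub>k]\<^bsup>(-1)^(k+1)\<^esup>\<close> of an acyclic complex of vector spaces
  with ordered bases \<open>c\<^sub>k\<close>, where \<open>b\<^sub>k\<close> is a sequence in \<open>C\<^sub>k\<close> mapped by \<open>\<partial>\<close> to a basis of the
  boundaries in \<open>C\<^sub>k\<^sub>-\<^sub>1\<close>.  Degrees with \<open>C\<^sub>k = 0\<close> contribute the factor 1.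
\<close>

definition is_torsion :: "(int \<Rightarrow> 'c monoid) \<Rightarrow> (int \<Rightarrow> 'c \<Rightarrow> 'c) \<Rightarrow> (int \<Rightarrow> 's::field \<Rightarrow> 'c \<Rightarrow> 'c) \<Rightarrow>
    (nat \<Rightarrow> 'c list) \<Rightarrow> 's \<Rightarrow> bool" where
  "is_torsion C d scl c \<tau> \<longleftrightarrow>
     (\<exists>b. (\<forall>k. set (b k) \<subseteq> carrier (C k) \<and>
             is_basis (C (k - 1)) (scl (k - 1)) (d k ` carrier (C k)) (map (d k) (b k))) \<and>
          \<tau> = (\<Prod>k | c k \<noteq> [].
                 transition_det (C (int k)) (scl (int k))
                   (map (d (int k + 1)) (b (int k + 1)) @ b (int k)) (c k)
                 powi (if even k then - 1 else 1)))"

definition twisted_alexander_complex_acyclic :: "(real \<Rightarrow> real^4) \<Rightarrow>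
    ('a, 'b::topological_space) cw_model \<Rightarrow> nat \<Rightarrow> ((real \<Rightarrow> real^4) set \<Rightarrow> int) \<Rightarrow>
    ((real \<Rightarrow> real^4) set \<Rightarrow> 'f::field Matrix.mat) \<Rightarrow> bool" where
  "twisted_alexander_complex_acyclic K M n \<xi> \<rho> \<longleftrightarrow>
     acyclic_complex (twisted_chain K M n (alexander_rep \<xi> \<rho>))
       (twisted_boundary K M n (alexander_rep \<xi> \<rho>))"

text \<open>
  The invariant is a class modulo \<open>\<plusminus>t\<^sup>m\<close>; it is represented by the set of all its representatives.
\<close>

definition twisted_alexander_invariant :: "(real \<Rightarrow> real^4) \<Rightarrow>
    ('a::topological_space, 'b::topological_space) cw_model \<Rightarrow> nat \<Rightarrow>
    ((real \<Rightarrow> real^4) set \<Rightarrow> int) \<Rightarrow> ((real \<Rightarrow> real^4) set \<Rightarrow> 'f::field Matrix.mat) \<Rightarrow>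
    'f poly fract set" where
  "twisted_alexander_invariant K M n \<xi> \<rho> =
     {\<sigma> * ratfun_t powi m * \<tau> | \<sigma> m \<tau>. \<sigma> \<in> {1, - 1} \<and>
        (\<exists>b. cell_basis K M b \<and>
           is_torsion (twisted_chain K M n (alexander_rep \<xi> \<rho>))
             (twisted_boundary K M n (alexander_rep \<xi> \<rho>))
             (twisted_scale K M n (alexander_rep \<xi> \<rho>))
             (\<lambda>k. [twisted_tensor K M n (alexander_rep \<xi> \<rho>) (int k) (unit_vec n j) (b k i).
                     i \<leftarrow> [0..<ncells M k], j \<leftarrow> [0..<n]])
             \<tau>)}"

definition monic_fls :: "'f::field fls \<Rightarrow> bool" where
  "monic_fls f \<longleftrightarrow> fls_nth f (fls_subdegree f) \<in> {1, - 1}"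

end

theory Submission
  imports Defs
begin

text \<open>
  The cellular boundary maps of the universal cover are matrices over the group ring of the knot group. A
  representation turns them into matrices over its coefficient ring, which describe the twisted complex
  (\<open>coordinates_exist\<close>). The representations over \<open>\<int>((t))\<close> and over \<open>F(t)\<close> agree over \<open>F((t))\<close>, and therefore so
  do the matrices.

  The ring \<open>\<int>((t))\<close> is Euclidean: the size of a series is the absolute value of its leading coefficient
  (\<open>fls_euclidean\<close>). Vanishing of the twisted Novikov homology means that the complex over \<open>\<int>((t))\<close> is exact.
  By elimination, an exact complex over a Euclidean ring has bases in all degrees, given by
  invertible matrices \<open>V\<^sub>k\<close>, in which every boundary map is a partial identity (\<open>exact_complex_normal_form\<close>).
  The determinants of these base changes are units of \<open>\<int>((t))\<close>, and the units of \<open>\<int>((t))\<close> are the series with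
  leading coefficient \<open>\<plusminus>1\<close>.

  Over \<open>F((t))\<close> the torsion can be computed from this normal form. If \<open>b\<^sub>k\<close> is any choice of chains mapped to a basis
  of the boundaries, then the matrix with columns \<open>\<partial>b\<^sub>k\<^sub>+\<^sub>1\<close> and \<open>b\<^sub>k\<close> is the product of \<open>V\<^sub>k\<close> with a block
  triangular matrix, and its determinant is \<open>det V\<^sub>k\<close> times \<open>g\<^sub>k\<^sub>+\<^sub>1 g\<^sub>k\<close>, where \<open>g\<^sub>k\<close> compares the two bases of
  boundaries in degree \<open>k - 1\<close> (\<open>torsion_factors\<close>). In the alternating product the \<open>g\<^sub>k\<close> cancel. So the torsion is
  an alternating product of the \<open>det V\<^sub>k\<close> and has leading coefficient \<open>\<plusminus>1\<close> (\<open>torsion_is_monic\<close>).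
\<close>

section \<open>The coefficient ring \<open>\<int>((t))\<close>\<close>

text \<open>
  Long division without carries: each coefficient of the quotient is chosen so that the
  corresponding coefficient of the remainder is reduced modulo the constant term of the divisor.
\<close>

fun fps_quotient :: "int fps \<Rightarrow> int fps \<Rightarrow> nat \<Rightarrow> int" where
  "fps_quotient a b n =
     (fps_nth a n - (\<Sum>i<n. fps_quotient a b i * fps_nth b (n - i))) div fps_nth b 0"

declare fps_quotient.simps [simp del]

lemma fps_division_coefficientwise:
  fixes a b :: "int fps"
  assumes "fps_nth b 0 \<noteq> 0"
  shows "\<bar>fps_nth (a - Abs_fps (fps_quotient a b) * b) n\<bar> < \<bar>fps_nth b 0\<bar>"
proof -
  let ?c = "fps_nth a n - (\<Sum>i<n. fps_quotient a b i * fps_nth b (n - i))"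
  have "{0..n} = insert n {..<n}" by auto
  then have "fps_nth (a - Abs_fps (fps_quotient a b) * b) n = ?c - fps_quotient a b n * fps_nth b 0"
    by (simp add: fps_mult_nth)
  also have "fps_quotient a b n = ?c div fps_nth b 0"
    by (rule fps_quotient.simps)
  also have "?c - ?c div fps_nth b 0 * fps_nth b 0 = ?c mod fps_nth b 0"
    by (rule minus_div_mult_eq_mod)
  finally show ?thesis
    using assms by (simp add: abs_mod_less)
qed

definition leading :: "'a::zero fls \<Rightarrow> 'a" where
  "leading f = fls_nth f (fls_subdegree f)"

lemma leading_eq_0_iff [simp]: "leading f = 0 \<longleftrightarrow> f = 0"
  by (cases "f = 0") (simp_all add: leading_def nth_fls_subdegree_nonzero)

lemma leading_mult: "leading (f * g) = leading f * leading (g :: 'a::idom fls)"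
proof (cases "f = 0 \<or> g = 0")
  case True
  then show ?thesis
    by (auto simp: leading_def)
next
  case False
  then show ?thesis
    by (simp add: leading_def fls_times_nth(1))
qed

lemma leading_shift: "leading (fls_shift k f) = leading f"
  by (cases "f = 0") (simp_all add: leading_def)

lemma leading_fps_to_fls: "leading (fps_to_fls p) = fps_nth p (subdegree p)"
  by (simp add: leading_def fls_subdegree_fls_to_fps)

text \<open>
  After shifting, dividend and divisor are power series and the constant term of the divisor is its
  leading coefficient. Coefficientwise division leaves a remainder all of whose coefficients, in
  particular the first nonzero one, are smaller than that. This makes \<open>\<int>((t))\<close> Euclidean for the
  absolute value of the leading coefficient, although \<open>\<int>[[t]]\<close> is not a principal ideal domain.
\<close>

lemma fls_euclidean:
  fixes a b :: "int fls"
  assumes "b \<noteq> 0"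
  shows "\<exists>q. a - q * b = 0 \<or> nat \<bar>leading (a - q * b)\<bar> < nat \<bar>leading b\<bar>"
proof -
  define A B where "A = fls_base_factor_to_fps a" and "B = fls_base_factor_to_fps b"
  define q where "q = Abs_fps (fps_quotient A B)"
  define k where "k = fls_subdegree b - fls_subdegree a"
  have a: "a = fls_shift (- fls_subdegree a) (fps_to_fls A)"
    and b: "b = fls_shift (- fls_subdegree b) (fps_to_fls B)"
    unfolding A_def B_def by (rule fls_conv_base_factor_to_fps_shift_subdegree)+
  have B0: "fps_nth B 0 = leading b"
    by (simp add: B_def leading_def fls_base_factor_to_fps_nth)
  have "fls_shift k (fps_to_fls q) * b
      = fls_shift k (fps_to_fls q) * fls_shift (- fls_subdegree b) (fps_to_fls B)"
    using b by simp
  also have "\<dots> = fls_shift (- fls_subdegree a) (fps_to_fls (q * B))"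
    by (simp add: fls_times_both_shifted_simp k_def fls_times_fps_to_fls)
  finally have "a - fls_shift k (fps_to_fls q) * b
      = fls_shift (- fls_subdegree a) (fps_to_fls (A - q * B))"
    by (subst a) (auto intro!: fls_eqI)
  moreover have "leading (fps_to_fls (A - q * B)) = fps_nth (A - q * B) (subdegree (A - q * B))"
    by (rule leading_fps_to_fls)
  moreover have "\<bar>fps_nth (A - q * B) (subdegree (A - q * B))\<bar> < \<bar>leading b\<bar>"
    using fps_division_coefficientwise[of B A] B0 assms unfolding q_def by simp
  ultimately have "\<bar>leading (a - fls_shift k (fps_to_fls q) * b)\<bar> < \<bar>leading b\<bar>"
    by (simp only: leading_shift)
  then show ?thesis
    using assms by (intro exI[of _ "fls_shift k (fps_to_fls q)"]) simp
qed

text \<open>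
  The leading coefficient is multiplicative, so a unit has a unit of \<open>\<int>\<close> as leading coefficient.
\<close>

lemma fls_unit_leading:
  fixes u :: "int fls"
  assumes "u dvd 1"
  shows "leading u \<in> {1, - 1}"
proof -
  obtain v where "1 = u * v" using assms by (elim dvdE)
  then have "1 = leading u * leading v"
    by (metis leading_mult leading_def fls_one_subdegree fls_one_nth)
  then show ?thesis
    by (metis insertI1 insertI2 zmult_eq_1_iff)
qed

section \<open>Laurent series over a field\<close>

definition fls_of_int_fls :: "int fls \<Rightarrow> 'a::comm_ring_1 fls" where
  "fls_of_int_fls f = Abs_fls (\<lambda>k. of_int (fls_nth f k))"

lemma fls_of_int_fls_nth [simp]: "fls_nth (fls_of_int_fls f) k = of_int (fls_nth f k)"
proof -
  have "\<forall>\<^sub>\<infinity>n. (of_int (fls_nth f (- int n)) :: 'a) = 0"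
    by (rule MOST_mono[OF MOST_fls_neg_nth_eq_0[of f]]) simp
  then show ?thesis
    unfolding fls_of_int_fls_def by (rule nth_Abs_fls)
qed

text \<open>
  Reduction of coefficients may raise the subdegree. The product formula is therefore needed with
  arbitrary lower bounds in place of the subdegrees.
\<close>

lemma fls_times_nth_from:
  fixes f g :: "'a::semiring_1 fls"
  assumes "a \<le> fls_subdegree f" and "b \<le> fls_subdegree g"
  shows "fls_nth (f * g) k = (\<Sum>i=a..k - b. fls_nth f i * fls_nth g (k - i))"
  unfolding fls_times_nth(2)
  by (rule sum.mono_neutral_left) (use assms in auto)

lemma subdegree_fls_of_int_fls:
  fixes f :: "int fls"
  obtains a where "a \<le> fls_subdegree f" "a \<le> fls_subdegree (fls_of_int_fls f :: 'a::comm_ring_1 fls)"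
  by (meson linorder_linear order_refl)

lemma ring_hom_fls_of_int_fls: "comm_ring_hom (fls_of_int_fls :: int fls \<Rightarrow> 'a::comm_ring_1 fls)"
proof
  fix f g :: "int fls"
  obtain a where a: "a \<le> fls_subdegree f" "a \<le> fls_subdegree (fls_of_int_fls f :: 'a fls)"
    by (rule subdegree_fls_of_int_fls)
  obtain b where b: "b \<le> fls_subdegree g" "b \<le> fls_subdegree (fls_of_int_fls g :: 'a fls)"
    by (rule subdegree_fls_of_int_fls)
  show "fls_of_int_fls (f * g) = (fls_of_int_fls f * fls_of_int_fls g :: 'a fls)"
    by (rule fls_eqI) (simp add: fls_times_nth_from[OF a(1) b(1)] fls_times_nth_from[OF a(2) b(2)])
  show "fls_of_int_fls (f + g) = (fls_of_int_fls f + fls_of_int_fls g :: 'a fls)"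
    by (rule fls_eqI) simp
qed (rule fls_eqI, simp)+

text \<open>
  The leading coefficient \<open>\<plusminus>1\<close> of a unit survives in every field, whatever its characteristic. This is
  the only way in which integrality enters the final statement.
\<close>

lemma fls_of_int_fls_unit_monic:
  fixes u :: "int fls"
  assumes "u dvd 1"
  shows "monic_fls (fls_of_int_fls u :: 'a::field fls)"
proof -
  have u: "fls_nth u (fls_subdegree u) \<in> {1, - 1}"
    using fls_unit_leading[OF assms] by (simp add: leading_def)
  then have "fls_subdegree (fls_of_int_fls u :: 'a fls) = fls_subdegree u"
    by (intro fls_subdegree_eqI) auto
  then show ?thesis
    using u by (auto simp: monic_fls_def)
qed

lemma monic_fls_iff: "monic_fls f \<longleftrightarrow> leading f \<in> {1, - 1}"
  by (simp add: monic_fls_def leading_def)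

lemma monic_fls_nonzero: "monic_fls f \<Longrightarrow> f \<noteq> 0"
  by (auto simp: monic_fls_def)

lemma monic_fls_mult: "monic_fls f \<Longrightarrow> monic_fls g \<Longrightarrow> monic_fls (f * g)"
  by (auto simp: monic_fls_iff leading_mult)

lemma monic_fls_one: "monic_fls 1"
  by (simp add: monic_fls_def)

lemma monic_fls_inverse:
  assumes "monic_fls f"
  shows "monic_fls (inverse f)"
proof -
  have "leading f * leading (inverse f) = leading (f * inverse f)"
    by (rule leading_mult[symmetric])
  also have "\<dots> = 1"
    using monic_fls_nonzero[OF assms] by (simp add: leading_def)
  finally show ?thesis
    using assms by (auto simp: monic_fls_iff minus_equation_iff)
qed

lemma monic_fls_powi: "monic_fls f \<Longrightarrow> monic_fls (f powi k)"
proof -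
  have "monic_fls (g ^ m)" if "monic_fls g" for m and g :: "'a fls"
    using that by (induction m) (simp_all add: monic_fls_one monic_fls_mult)
  then show "monic_fls f \<Longrightarrow> monic_fls (f powi k)"
    by (simp add: power_int_def monic_fls_inverse)
qed

lemma monic_fls_prod: "(\<And>i. i \<in> I \<Longrightarrow> monic_fls (f i)) \<Longrightarrow> monic_fls (prod f I)"
  by (induction I rule: infinite_finite_induct) (simp_all add: monic_fls_one monic_fls_mult)

lemma field_hom_fls_of_ratfun: "field_hom (fls_of_ratfun :: 'a::field poly fract \<Rightarrow> 'a fls)"
proof
  let ?e = "\<lambda>p :: 'a poly. fps_to_fls (fps_of_poly p)"
  fix x y :: "'a poly fract"
  obtain p q where x: "x = Fract p q" "q \<noteq> 0" by (cases x)
  obtain r s where y: "y = Fract r s" "s \<noteq> 0" by (cases y)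
  have nz: "?e q \<noteq> 0" "?e s \<noteq> 0" "q * s \<noteq> 0"
    using x y by simp_all
  have e_mult: "?e (a * b) = ?e a * ?e b" and e_add: "?e (a + b) = ?e a + ?e b" for a b
    by (simp_all add: fps_of_poly_mult fls_times_fps_to_fls fps_of_poly_add)
  show "fls_of_ratfun (x * y) = fls_of_ratfun x * fls_of_ratfun y"
    using fls_of_ratfun_Fract[OF nz(3), of "p * r"]
    by (simp add: x y fls_of_ratfun_Fract e_mult)
  show "fls_of_ratfun (x + y) = fls_of_ratfun x + fls_of_ratfun y"
    using fls_of_ratfun_Fract[OF nz(3), of "p * s + r * q"] nz
    by (simp add: x y fls_of_ratfun_Fract e_mult e_add add_frac_eq)
  show "fls_of_ratfun (1 :: 'a poly fract) = 1"
    unfolding One_fract_def by (simp add: fls_of_ratfun_Fract)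
  show "fls_of_ratfun (0 :: 'a poly fract) = 0"
    unfolding Zero_fract_def by (simp add: fls_of_ratfun_Fract)
qed

lemma fls_of_ratfun_power_int:
  "fls_of_ratfun (x powi k) = (fls_of_ratfun x powi k :: 'f::field fls)"
proof -
  interpret \<phi>: field_hom "fls_of_ratfun :: 'f poly fract \<Rightarrow> 'f fls" by (rule field_hom_fls_of_ratfun)
  show ?thesis by (simp add: power_int_def \<phi>.hom_power \<phi>.hom_inverse)
qed

lemma monic_fls_of_ratfun_t: "monic_fls (fls_of_ratfun ratfun_t :: 'a::field fls)"
  unfolding ratfun_t_def fls_of_ratfun_Fract[OF one_neq_zero]
  by (simp add: fps_of_poly_pCons monic_fls_def)

lemma fls_of_ratfun_ratfun_t: "fls_of_ratfun ratfun_t = (fls_X :: 'a::field fls)"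
  unfolding ratfun_t_def fls_of_ratfun_Fract[OF one_neq_zero]
  by (simp add: fps_of_poly_pCons)

unbundle no vec_syntax
no_notation fps_nth (infixl \<open>$\<close> 75)

section \<open>Matrices over a Euclidean domain\<close>

text \<open>
  An identity block of size \<open>s\<close> in the upper right corner: the first \<open>s\<close> basis vectors of the target are
  the images of the last \<open>s\<close> basis vectors of the source.
\<close>

definition partial_identity :: "nat \<Rightarrow> nat \<Rightarrow> nat \<Rightarrow> 'r::comm_ring_1 Matrix.mat" where
  "partial_identity m N s = Matrix.mat m N (\<lambda>(i, j). if i < s \<and> j = i + (N - s) then 1 else 0)"

lemma partial_identity_carrier [simp]: "partial_identity m N s \<in> carrier_mat m N"
  by (simp add: partial_identity_def)

lemma mult_mat_entry:
  assumes "A \<in> carrier_mat n k" "B \<in> carrier_mat k m" "i < n" "j < m"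
  shows "(A * B) $$ (i, j) = (\<Sum>l<k. A $$ (i, l) * B $$ (l, j))"
  using assms by (simp add: scalar_prod_def atLeast0LessThan)

lemma mult_vec_entry:
  assumes "A \<in> carrier_mat n k" "v \<in> carrier_vec k" "i < n"
  shows "(A *\<^sub>v v) $ i = (\<Sum>l<k. A $$ (i, l) * v $ l)"
  using assms by (simp add: scalar_prod_def atLeast0LessThan)

lemma mult_unit_vec_entry:
  assumes "A \<in> carrier_mat n k" "i < n" "j < k"
  shows "(A *\<^sub>v unit_vec k j) $ i = (A $$ (i, j) :: 'a::semiring_1)"
  using assms by simp

text \<open>
  Among all multiples \<open>U * A\<close> with \<open>U\<close> invertible, take one whose column has minimal total weight. Two
  nonzero entries would allow a division step that lowers the weight, so at most one entry is nonzero,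
  and a swap moves it to the last row.
\<close>

lemma clear_column:
  fixes A :: "'r::idom Matrix.mat" and size :: "'r \<Rightarrow> nat"
  assumes euclid: "\<And>a b. b \<noteq> 0 \<Longrightarrow> \<exists>q. a - q * b = 0 \<or> size (a - q * b) < size b"
    and A: "A \<in> carrier_mat (Suc N) m" and c: "c < m"
  shows "\<exists>U\<in>carrier_mat (Suc N) (Suc N). Determinant.det U dvd 1 \<and> (\<forall>i<N. (U * A) $$ (i, c) = 0)"
proof -
  \<comment> \<open>the weight of a zero entry is below that of every nonzero entry, even of size zero\<close>
  define weight where "weight x = (if x = 0 then 0 else Suc (size x))" for x
  define \<mu> where "\<mu> B = (\<Sum>i<Suc N. weight (B $$ (i, c)))" for B :: "'r Matrix.mat"
  define units where "units = {U \<in> carrier_mat (Suc N) (Suc N). Determinant.det (U :: 'r Matrix.mat) dvd 1}"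
  have "1\<^sub>m (Suc N) \<in> units" by (simp add: units_def)
  then obtain U where U: "U \<in> units" and least: "\<And>V. V \<in> units \<Longrightarrow> \<mu> (U * A) \<le> \<mu> (V * A)"
    using ex_has_least_nat[of "\<lambda>U. U \<in> units" _ "\<lambda>U. \<mu> (U * A)"] by blast
  define B where "B = U * A"
  have UC: "U \<in> carrier_mat (Suc N) (Suc N)" and dU: "Determinant.det U dvd 1"
    using U by (auto simp: units_def)
  have B: "B \<in> carrier_mat (Suc N) m" using UC A by (simp add: B_def)
  have no_pair: False
    if kl: "k < Suc N" "l < Suc N" "k \<noteq> l" "B $$ (k, c) \<noteq> 0" "B $$ (l, c) \<noteq> 0"
      "size (B $$ (l, c)) \<le> size (B $$ (k, c))" for k l
  proof -
    obtain q where q: "B $$ (k, c) - q * B $$ (l, c) = 0 \<or>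
        size (B $$ (k, c) - q * B $$ (l, c)) < size (B $$ (l, c))"
      using euclid[OF kl(5)] by blast
    define V where "V = addrow_mat (Suc N) (- q) k l * U"
    have "V \<in> units"
      using kl UC dU mult_carrier_mat[OF addrow_mat_carrier UC]
      by (simp add: units_def V_def det_mult[of _ "Suc N"] det_addrow_mat)
    have VA: "V * A = addrow (- q) k l B"
      using addrow_mat[OF B kl(2), of "- q" k] A UC
      by (simp add: V_def B_def assoc_mult_mat[OF addrow_mat_carrier UC A])
    have entry: "(V * A) $$ (i, c) = (if i = k then B $$ (k, c) - q * B $$ (l, c) else B $$ (i, c))"
      if "i < Suc N" for i
      using that B c kl by (simp add: VA)
    have "\<mu> (V * A) < \<mu> B"
      unfolding \<mu>_def
    proof (rule sum_strict_mono_ex1)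
      have less: "weight ((V * A) $$ (k, c)) < weight (B $$ (k, c))"
        using q kl by (auto simp: entry weight_def)
      show "\<forall>i\<in>{..<Suc N}. weight ((V * A) $$ (i, c)) \<le> weight (B $$ (i, c))"
        using less entry by (metis lessThan_iff order.refl order.strict_implies_order)
      show "\<exists>i\<in>{..<Suc N}. weight ((V * A) $$ (i, c)) < weight (B $$ (i, c))"
        using less kl(1) by blast
    qed simp
    with least[OF \<open>V \<in> units\<close>] show False by (simp add: B_def)
  qed
  then have unique: "k = l" if "k < Suc N" "l < Suc N" "B $$ (k, c) \<noteq> 0" "B $$ (l, c) \<noteq> 0" for k l
    using that by (metis nat_le_linear)
  show ?thesis
  proof (cases "\<exists>k<N. B $$ (k, c) \<noteq> 0")
    case False
    then show ?thesis using UC dU unfolding B_def by blast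
  next
    case True
    then obtain k where k: "k < N" "B $$ (k, c) \<noteq> 0" by blast
    define V where "V = swaprows_mat (Suc N) k N * U"
    have V: "V \<in> carrier_mat (Suc N) (Suc N)" "Determinant.det V dvd 1"
      using k UC dU mult_carrier_mat[OF swaprows_mat_carrier UC]
      by (simp_all add: V_def det_mult[of _ "Suc N"] det_swaprows_mat)
    have VA: "V * A = swaprows k N B"
      using swaprows_mat[OF B, of k N] k A UC
      by (simp add: V_def B_def assoc_mult_mat[OF swaprows_mat_carrier UC A])
    have "(V * A) $$ (i, c) = 0" if "i < N" for i
      using that B c k unique[of k i] unique[of k N] by (auto simp: VA)
    then show ?thesis using V by blast
  qed
qed

text \<open>
  Induction on the number of columns: once the last column is cleared above its last entry, the rest of
  the problem concerns the matrix with last row and last column removed.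
\<close>

lemma clear_upper_rows:
  fixes A :: "'r::idom Matrix.mat" and size :: "'r \<Rightarrow> nat"
  assumes euclid: "\<And>a b. b \<noteq> 0 \<Longrightarrow> \<exists>q. a - q * b = 0 \<or> size (a - q * b) < size b"
    and "A \<in> carrier_mat N m" and "m \<le> N"
  shows "\<exists>U\<in>carrier_mat N N. Determinant.det U dvd 1 \<and> (\<forall>i<N - m. \<forall>j<m. (U * A) $$ (i, j) = 0)"
  using assms(2,3)
proof (induction m arbitrary: A N)
  case 0
  then show ?case by (intro bexI[of _ "1\<^sub>m N"]) auto
next
  case (Suc m)
  then obtain n where N: "N = Suc n" "m \<le> n" by (cases N) auto
  obtain U where U: "U \<in> carrier_mat (Suc n) (Suc n)" "Determinant.det U dvd 1"
      "\<And>i. i < n \<Longrightarrow> (U * A) $$ (i, m) = 0"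
    using clear_column[OF euclid, of A n "Suc m" m] Suc.prems N by auto
  define A' where "A' = Matrix.mat n m (\<lambda>(i, j). (U * A) $$ (i, j))"
  have A': "A' \<in> carrier_mat n m" by (simp add: A'_def)
  obtain V where V: "V \<in> carrier_mat n n" "Determinant.det V dvd 1"
      "\<And>i j. i < n - m \<Longrightarrow> j < m \<Longrightarrow> (V * A') $$ (i, j) = 0"
    using Suc.IH[OF A' N(2)] by blast
  define W where "W = four_block_mat V (0\<^sub>m n 1) (0\<^sub>m 1 n) (1\<^sub>m 1)"
  have W: "W \<in> carrier_mat (Suc n) (Suc n)"
    using V(1) unfolding W_def by (metis four_block_carrier_mat one_carrier_mat Suc_eq_plus1)
  have "Determinant.det W = Determinant.det V"
    unfolding W_def using V(1) by (subst det_four_block_mat_lower_left_zero[of _ n _ 1]) auto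
  then have det: "Determinant.det (W * U) dvd 1"
    using det_mult[OF W U(1)] U(2) V(2) by simp
  have UA: "U * A \<in> carrier_mat (Suc n) (Suc m)" using U(1) Suc.prems(1) N by simp
  have entry: "(W * (U * A)) $$ (i, j) = (\<Sum>k<n. V $$ (i, k) * (U * A) $$ (k, j))"
    if "i < n" "j < Suc m" for i j
  proof -
    have "(W * (U * A)) $$ (i, j) = (\<Sum>k<Suc n. W $$ (i, k) * (U * A) $$ (k, j))"
      using that by (intro mult_mat_entry[OF W UA]) auto
    also have "\<dots> = (\<Sum>k<n. V $$ (i, k) * (U * A) $$ (k, j))"
      using V(1) that by (simp add: W_def)
    finally show ?thesis .
  qed
  have "(W * U * A) $$ (i, j) = 0" if "i < N - Suc m" "j < Suc m" for i j
  proof -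
    have i: "i < n" "i < n - m" using that N by auto
    have "W * U * A = W * (U * A)" using W U(1) Suc.prems(1) N by (intro assoc_mult_mat) auto
    moreover have "(\<Sum>k<n. V $$ (i, k) * (U * A) $$ (k, j)) = 0"
    proof (cases "j = m")
      case True
      then show ?thesis using U(3) by simp
    next
      case False
      then have "(\<Sum>k<n. V $$ (i, k) * (U * A) $$ (k, j)) = (V * A') $$ (i, j)"
        using V(1) i that by (simp add: A'_def scalar_prod_def atLeast0LessThan)
      then show ?thesis using V(3)[OF i(2)] False that by simp
    qed
    ultimately show ?thesis using entry[OF i(1)] that by simp
  qed
  then show ?case using det W U(1) N by (intro bexI[of _ "W * U"]) auto
qed

text \<open>
  Padding by zeros to square matrices keeps the product equal to the identity, but the padded left
  factor has a zero column and hence determinant zero.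
\<close>

lemma right_inverse_imp_wide:
  fixes A :: "'r::idom Matrix.mat"
  assumes A: "A \<in> carrier_mat m N" and X: "X \<in> carrier_mat N m" and AX: "A * X = 1\<^sub>m m"
  shows "m \<le> N"
proof (rule ccontr)
  assume "\<not> m \<le> N"
  then have N: "N < m" by simp
  define A' where "A' = Matrix.mat m m (\<lambda>(i, j). if j < N then A $$ (i, j) else 0)"
  define X' where "X' = Matrix.mat m m (\<lambda>(i, j). if i < N then X $$ (i, j) else 0)"
  have carr: "A' \<in> carrier_mat m m" "X' \<in> carrier_mat m m" by (simp_all add: A'_def X'_def)
  have "A' * X' = 1\<^sub>m m"
  proof (rule eq_matI)
    fix i j assume ij: "i < dim_row (1\<^sub>m m :: 'r mat)" "j < dim_col (1\<^sub>m m :: 'r mat)"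
    have "(A' * X') $$ (i, j) = (\<Sum>k<m. if k < N then A $$ (i, k) * X $$ (k, j) else 0)"
      using ij carr by (simp add: scalar_prod_def atLeast0LessThan A'_def X'_def, intro sum.cong) auto
    also have "\<dots> = (\<Sum>k<N. A $$ (i, k) * X $$ (k, j))"
      using N by (intro sum.mono_neutral_cong_right) auto
    also have "\<dots> = (A * X) $$ (i, j)"
      using ij A X by (simp add: scalar_prod_def atLeast0LessThan)
    finally show "(A' * X') $$ (i, j) = 1\<^sub>m m $$ (i, j)" using AX by simp
  qed (use carr in auto)
  then have "Determinant.det A' \<noteq> 0"
    using det_mult[OF carr] by auto
  moreover have "A' *\<^sub>v unit_vec m N = 0\<^sub>v m"
    using N carr by (intro eq_vecI) (auto simp: A'_def)
  moreover have "unit_vec m N \<noteq> (0\<^sub>v m :: 'r Matrix.vec)" using N by simp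
  ultimately show False
    using det_0_iff_vec_prod_zero[OF carr(1)] by (metis unit_vec_carrier)
qed

text \<open>
  The inverse is the adjugate divided by the determinant.
\<close>

lemma det_unit_imp_invertible:
  fixes A :: "'r::comm_ring_1 Matrix.mat"
  assumes "A \<in> carrier_mat n n" and "Determinant.det A dvd 1"
  obtains B where "B \<in> carrier_mat n n" "A * B = 1\<^sub>m n" "B * A = 1\<^sub>m n"
proof -
  obtain d where d: "1 = Determinant.det A * d" using assms(2) by (elim dvdE)
  show ?thesis
  proof
    show "d \<cdot>\<^sub>m adj_mat A \<in> carrier_mat n n" using adj_mat(1)[OF assms(1)] by simp
    show "A * (d \<cdot>\<^sub>m adj_mat A) = 1\<^sub>m n" "d \<cdot>\<^sub>m adj_mat A * A = 1\<^sub>m n"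
      using adj_mat[OF assms(1)] assms(1) d
      by (auto simp: mult_smult_distrib[OF assms(1)] mult_smult_assoc_mat[of _ n n] mult.commute
          intro!: eq_matI)
  qed
qed

lemma sum_lessThan_add: "(\<Sum>k<p + m. f k) = (\<Sum>k<p. f k) + (\<Sum>k<m. f (p + k) :: 'a::comm_monoid_add)"
  for p m :: nat
  by (induction m) (simp_all add: add.assoc)

lemma partial_identity_mult_entry:
  assumes "A \<in> carrier_mat N n" "i < m" "j < n" "s \<le> N" "s \<le> m"
  shows "(partial_identity m N s * A) $$ (i, j) = (if i < s then A $$ (N - s + i, j) else 0)"
proof -
  have "(partial_identity m N s * A) $$ (i, j) = (\<Sum>l<N. partial_identity m N s $$ (i, l) * A $$ (l, j))"
    using assms by (intro mult_mat_entry) auto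
  also have "\<dots> = (\<Sum>l<N. if l = N - s + i then (if i < s then A $$ (l, j) else 0) else 0)"
    using assms by (intro sum.cong) (auto simp: partial_identity_def)
  also have "\<dots> = (if i < s then A $$ (N - s + i, j) else 0)"
    using assms by (auto simp: sum.delta)
  finally show ?thesis .
qed

lemma mult_partial_identity_entry:
  assumes "A \<in> carrier_mat n m" "i < n" "j < s" "s \<le> N" "s \<le> m"
  shows "(A * partial_identity m N s) $$ (i, N - s + j) = A $$ (i, j)"
proof -
  have "(A * partial_identity m N s) $$ (i, N - s + j) =
      (\<Sum>l<m. A $$ (i, l) * partial_identity m N s $$ (l, N - s + j))"
    using assms by (intro mult_mat_entry[OF _ partial_identity_carrier]) auto
  also have "\<dots> = (\<Sum>l<m. if l = j then A $$ (i, l) else 0)"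
    using assms by (intro sum.cong) (auto simp: partial_identity_def)
  also have "\<dots> = A $$ (i, j)"
    using assms by (auto simp: sum.delta)
  finally show ?thesis .
qed

text \<open>
  Clearing columns of the transpose gives \<open>A * V = [0, L]\<close> with \<open>L\<close> square. A right inverse of \<open>A\<close> provides one
  of \<open>L\<close>, so \<open>L\<close> is invertible and can be absorbed into \<open>V\<close>.
\<close>

lemma right_invertible_normal_form:
  fixes A :: "'r::idom Matrix.mat" and size :: "'r \<Rightarrow> nat"
  assumes euclid: "\<And>a b. b \<noteq> 0 \<Longrightarrow> \<exists>q. a - q * b = 0 \<or> size (a - q * b) < size b"
    and A: "A \<in> carrier_mat m N" and X: "X \<in> carrier_mat N m" and AX: "A * X = 1\<^sub>m m"
  shows "m \<le> N" "\<exists>V\<in>carrier_mat N N. Determinant.det V dvd 1 \<and> A * V = partial_identity m N m"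
proof -
  show "m \<le> N" by (rule right_inverse_imp_wide[OF A X AX])
  then obtain p where N: "N = p + m" by (metis le_add_diff_inverse2)
  obtain U where U: "U \<in> carrier_mat N N" "Determinant.det U dvd 1"
      "\<And>i j. i < p \<Longrightarrow> j < m \<Longrightarrow> (U * transpose_mat A) $$ (i, j) = 0"
    using clear_upper_rows[OF euclid, of "transpose_mat A" N m] A \<open>m \<le> N\<close> N by auto
  define V where "V = transpose_mat U"
  have V: "V \<in> carrier_mat N N" "Determinant.det V dvd 1"
    using U by (simp_all add: V_def det_transpose)
  have AV: "A * V \<in> carrier_mat m N" using A V by simp
  have zero: "(A * V) $$ (i, j) = 0" if "i < m" "j < p" for i j
  proof -
    have "A * V = transpose_mat (U * transpose_mat A)"
      using transpose_mult[OF U(1), of "transpose_mat A" m] A by (simp add: V_def)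
    then show ?thesis using U(3)[of j i] that A U(1) N by simp
  qed
  define L where "L = Matrix.mat m m (\<lambda>(i, j). (A * V) $$ (i, p + j))"
  have L: "L \<in> carrier_mat m m" by (simp add: L_def)
  obtain V' where V': "V' \<in> carrier_mat N N" "V * V' = 1\<^sub>m N"
    using det_unit_imp_invertible[OF V] by blast
  define Y where "Y = Matrix.mat m m (\<lambda>(i, j). (V' * X) $$ (p + i, j))"
  have V'X: "V' * X \<in> carrier_mat N m" using V' X by simp
  have split: "(A * V * Z) $$ (i, j) = (\<Sum>k<m. L $$ (i, k) * Z $$ (p + k, j))"
    if "Z \<in> carrier_mat N n" "i < m" "j < n" for Z n i j
    using that AV zero by (simp add: mult_mat_entry[OF AV] N sum_lessThan_add L_def)
  have "L * Y = 1\<^sub>m m"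
  proof (rule eq_matI)
    fix i j assume ij: "i < dim_row (1\<^sub>m m :: 'r mat)" "j < dim_col (1\<^sub>m m :: 'r mat)"
    have "(L * Y) $$ (i, j) = (A * V * (V' * X)) $$ (i, j)"
      using ij split[OF V'X, of i j] by (subst mult_mat_entry[OF L, of _ m]) (simp_all add: Y_def)
    also have "A * V * (V' * X) = A * (V * V') * X"
      using assoc_mult_mat[OF A V(1) V'X] assoc_mult_mat[OF V(1) V'(1) X]
        assoc_mult_mat[OF A mult_carrier_mat[OF V(1) V'(1)] X] by simp
    also have "\<dots> = 1\<^sub>m m" using A AX V' by simp
    finally show "(L * Y) $$ (i, j) = 1\<^sub>m m $$ (i, j)" .
  qed (simp_all add: L_def Y_def)
  then have "Determinant.det L * Determinant.det Y = 1"
    using det_mult[of L m Y] by (simp add: L_def Y_def)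
  then obtain L' where L': "L' \<in> carrier_mat m m" "L * L' = 1\<^sub>m m" "L' * L = 1\<^sub>m m"
    using det_unit_imp_invertible[OF L] by (metis dvdI)
  have "Determinant.det L' * Determinant.det L = 1"
    using det_mult[of L' m L] L L' by simp
  then have dL': "Determinant.det L' dvd 1" by (metis dvdI)
  define W where "W = four_block_mat (1\<^sub>m p) (0\<^sub>m p m) (0\<^sub>m m p) L'"
  have W: "W \<in> carrier_mat N N" using L'(1) unfolding W_def N by (rule four_block_carrier_mat[OF one_carrier_mat])
  have "Determinant.det W = Determinant.det L'"
    unfolding W_def using L'(1) by (subst det_four_block_mat_lower_left_zero[of _ p _ m]) auto
  then have "Determinant.det (V * W) dvd 1"
    using det_mult[OF V(1) W] V(2) dL' by simp
  moreover have "A * (V * W) = partial_identity m N m"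
  proof (rule eq_matI)
    fix i j assume "i < dim_row (partial_identity m N m :: 'r mat)"
      "j < dim_col (partial_identity m N m :: 'r mat)"
    then have ij: "i < m" "j < N" by (simp_all add: partial_identity_def)
    have "(A * (V * W)) $$ (i, j) = (\<Sum>k<m. L $$ (i, k) * W $$ (p + k, j))"
      using split[OF W] ij assoc_mult_mat[OF A V(1) W] by simp
    also have "\<dots> = (if j < p then 0 else (L * L') $$ (i, j - p))"
      using ij L'(1) N by (cases "j < p") (simp_all add: W_def mult_mat_entry[OF L L'(1)] del: index_mult_mat(1))
    also have "\<dots> = partial_identity m N m $$ (i, j)"
      using ij L' N by (auto simp: partial_identity_def)
    finally show "(A * (V * W)) $$ (i, j) = partial_identity m N m $$ (i, j)" .
  qed (use A V W in \<open>auto simp: partial_identity_def\<close>)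
  ultimately show "\<exists>V\<in>carrier_mat N N. Determinant.det V dvd 1 \<and> A * V = partial_identity m N m"
    using V W by (intro bexI[of _ "V * W"]) auto
qed

section \<open>Exact complexes over a Euclidean domain\<close>

abbreviation first_columns_span :: "'r::comm_ring_1 Matrix.mat \<Rightarrow> nat \<Rightarrow> nat \<Rightarrow> 'r Matrix.vec set" where
  "first_columns_span V n s \<equiv> {V *\<^sub>v y | y. y \<in> carrier_vec n \<and> (\<forall>i. s \<le> i \<and> i < n \<longrightarrow> y $ i = 0)}"

text \<open>
  The inductive step of the normal form. Exactness says that the image of \<open>D\<close> is the space of cycles, which
  the previous step describes as the span of the first \<open>s\<close> columns of \<open>V\<close>. In these coordinates \<open>D\<close> is a
  right invertible matrix above zero rows; its normal form provides the next base change \<open>W\<close>, and the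
  kernel is visibly the span of the first columns of \<open>W\<close>.
\<close>

lemma extend_normal_form:
  fixes D :: "'r::idom Matrix.mat" and size :: "'r \<Rightarrow> nat"
  assumes euclid: "\<And>a b. b \<noteq> 0 \<Longrightarrow> \<exists>q. a - q * b = 0 \<or> size (a - q * b) < size b"
    and D: "D \<in> carrier_mat n N" and V: "V \<in> carrier_mat n n" "Determinant.det V dvd 1" and s: "s \<le> n"
    and image: "{D *\<^sub>v x | x. x \<in> carrier_vec N} =
      first_columns_span V n s"
  shows "s \<le> N" "\<exists>W\<in>carrier_mat N N. Determinant.det W dvd 1 \<and> D * W = V * partial_identity n N s \<and>
    {x \<in> carrier_vec N. D *\<^sub>v x = 0\<^sub>v n} =
    first_columns_span W N (N - s)"
proof -
  obtain V' where V': "V' \<in> carrier_mat n n" "V * V' = 1\<^sub>m n" "V' * V = 1\<^sub>m n"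
    using det_unit_imp_invertible[OF V] by blast
  have cancel: "V' *\<^sub>v (V *\<^sub>v y) = y" if "y \<in> carrier_vec n" for y
    using that V V' by (metis assoc_mult_mat_vec one_mult_mat_vec)
  have V'D: "V' * D \<in> carrier_mat n N" using V' D by simp
  have lower: "(V' * D) $$ (i, j) = 0" if "s \<le> i" "i < n" "j < N" for i j
  proof -
    have "D *\<^sub>v unit_vec N j \<in> {D *\<^sub>v x | x. x \<in> carrier_vec N}" by auto
    then have "D *\<^sub>v unit_vec N j \<in> first_columns_span V n s"
      by (simp only: image)
    then obtain y where y: "D *\<^sub>v unit_vec N j = V *\<^sub>v y" "y \<in> carrier_vec n"
        "\<forall>i. s \<le> i \<and> i < n \<longrightarrow> y $ i = 0"
      by (elim CollectE exE conjE) simp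
    have "(V' * D) *\<^sub>v unit_vec N j = y"
      unfolding assoc_mult_mat_vec[OF V'(1) D unit_vec_carrier] y(1) by (rule cancel[OF y(2)])
    moreover have "((V' * D) *\<^sub>v unit_vec N j) $ i = (V' * D) $$ (i, j)"
      using mult_unit_vec_entry[OF V'D that(2,3)] .
    ultimately show ?thesis using y that by simp
  qed
  define A where "A = Matrix.mat s N (\<lambda>(i, j). (V' * D) $$ (i, j))"
  have A: "A \<in> carrier_mat s N" by (simp add: A_def)
  have A_entry: "A $$ (i, j) = (V' * D) $$ (i, j)" if "i < s" "j < N" for i j
    using that by (simp add: A_def)
  have A_mult: "(A * Z) $$ (i, j) = (V' * D * Z) $$ (i, j)"
    if "Z \<in> carrier_mat N m" "i < s" "j < m" for Z m i j
    using that s A_entry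
    by (simp add: mult_mat_entry[OF A that(1)] mult_mat_entry[OF V'D that(1)] del: index_mult_mat(1))
  have "\<exists>x\<in>carrier_vec N. D *\<^sub>v x = V *\<^sub>v unit_vec n j" if "j < s" for j
  proof -
    have "V *\<^sub>v unit_vec n j \<in> first_columns_span V n s"
      using that s by (auto intro!: exI[of _ "unit_vec n j"])
    then show ?thesis using image[symmetric] by auto
  qed
  then obtain x where x: "\<And>j. j < s \<Longrightarrow> x j \<in> carrier_vec N" "\<And>j. j < s \<Longrightarrow> D *\<^sub>v x j = V *\<^sub>v unit_vec n j"
    by metis
  define X where "X = Matrix.mat N s (\<lambda>(i, j). x j $ i)"
  have X: "X \<in> carrier_mat N s" by (simp add: X_def)
  have X_entry: "X $$ (i, j) = x j $ i" if "i < N" "j < s" for i j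
    using that by (simp add: X_def)
  have "A * X = 1\<^sub>m s"
  proof (rule eq_matI)
    fix i j assume "i < dim_row (1\<^sub>m s :: 'r mat)" "j < dim_col (1\<^sub>m s :: 'r mat)"
    then have ij: "i < s" "j < s" by simp_all
    have "(A * X) $$ (i, j) = ((V' * D) *\<^sub>v x j) $ i"
      using ij s x(1)[of j]
      by (simp add: A_mult[OF X] mult_mat_entry[OF V'D X] mult_vec_entry[OF V'D x(1)] X_entry
          del: index_mult_mat(1) index_mult_mat_vec)
    also have "(V' * D) *\<^sub>v x j = unit_vec n j"
      unfolding assoc_mult_mat_vec[OF V'(1) D x(1)[OF ij(2)]] x(2)[OF ij(2)]
      by (rule cancel[OF unit_vec_carrier])
    finally show "(A * X) $$ (i, j) = 1\<^sub>m s $$ (i, j)" using ij s by simp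
  qed (simp_all add: A_def X_def)
  note nf = right_invertible_normal_form[OF euclid A X this]
  show "s \<le> N" by (rule nf(1))
  obtain W where W: "W \<in> carrier_mat N N" "Determinant.det W dvd 1" "A * W = partial_identity s N s"
    using nf(2) by blast
  have "V' * D * W = partial_identity n N s"
  proof (rule eq_matI)
    fix i j assume "i < dim_row (partial_identity n N s :: 'r mat)" "j < dim_col (partial_identity n N s :: 'r mat)"
    then have ij: "i < n" "j < N" by (simp_all add: partial_identity_def)
    show "(V' * D * W) $$ (i, j) = partial_identity n N s $$ (i, j)"
    proof (cases "i < s")
      case True
      then have "(V' * D * W) $$ (i, j) = (A * W) $$ (i, j)"
        using A_mult[OF W(1)] ij by simp
      then show ?thesis using True ij W(3) by (simp add: partial_identity_def)
    next
      case False
      then show ?thesis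
        using ij lower
        by (simp add: mult_mat_entry[OF V'D W(1)] partial_identity_def del: index_mult_mat(1))
    qed
  qed (use V' D W in \<open>auto simp: partial_identity_def\<close>)
  moreover have "V * (V' * D * W) = D * W"
    using assoc_mult_mat[OF V'(1) D W(1)] assoc_mult_mat[OF V(1) V'(1) mult_carrier_mat[OF D W(1)]]
      V'(2) left_mult_one_mat[OF mult_carrier_mat[OF D W(1)]] by simp
  ultimately have DW: "D * W = V * partial_identity n N s" by simp
  obtain W' where W': "W' \<in> carrier_mat N N" "W * W' = 1\<^sub>m N"
    using det_unit_imp_invertible[OF W(1,2)] by blast
  have pv: "partial_identity n N s *\<^sub>v y = 0\<^sub>v n \<longleftrightarrow> (\<forall>i. N - s \<le> i \<and> i < N \<longrightarrow> y $ i = 0)"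
    if y: "y \<in> carrier_vec N" for y :: "'r Matrix.vec"
  proof -
    have "(partial_identity n N s *\<^sub>v y) $ i = (if i < s then y $ (N - s + i) else 0)" if "i < n" for i
    proof -
      have "(partial_identity n N s *\<^sub>v y) $ i = (\<Sum>l<N. partial_identity n N s $$ (i, l) * y $ l)"
        using y that by (intro mult_vec_entry) auto
      also have "\<dots> = (\<Sum>l<N. if l = N - s + i then (if i < s then y $ l else 0) else 0)"
        using that by (intro sum.cong) (auto simp: partial_identity_def)
      also have "\<dots> = (if i < s then y $ (N - s + i) else 0)"
        using nf(1) by (auto simp: sum.delta)
      finally show ?thesis .
    qed
    then have "partial_identity n N s *\<^sub>v y = 0\<^sub>v n \<longleftrightarrow> (\<forall>i<n. (if i < s then y $ (N - s + i) else 0) = 0)"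
      by (auto simp: vec_eq_iff partial_identity_def)
    also have "\<dots> \<longleftrightarrow> (\<forall>i. N - s \<le> i \<and> i < N \<longrightarrow> y $ i = 0)"
    proof
      assume *: "\<forall>i<n. (if i < s then y $ (N - s + i) else 0) = 0"
      show "\<forall>i. N - s \<le> i \<and> i < N \<longrightarrow> y $ i = 0"
      proof (intro allI impI)
        fix i assume "N - s \<le> i \<and> i < N"
        then have "i - (N - s) < s" "N - s + (i - (N - s)) = i" using nf(1) by auto
        then show "y $ i = 0" using * s by (metis less_le_trans)
      qed
    next
      assume *: "\<forall>i. N - s \<le> i \<and> i < N \<longrightarrow> y $ i = 0"
      have "y $ (N - s + i) = 0" if "i < s" for i
        using that nf(1) by (intro *[rule_format]) linarith
      then show "\<forall>i<n. (if i < s then y $ (N - s + i) else 0) = 0" by simp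
    qed
    finally show ?thesis .
  qed
  have DWy: "D *\<^sub>v (W *\<^sub>v y) = 0\<^sub>v n \<longleftrightarrow> (\<forall>i. N - s \<le> i \<and> i < N \<longrightarrow> y $ i = 0)"
    if y: "y \<in> carrier_vec N" for y
  proof -
    have "D *\<^sub>v (W *\<^sub>v y) = V *\<^sub>v (partial_identity n N s *\<^sub>v y)"
      using assoc_mult_mat_vec[OF D W(1) y] assoc_mult_mat_vec[OF V(1) partial_identity_carrier y]
      by (simp only: DW)
    moreover have "V *\<^sub>v z = 0\<^sub>v n \<longleftrightarrow> z = 0\<^sub>v n" if "z \<in> carrier_vec n" for z
    proof
      assume "V *\<^sub>v z = 0\<^sub>v n"
      then have "z = V' *\<^sub>v 0\<^sub>v n" using cancel[OF that] by simp
      then show "z = 0\<^sub>v n" using V'(1) by (auto intro!: eq_vecI)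
    qed (use V(1) in \<open>auto intro!: eq_vecI\<close>)
    ultimately show ?thesis
      using pv[OF y] mult_mat_vec_carrier[OF partial_identity_carrier y] by simp
  qed
  have "x = W *\<^sub>v (W' *\<^sub>v x)" if "x \<in> carrier_vec N" for x
    using that W'(2) by (simp flip: assoc_mult_mat_vec[OF W(1) W'(1) that])
  then have "{x \<in> carrier_vec N. D *\<^sub>v x = 0\<^sub>v n} =
      first_columns_span W N (N - s)"
    using DWy W(1) W'(1) by (auto, metis mult_mat_vec_carrier)
  then show "\<exists>W\<in>carrier_mat N N. Determinant.det W dvd 1 \<and> D * W = V * partial_identity n N s \<and>
      {x \<in> carrier_vec N. D *\<^sub>v x = 0\<^sub>v n} =
      first_columns_span W N (N - s)"
    using W DW by blast
qed

text \<open>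
  Starting from degree \<open>0\<close>, where every vector is a cycle, bases are chosen degree by degree. Euclidean
  division enters because the modules of cycles have to be free, not merely projective.
\<close>

lemma exact_complex_normal_form:
  fixes D :: "nat \<Rightarrow> 'r::idom Matrix.mat" and size :: "'r \<Rightarrow> nat"
  assumes euclid: "\<And>a b. b \<noteq> 0 \<Longrightarrow> \<exists>q. a - q * b = 0 \<or> size (a - q * b) < size b"
    and D: "\<And>k. D k \<in> carrier_mat (N k) (N (Suc k))"
    and onto: "{D 0 *\<^sub>v x | x. x \<in> carrier_vec (N 1)} = carrier_vec (N 0)"
    and exact: "\<And>k. {D (Suc k) *\<^sub>v x | x. x \<in> carrier_vec (N (Suc (Suc k)))} =
      {x \<in> carrier_vec (N (Suc k)). D k *\<^sub>v x = 0\<^sub>v (N k)}"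
  obtains V s where "s 0 = N 0"
    "\<And>k. V k \<in> carrier_mat (N k) (N k)" "\<And>k. Determinant.det (V k) dvd 1"
    "\<And>k. s k \<le> N k" "\<And>k. s k \<le> N (Suc k)" "\<And>k. s (Suc k) = N (Suc k) - s k"
    "\<And>k. D k * V (Suc k) = V k * partial_identity (N k) (N (Suc k)) (s k)"
proof -
  define P where "P k = (\<lambda>(V, s). V \<in> carrier_mat (N k) (N k) \<and> Determinant.det V dvd 1 \<and> s \<le> N k \<and>
      (k = 0 \<longrightarrow> s = N 0) \<and>
      {D k *\<^sub>v x | x. x \<in> carrier_vec (N (Suc k))} =
      first_columns_span V (N k) s)" for k
  define Q where "Q k = (\<lambda>(V, s) (W, s'). s \<le> N (Suc k) \<and> s' = N (Suc k) - s \<and>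
      D k * W = V * partial_identity (N k) (N (Suc k)) s)" for k
  have "P 0 (1\<^sub>m (N 0), N 0)"
    using onto unfolding P_def by (auto intro: exI[of _ "_ :: 'r Matrix.vec"] one_mult_mat_vec[symmetric])
  moreover have "\<exists>y. P (Suc k) y \<and> Q k x y" if "P k x" for k x
  proof -
    obtain V s where x: "x = (V, s)" by (cases x)
    have p: "V \<in> carrier_mat (N k) (N k)" "Determinant.det V dvd 1" "s \<le> N k"
      "{D k *\<^sub>v x | x. x \<in> carrier_vec (N (Suc k))} =
       first_columns_span V (N k) s"
      using that unfolding P_def x by simp_all
    note step = extend_normal_form[OF euclid D p]
    obtain W where "W \<in> carrier_mat (N (Suc k)) (N (Suc k))" "Determinant.det W dvd 1"
        "D k * W = V * partial_identity (N k) (N (Suc k)) s"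
        "{x \<in> carrier_vec (N (Suc k)). D k *\<^sub>v x = 0\<^sub>v (N k)} = first_columns_span W (N (Suc k)) (N (Suc k) - s)"
      using step(2) by blast
    then have "P (Suc k) (W, N (Suc k) - s) \<and> Q k x (W, N (Suc k) - s)"
      using step(1) exact[of k] by (simp add: P_def Q_def x)
    then show ?thesis by blast
  qed
  ultimately obtain f where f: "\<And>k. P k (f k)" "\<And>k. Q k (f k) (f (Suc k))"
    using dependent_nat_choice[of P Q] by blast
  show ?thesis
    by (rule that[of "\<lambda>k. snd (f k)" "\<lambda>k. fst (f k)"])
      (use f in \<open>force simp: P_def Q_def split_beta\<close>)+
qed

section \<open>Torsion in terms of a normal form\<close>

definition beside :: "'r Matrix.mat \<Rightarrow> 'r Matrix.mat \<Rightarrow> 'r Matrix.mat" where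
  "beside A B = Matrix.mat (dim_row A) (dim_col A + dim_col B)
     (\<lambda>(i, j). if j < dim_col A then A $$ (i, j) else B $$ (i, j - dim_col A))"

lemma beside_carrier [simp]:
  "A \<in> carrier_mat n k \<Longrightarrow> B \<in> carrier_mat n l \<Longrightarrow> beside A B \<in> carrier_mat n (k + l)"
  by (auto simp: beside_def)

lemma mult_beside:
  assumes "V \<in> carrier_mat m n" "A \<in> carrier_mat n k" "B \<in> carrier_mat n l"
  shows "V * beside A B = beside (V * A) (V * B)"
proof (rule eq_matI)
  fix i j assume "i < dim_row (beside (V * A) (V * B))" "j < dim_col (beside (V * A) (V * B))"
  then have ij: "i < m" "j < k + l" using assms by (simp_all add: beside_def)
  have "col (beside A B) j = (if j < k then col A j else col B (j - k))"
    using ij assms by (intro eq_vecI) (auto simp: beside_def)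
  then show "(V * beside A B) $$ (i, j) = beside (V * A) (V * B) $$ (i, j)"
    using ij assms by (auto simp: beside_def)
qed (use assms in \<open>auto simp: beside_def\<close>)

text \<open>
  If \<open>Y\<close> is a left inverse of \<open>B\<close> that ignores the first \<open>p\<close> coordinates, then the lower blocks of \<open>B\<close> and of
  \<open>Y\<close> are inverse to each other. As both products are identities, the blocks are square.
\<close>

lemma complementary_block_invertible:
  fixes B Y :: "'r::idom Matrix.mat"
  assumes B: "B \<in> carrier_mat (p + r) l" and Y: "Y \<in> carrier_mat l (p + r)"
    and YB: "Y * B = 1\<^sub>m l"
    and zero: "\<And>i j. i < l \<Longrightarrow> j < p \<Longrightarrow> Y $$ (i, j) = 0"
    and BY: "\<And>i j. i < r \<Longrightarrow> j < r \<Longrightarrow> (B * Y) $$ (p + i, p + j) = 1\<^sub>m r $$ (i, j)"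
  shows "l = r" "Determinant.det (Matrix.mat r l (\<lambda>(i, j). B $$ (p + i, j))) \<noteq> 0"
proof -
  define G where "G = Matrix.mat r l (\<lambda>(i, j). B $$ (p + i, j))"
  define H where "H = Matrix.mat l r (\<lambda>(i, j). Y $$ (i, p + j))"
  have G: "G \<in> carrier_mat r l" and H: "H \<in> carrier_mat l r" by (simp_all add: G_def H_def)
  have Ge: "G $$ (i, j) = B $$ (p + i, j)" if "i < r" "j < l" for i j
    using that by (simp add: G_def)
  have He: "H $$ (i, j) = Y $$ (i, p + j)" if "i < l" "j < r" for i j
    using that by (simp add: H_def)
  have GH: "G * H = 1\<^sub>m r"
  proof (rule eq_matI)
    fix i j assume "i < dim_row (1\<^sub>m r :: 'r mat)" "j < dim_col (1\<^sub>m r :: 'r mat)"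
    then have ij: "i < r" "j < r" by simp_all
    then show "(G * H) $$ (i, j) = 1\<^sub>m r $$ (i, j)"
      using BY[OF ij]
      by (simp add: mult_mat_entry[OF G H] mult_mat_entry[OF B Y] Ge He del: index_mult_mat(1))
  qed (simp_all add: G_def H_def)
  have HG: "H * G = 1\<^sub>m l"
  proof (rule eq_matI)
    fix i j assume "i < dim_row (1\<^sub>m l :: 'r mat)" "j < dim_col (1\<^sub>m l :: 'r mat)"
    then have ij: "i < l" "j < l" by simp_all
    have "(H * G) $$ (i, j) = (Y * B) $$ (i, j)"
      using ij zero
      by (simp add: mult_mat_entry[OF H G] mult_mat_entry[OF Y B] Ge He sum_lessThan_add
          del: index_mult_mat(1))
    then show "(H * G) $$ (i, j) = 1\<^sub>m l $$ (i, j)" using YB by simp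
  qed (simp_all add: G_def H_def)
  show "l = r"
    using right_inverse_imp_wide[OF G H GH] right_inverse_imp_wide[OF H G HG] by simp
  then have "Determinant.det G * Determinant.det H = 1"
    using det_mult[of G r H] G H GH by simp
  then show "Determinant.det (Matrix.mat r l (\<lambda>(i, j). B $$ (p + i, j))) \<noteq> 0"
    unfolding G_def by auto
qed

text \<open>
  The columns of \<open>B (Suc k)\<close> play the role of the lifts \<open>b\<close> of a basis of the boundaries. The matrix \<open>Y (Suc k)\<close>
  maps a chain to the coordinates of its boundary in this basis. The three equations between \<open>B\<close>, \<open>Y\<close> and
  \<open>D\<close> express the basis property in a form that is inherited by larger rings. In the coordinates given by
  \<open>V k\<close>, the matrix with columns \<open>\<partial>b\<close> and \<open>b\<close> is block triangular; its diagonal blocks compare the given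
  bases of the boundaries in degrees \<open>k\<close> and \<open>k - 1\<close> with the standard ones, and \<open>g\<close> denotes the
  determinants of these comparison matrices.
\<close>

lemma torsion_factors:
  fixes D V B Y :: "nat \<Rightarrow> 'r::idom Matrix.mat"
  assumes s0: "s 0 = N 0"
    and V: "\<And>k. V k \<in> carrier_mat (N k) (N k)" "\<And>k. Determinant.det (V k) dvd 1"
    and s: "\<And>k. s k \<le> N k" "\<And>k. s k \<le> N (Suc k)" "\<And>k. s (Suc k) = N (Suc k) - s k"
    and D: "\<And>k. D k \<in> carrier_mat (N k) (N (Suc k))"
    and nf: "\<And>k. D k * V (Suc k) = V k * partial_identity (N k) (N (Suc k)) (s k)"
    and B: "\<And>k. B k \<in> carrier_mat (N k) (l k)"
    and Y: "\<And>k. Y k \<in> carrier_mat (l k) (N k)"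
    and l0: "l 0 = 0"
    and YB: "\<And>k. Y k * B k = 1\<^sub>m (l k)"
    and DBY: "\<And>k. D k * B (Suc k) * Y (Suc k) = D k"
    and YD: "\<And>k. Y k * D k = 0\<^sub>m (l k) (N (Suc k))"
  obtains g where "g 0 = 1" "\<And>k. g k \<noteq> 0" "\<And>k. N k = 0 \<Longrightarrow> g k = 1"
    "\<And>k. l (Suc k) + l k = N k"
    "\<And>k. Determinant.det (beside (D k * B (Suc k)) (B k)) = Determinant.det (V k) * (g (Suc k) * g k)"
proof -
  have "\<exists>W. W \<in> carrier_mat (N k) (N k) \<and> V k * W = 1\<^sub>m (N k) \<and> W * V k = 1\<^sub>m (N k)" for k
    using det_unit_imp_invertible[OF V] by metis
  then obtain W where W: "\<And>k. W k \<in> carrier_mat (N k) (N k)" "\<And>k. V k * W k = 1\<^sub>m (N k)"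
      "\<And>k. W k * V k = 1\<^sub>m (N k)"
    by metis
  define J where "J k = (partial_identity (N k) (N (Suc k)) (s k) :: 'r Matrix.mat)" for k
  have J: "J k \<in> carrier_mat (N k) (N (Suc k))" for k by (simp add: J_def)
  define b where "b k = W k * B k" for k
  define y where "y k = Y k * V k" for k
  have b: "b k \<in> carrier_mat (N k) (l k)" and y: "y k \<in> carrier_mat (l k) (N k)" for k
    using W(1)[of k] B[of k] Y[of k] V(1)[of k] by (simp_all add: b_def y_def)
  have WVX: "W k * (V k * X) = X" if "X \<in> carrier_mat (N k) m" for k m X
    using assoc_mult_mat[OF W(1) V(1) that] W(3) left_mult_one_mat[OF that] by simp
  have VWX: "V k * (W k * X) = X" if "X \<in> carrier_mat (N k) m" for k m X
    using assoc_mult_mat[OF V(1) W(1) that] W(2) left_mult_one_mat[OF that] by simp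
  have Db: "W k * (D k * B (Suc k)) = J k * b (Suc k)" for k
  proof -
    have "D k * B (Suc k) = D k * (V (Suc k) * b (Suc k))"
      using VWX[OF B] by (simp add: b_def)
    also have "\<dots> = V k * (J k * b (Suc k))"
      using assoc_mult_mat[OF D V(1) b, of k] assoc_mult_mat[OF V(1) J b, of k] nf[of k]
      by (simp add: J_def)
    finally show ?thesis using WVX[OF mult_carrier_mat[OF J b]] by simp
  qed
  have yb: "y k * b k = 1\<^sub>m (l k)" for k
  proof -
    have "y k * b k = Y k * (V k * b k)" by (simp add: y_def assoc_mult_mat[OF Y V(1) b])
    also have "V k * b k = B k" unfolding b_def by (rule VWX[OF B])
    finally show ?thesis using YB by simp
  qed
  have Jby: "J k * (b (Suc k) * y (Suc k)) = J k" for k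
  proof -
    note c = mult_carrier_mat[OF D B, of k]
    have "J k * (b (Suc k) * y (Suc k)) = W k * (D k * B (Suc k)) * y (Suc k)"
      using Db assoc_mult_mat[OF J b y] by simp
    also have "\<dots> = W k * (D k * B (Suc k) * Y (Suc k) * V (Suc k))"
      using assoc_mult_mat[OF W(1) c y] assoc_mult_mat[OF c Y V(1)] by (simp add: y_def)
    also have "\<dots> = W k * (V k * J k)" using nf by (simp add: DBY J_def)
    also have "\<dots> = J k" by (rule WVX[OF J])
    finally show ?thesis .
  qed
  have yJ: "y k * J k = 0\<^sub>m (l k) (N (Suc k))" for k
  proof -
    have "y k * J k = Y k * (V k * J k)" unfolding y_def by (rule assoc_mult_mat[OF Y V(1) J])
    also have "\<dots> = Y k * D k * V (Suc k)"
      using assoc_mult_mat[OF Y D V(1), of k] nf[of k] by (simp add: J_def)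
    also have "\<dots> = 0\<^sub>m (l k) (N (Suc k))" using V(1)[of "Suc k"] by (simp add: YD)
    finally show ?thesis .
  qed
  have zero: "y k $$ (i, j) = 0" if "i < l k" "j < s k" for k i j
    using mult_partial_identity_entry[OF y[of k] that s(2)[of k] s(1)[of k]] yJ[of k] that s(1,2)[of k]
    by (simp add: J_def del: index_mult_mat(1))
  define r where "r k = N k - s k" for k
  have N: "N k = s k + r k" for k using s(1)[of k] by (simp add: r_def)
  have r_Suc: "r (Suc k) = s k" for k using s(2)[of k] s(3)[of k] by (simp add: r_def)
  have r0: "r 0 = 0" by (simp add: r_def s0)
  define G where "G k = Matrix.mat (r k) (l k) (\<lambda>(i, j). b k $$ (s k + i, j))" for k
  have lr_det: "l k = r k \<and> Determinant.det (G k) \<noteq> 0" for k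
  proof (cases k)
    case 0
    then show ?thesis using r0 l0 by (simp add: G_def det_dim_zero)
  next
    case (Suc m)
    have b': "b k \<in> carrier_mat (s k + r k) (l k)" and y': "y k \<in> carrier_mat (l k) (s k + r k)"
      using b[of k] y[of k] N[of k] by simp_all
    have "(b k * y k) $$ (s k + i, s k + j) = 1\<^sub>m (r k) $$ (i, j)" if "i < r k" "j < r k" for i j
    proof -
      have "(b k * y k) $$ (s k + i, s k + j) = (J m * (b k * y k)) $$ (i, s k + j)"
        using partial_identity_mult_entry[OF mult_carrier_mat[OF b y], of i "N m" "s k + j" k "s m"]
          that s(1,2,3)[of m] N[of m] N[of k] r_Suc[of m]
        by (simp add: Suc J_def)
      also have "\<dots> = J m $$ (i, s k + j)" using Jby[of m] Suc by simp
      also have "\<dots> = 1\<^sub>m (r k) $$ (i, j)"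
        using that N[of m] N[of k] r_Suc[of m] by (auto simp: J_def partial_identity_def Suc)
      finally show ?thesis .
    qed
    from complementary_block_invertible[OF b' y' yb zero this]
    show ?thesis by (simp add: G_def)
  qed
  then have lr: "l k = r k" and detG: "Determinant.det (G k) \<noteq> 0" for k by simp_all
  show ?thesis
  proof (rule that[of "\<lambda>k. Determinant.det (G k)"])
    show "Determinant.det (G 0) = 1" using r0 l0 by (simp add: G_def det_dim_zero)
    show "Determinant.det (G k) \<noteq> 0" for k by (rule detG)
    show "Determinant.det (G k) = 1" if "N k = 0" for k
      using that N[of k] lr[of k] by (simp add: G_def det_dim_zero)
    show sum: "l (Suc k) + l k = N k" for k using lr[of k] lr[of "Suc k"] r_Suc N[of k] by simp
    show "Determinant.det (beside (D k * B (Suc k)) (B k)) =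
        Determinant.det (V k) * (Determinant.det (G (Suc k)) * Determinant.det (G k))" for k
    proof -
      define M where "M = beside (J k * b (Suc k)) (b k)"
      have lN: "s k = l (Suc k)" "N k = l (Suc k) + l k"
        using sum[of k] lr[of "Suc k"] r_Suc[of k] by linarith+
      define T where "T = Matrix.mat (l (Suc k)) (l k) (\<lambda>(i, j). b k $$ (i, j))"
      have M_eq: "M = four_block_mat (G (Suc k)) T (0\<^sub>m (l k) (l (Suc k))) (G k)"
      proof (rule eq_matI)
        fix i j
        assume "i < dim_row (four_block_mat (G (Suc k)) T (0\<^sub>m (l k) (l (Suc k))) (G k))"
          "j < dim_col (four_block_mat (G (Suc k)) T (0\<^sub>m (l k) (l (Suc k))) (G k))"
        then have ij: "i < N k" "j < l (Suc k) + l k"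
          using lr[of "Suc k"] lr[of k] lN by (simp_all add: G_def)
        have Jb: "(J k * b (Suc k)) $$ (i, j) = (if i < s k then b (Suc k) $$ (s (Suc k) + i, j) else 0)"
          if "j < l (Suc k)"
          using partial_identity_mult_entry[OF b[of "Suc k"] ij(1) that s(2)[of k] s(1)[of k]] s(3)[of k] by (simp add: J_def)
        show "M $$ (i, j) = four_block_mat (G (Suc k)) T (0\<^sub>m (l k) (l (Suc k))) (G k) $$ (i, j)"
          using ij Jb b[of k] b[of "Suc k"] J[of k] lN lr[of "Suc k"] lr[of k]
          by (auto simp: M_def beside_def G_def T_def simp del: index_mult_mat(1))
      qed (use b[of k] b[of "Suc k"] J[of k] lN lr[of "Suc k"] lr[of k]
          in \<open>auto simp: M_def beside_def G_def\<close>)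
      have "Determinant.det M = Determinant.det (G (Suc k)) * Determinant.det (G k)"
        unfolding M_eq using lr[of "Suc k"] lr[of k]
        by (intro det_four_block_mat_lower_left_zero[of _ "l (Suc k)" _ "l k"])
          (auto simp: G_def T_def)
      moreover have "beside (D k * B (Suc k)) (B k) = V k * M"
      proof -
        have "V k * M = beside (V k * (J k * b (Suc k))) (V k * b k)"
          unfolding M_def by (rule mult_beside[OF V(1) mult_carrier_mat[OF J b] b])
        also have "V k * (J k * b (Suc k)) = D k * B (Suc k)"
          using VWX[OF mult_carrier_mat[OF D B], of k] Db[of k] by simp
        also have "V k * b k = B k" unfolding b_def by (rule VWX[OF B])
        finally show ?thesis ..
      qed
      moreover have "M \<in> carrier_mat (N k) (N k)"
        unfolding M_def using beside_carrier[OF mult_carrier_mat[OF J b] b, of k] lN by simp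
      ultimately show ?thesis using det_mult[OF V(1)] by simp
    qed
  qed
qed

lemma alternating_product_telescopes:
  fixes g :: "nat \<Rightarrow> 'a::field"
  assumes "\<And>k. g k \<noteq> 0"
  shows "(\<Prod>k\<le>m. (g (Suc k) * g k) powi (if even k then - 1 else 1)) =
    inverse (g 0) * g (Suc m) powi (if even m then - 1 else 1)"
  using assms by (induction m) (auto simp: power_int_mult_distrib field_simps)

text \<open>
  Here the two coefficient rings meet: the integral matrices \<open>D0\<close> have a normal form over \<open>\<int>((t))\<close>, the bases
  live over \<open>F(t)\<close>, and both are compared over \<open>F((t))\<close>. The determinants comparing bases cancel in the
  alternating product, and what remains is a product of determinants of the base changes \<open>V k\<close>, which are
  units of \<open>\<int>((t))\<close>.
\<close>

lemma torsion_is_monic: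
  fixes D0 :: "nat \<Rightarrow> int fls Matrix.mat" and D B Y :: "nat \<Rightarrow> 'f::field poly fract Matrix.mat"
  assumes D0: "\<And>k. D0 k \<in> carrier_mat (N k) (N (Suc k))"
    and onto: "{D0 0 *\<^sub>v x | x. x \<in> carrier_vec (N 1)} = carrier_vec (N 0)"
    and exact: "\<And>k. {D0 (Suc k) *\<^sub>v x | x. x \<in> carrier_vec (N (Suc (Suc k)))} =
      {x \<in> carrier_vec (N (Suc k)). D0 k *\<^sub>v x = 0\<^sub>v (N k)}"
    and fin: "N (Suc m) = 0"
    and D: "\<And>k. D k \<in> carrier_mat (N k) (N (Suc k))"
    and D_D0: "\<And>k. map_mat fls_of_ratfun (D k) = map_mat fls_of_int_fls (D0 k)"
    and B: "\<And>k. B k \<in> carrier_mat (N k) (l k)"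
    and Y: "\<And>k. Y k \<in> carrier_mat (l k) (N k)"
    and l0: "l 0 = 0"
    and YB: "\<And>k. Y k * B k = 1\<^sub>m (l k)"
    and DBY: "\<And>k. D k * B (Suc k) * Y (Suc k) = D k"
    and YD: "\<And>k. Y k * D k = 0\<^sub>m (l k) (N (Suc k))"
  shows "l (Suc k) + l k = N k"
    and "monic_fls (fls_of_ratfun (\<Prod>k\<le>m. Determinant.det (beside (D k * B (Suc k)) (B k))
           powi (if even k then - 1 else 1)))"
proof -
  interpret \<phi>: field_hom "fls_of_ratfun :: 'f poly fract \<Rightarrow> 'f fls" by (rule field_hom_fls_of_ratfun)
  interpret \<psi>: comm_ring_hom "fls_of_int_fls :: int fls \<Rightarrow> 'f fls" by (rule ring_hom_fls_of_int_fls)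
  obtain V s where nf: "s 0 = N 0"
      "\<And>k. V k \<in> carrier_mat (N k) (N k)" "\<And>k. Determinant.det (V k) dvd 1"
      "\<And>k. s k \<le> N k" "\<And>k. s k \<le> N (Suc k)" "\<And>k. s (Suc k) = N (Suc k) - s k"
      "\<And>k. D0 k * V (Suc k) = V k * partial_identity (N k) (N (Suc k)) (s k)"
    by (rule exact_complex_normal_form[of "\<lambda>a. nat \<bar>leading a\<bar>" D0 N]) (use fls_euclidean D0 onto exact in auto)
  let ?f = "map_mat (fls_of_ratfun :: 'f poly fract \<Rightarrow> 'f fls)"
  let ?h = "map_mat (fls_of_int_fls :: int fls \<Rightarrow> 'f fls)"
  have detV: "Determinant.det (?h (V k)) = fls_of_int_fls (Determinant.det (V k))" for k
    by simp
  have V_unit: "Determinant.det (?h (V k)) dvd 1" for k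
    unfolding detV using nf(3)[of k] by (metis \<psi>.hom_dvd \<psi>.hom_one)
  \<comment> \<open>the normal form over \<open>\<int>((t))\<close> becomes one of the image of \<open>D\<close> over \<open>F((t))\<close>\<close>
  have nf': "?f (D k) * ?h (V (Suc k)) = ?h (V k) * partial_identity (N k) (N (Suc k)) (s k)" for k
  proof -
    have "?h (partial_identity (N k) (N (Suc k)) (s k)) = partial_identity (N k) (N (Suc k)) (s k)"
      by (intro eq_matI) (auto simp: partial_identity_def)
    then show ?thesis
      using \<psi>.mat_hom_mult[OF D0 nf(2), of k] \<psi>.mat_hom_mult[OF nf(2) partial_identity_carrier, of k] nf(7)
      by (simp add: D_D0)
  qed
  have map_0: "?f (0\<^sub>m a b) = 0\<^sub>m a b" for a b
    by (intro eq_matI) auto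
  have id: "?f (Y k) * ?f (B k) = 1\<^sub>m (l k)" "?f (D k) * ?f (B (Suc k)) * ?f (Y (Suc k)) = ?f (D k)"
    "?f (Y k) * ?f (D k) = 0\<^sub>m (l k) (N (Suc k))" for k
    using \<phi>.mat_hom_mult[OF Y B, of k] \<phi>.mat_hom_mult[OF D B, of k]
      \<phi>.mat_hom_mult[OF mult_carrier_mat[OF D B] Y, of k] \<phi>.mat_hom_mult[OF Y D, of k]
    by (simp_all add: YB DBY YD \<phi>.mat_hom_one map_0)
  obtain g where g: "g 0 = 1" "\<And>k. g k \<noteq> 0" "\<And>k. N k = 0 \<Longrightarrow> g k = 1"
      "\<And>k. l (Suc k) + l k = N k"
      "\<And>k. Determinant.det (beside (?f (D k) * ?f (B (Suc k))) (?f (B k))) =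
        Determinant.det (?h (V k)) * (g (Suc k) * g k)"
    by (rule torsion_factors[of s N "\<lambda>k. ?h (V k)" "\<lambda>k. ?f (D k)" "\<lambda>k. ?f (B k)" l "\<lambda>k. ?f (Y k)"])
      (use nf(1-6) V_unit nf' id D B Y l0 in auto)
  show "l (Suc k) + l k = N k" by (rule g(4))
  have det: "fls_of_ratfun (Determinant.det (beside (D k * B (Suc k)) (B k))) =
      fls_of_int_fls (Determinant.det (V k)) * (g (Suc k) * g k)" for k
  proof -
    have "?f (beside (D k * B (Suc k)) (B k)) = beside (?f (D k * B (Suc k))) (?f (B k))"
      using D[of k] B[of "Suc k"] B[of k] by (intro eq_matI) (auto simp: beside_def)
    then show ?thesis
      using g(5)[of k] \<phi>.mat_hom_mult[OF D B, of k] \<phi>.hom_det[of "beside (D k * B (Suc k)) (B k)"]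
      by simp
  qed
  let ?e = "\<lambda>k::nat. if even k then - 1 else 1 :: int"
  have "fls_of_ratfun (\<Prod>k\<le>m. Determinant.det (beside (D k * B (Suc k)) (B k)) powi ?e k) =
      (\<Prod>k\<le>m. (fls_of_int_fls (Determinant.det (V k)) * (g (Suc k) * g k)) powi ?e k)"
    unfolding \<phi>.hom_prod by (intro prod.cong) (auto simp: det \<phi>.hom_inverse power_int_minus)
  also have "\<dots> = (\<Prod>k\<le>m. (fls_of_int_fls (Determinant.det (V k))) powi ?e k) *
      (\<Prod>k\<le>m. (g (Suc k) * g k) powi ?e k)"
    by (simp only: power_int_mult_distrib prod.distrib)
  \<comment> \<open>the end terms are one: degree \<open>0\<close> has nothing to lift, and there are no chains of degree \<open>m + 1\<close>\<close>
  also have "(\<Prod>k\<le>m. (g (Suc k) * g k) powi ?e k) = 1"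
    using alternating_product_telescopes[of g m, OF g(2)] g(1,3) fin by simp
  finally show "monic_fls (fls_of_ratfun (\<Prod>k\<le>m. Determinant.det (beside (D k * B (Suc k)) (B k)) powi ?e k))"
    by (simp only: mult_1_right)
      (intro monic_fls_prod monic_fls_powi fls_of_int_fls_unit_monic nf(3))
qed

section \<open>Tensor products\<close>

text \<open>
  The setting for the tensor product of two modules, with the data needed to see that it is a commutative group
  generated by pure tensors and universal for balanced biadditive maps.
\<close>

locale tensor =
  fixes G :: "'g set" and M :: "('m, 'y) monoid_scheme" and ract :: "'m \<Rightarrow> 'g \<Rightarrow> 'm"
    and N :: "('c, 'z) monoid_scheme" and lact :: "'g \<Rightarrow> 'c \<Rightarrow> 'c"
  assumes M: "comm_group M" and N: "comm_group N"
    and ract_closed: "\<And>g u. g \<in> G \<Longrightarrow> u \<in> carrier M \<Longrightarrow> ract u g \<in> carrier M"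
    and lact_closed: "\<And>g x. g \<in> G \<Longrightarrow> x \<in> carrier N \<Longrightarrow> lact g x \<in> carrier N"
begin

sublocale M: comm_group M by (rule M)
sublocale N: comm_group N by (rule N)

abbreviation "F \<equiv> free_Abelian_group (carrier M \<times> carrier N)"
abbreviation "R \<equiv> tensor_relations G M ract N lact"
abbreviation "T \<equiv> tensor_product G M ract N lact"
abbreviation "pure \<equiv> pure_tensor G M ract N lact"

definition relators :: "('m \<times> 'c) frag set" where
  "relators = {frag_of (u \<otimes>\<^bsub>M\<^esub> v, x) - frag_of (u, x) - frag_of (v, x) | u v x.
           u \<in> carrier M \<and> v \<in> carrier M \<and> x \<in> carrier N} \<union>
        {frag_of (u, x \<otimes>\<^bsub>N\<^esub> y) - frag_of (u, x) - frag_of (u, y) | u x y.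
           u \<in> carrier M \<and> x \<in> carrier N \<and> y \<in> carrier N} \<union>
        {frag_of (ract u g, x) - frag_of (u, lact g x) | u g x.
           u \<in> carrier M \<and> g \<in> G \<and> x \<in> carrier N}"

lemma R_generate: "R = generate F relators"
  by (simp add: tensor_relations_def relators_def)

sublocale F: comm_group F by (rule abelian_free_Abelian_group)

lemma frag_closed:
  "u \<in> carrier M \<Longrightarrow> x \<in> carrier N \<Longrightarrow> frag_of (u, x) \<in> carrier F"
  by simp

lemma F_diff_closed: "a \<in> carrier F \<Longrightarrow> b \<in> carrier F \<Longrightarrow> a - b \<in> carrier F"
  using keys_diff[of a b] by auto

lemma relators_closed: "relators \<subseteq> carrier F"
  unfolding relators_def
  by (auto simp del: carrier_free_Abelian_group_iff simp: ract_closed lact_closed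
      intro!: F_diff_closed frag_closed)

lemma subgroup_R: "subgroup R F"
  unfolding R_generate by (rule F.generate_is_subgroup[OF relators_closed])

lemma normal_R: "R \<lhd> F"
  using subgroup_R by (simp add: F.normal_iff_subgroup)

lemma comm_group_T: "comm_group T"
  unfolding tensor_product_def by (rule F.abelian_FactGroup[OF subgroup_R])

sublocale T: comm_group T by (rule comm_group_T)

lemma coset_hom: "(\<lambda>a. R #>\<^bsub>F\<^esub> a) \<in> hom F T"
  unfolding tensor_product_def by (rule normal.r_coset_hom_Mod[OF normal_R])

lemma coset_eqI:
  assumes "a \<in> carrier F" "b \<in> carrier F" "a - b \<in> R"
  shows "R #>\<^bsub>F\<^esub> a = R #>\<^bsub>F\<^esub> b"
proof -
  have "a \<in> R #>\<^bsub>F\<^esub> b"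
    using assms(3) by (force simp: r_coset_def)
  then show ?thesis
    using F.repr_independence[OF _ assms(2) subgroup_R] by simp
qed

lemma coset_add:
  "a \<in> carrier F \<Longrightarrow> b \<in> carrier F \<Longrightarrow> R #>\<^bsub>F\<^esub> (a + b) = (R #>\<^bsub>F\<^esub> a) \<otimes>\<^bsub>T\<^esub> (R #>\<^bsub>F\<^esub> b)"
  using hom_mult[OF coset_hom, of a b] by simp

lemma pure_closed [simp]: "u \<in> carrier M \<Longrightarrow> x \<in> carrier N \<Longrightarrow> pure u x \<in> carrier T"
  unfolding pure_tensor_def using coset_hom frag_closed by (rule hom_in_carrier)

lemma relator_R: "r \<in> relators \<Longrightarrow> r \<in> R"
  unfolding R_generate by (rule generate.incl)

lemma pure_mult_left:
  assumes "u \<in> carrier M" "v \<in> carrier M" "x \<in> carrier N"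
  shows "pure (u \<otimes>\<^bsub>M\<^esub> v) x = pure u x \<otimes>\<^bsub>T\<^esub> pure v x"
proof -
  have "frag_of (u \<otimes>\<^bsub>M\<^esub> v, x) - (frag_of (u, x) + frag_of (v, x)) \<in> R"
    using assms by (intro relator_R) (auto simp: relators_def diff_diff_add[symmetric])
  then have "R #>\<^bsub>F\<^esub> frag_of (u \<otimes>\<^bsub>M\<^esub> v, x) = R #>\<^bsub>F\<^esub> (frag_of (u, x) + frag_of (v, x))"
    using assms by (intro coset_eqI) (auto simp del: carrier_free_Abelian_group_iff
        intro!: frag_closed F.m_closed[simplified])
  then show ?thesis
    using assms coset_add[OF frag_closed frag_closed] by (simp add: pure_tensor_def)
qed

lemma pure_mult_right:
  assumes "u \<in> carrier M" "x \<in> carrier N" "y \<in> carrier N"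
  shows "pure u (x \<otimes>\<^bsub>N\<^esub> y) = pure u x \<otimes>\<^bsub>T\<^esub> pure u y"
proof -
  have "frag_of (u, x \<otimes>\<^bsub>N\<^esub> y) - (frag_of (u, x) + frag_of (u, y)) \<in> R"
    using assms by (intro relator_R) (auto simp: relators_def diff_diff_add[symmetric])
  then have "R #>\<^bsub>F\<^esub> frag_of (u, x \<otimes>\<^bsub>N\<^esub> y) = R #>\<^bsub>F\<^esub> (frag_of (u, x) + frag_of (u, y))"
    using assms by (intro coset_eqI) (auto simp del: carrier_free_Abelian_group_iff
        intro!: frag_closed F.m_closed[simplified])
  then show ?thesis
    using assms coset_add[OF frag_closed frag_closed] by (simp add: pure_tensor_def)
qed

lemma pure_balanced:
  assumes "u \<in> carrier M" "g \<in> G" "x \<in> carrier N"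
  shows "pure (ract u g) x = pure u (lact g x)"
proof -
  have "frag_of (ract u g, x) - frag_of (u, lact g x) \<in> R"
    using assms by (intro relator_R) (auto simp: relators_def)
  then show ?thesis
    unfolding pure_tensor_def using assms
    by (intro coset_eqI) (simp_all add: ract_closed lact_closed)
qed

lemma pure_hom_left: "x \<in> carrier N \<Longrightarrow> (\<lambda>u. pure u x) \<in> hom M T"
  by (rule homI) (simp_all add: pure_mult_left)

lemma pure_hom_right: "u \<in> carrier M \<Longrightarrow> pure u \<in> hom N T"
  by (rule homI) (simp_all add: pure_mult_right)

lemma tensor_induct [consumes 1, case_names one div pure]:
  assumes "X \<in> carrier T" and "P \<one>\<^bsub>T\<^esub>"
    and div: "\<And>X Y. X \<in> carrier T \<Longrightarrow> Y \<in> carrier T \<Longrightarrow> P X \<Longrightarrow> P Y \<Longrightarrow> P (X \<otimes>\<^bsub>T\<^esub> inv\<^bsub>T\<^esub> Y)"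
    and pure: "\<And>u x. u \<in> carrier M \<Longrightarrow> x \<in> carrier N \<Longrightarrow> P (pure u x)"
  shows "P X"
proof -
  interpret q: group_hom F T "\<lambda>a. R #>\<^bsub>F\<^esub> a"
    by (unfold_locales) (rule coset_hom)
  obtain c where c: "c \<in> carrier F" "X = R #>\<^bsub>F\<^esub> c"
    using assms(1) unfolding tensor_product_def carrier_FactGroup by blast
  have "Poly_Mapping.keys c \<subseteq> carrier M \<times> carrier N" using c by simp
  then have "P (R #>\<^bsub>F\<^esub> c)"
  proof (rule free_Abelian_group_induct[where P = "\<lambda>c. P (R #>\<^bsub>F\<^esub> c)"])
    show "P (R #>\<^bsub>F\<^esub> 0)" using q.hom_one assms(2) by simp
  next
    fix a b assume ab: "Poly_Mapping.keys a \<subseteq> carrier M \<times> carrier N"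
      "Poly_Mapping.keys b \<subseteq> carrier M \<times> carrier N" "P (R #>\<^bsub>F\<^esub> a)" "P (R #>\<^bsub>F\<^esub> b)"
    have "R #>\<^bsub>F\<^esub> (a - b) = (R #>\<^bsub>F\<^esub> a) \<otimes>\<^bsub>T\<^esub> inv\<^bsub>T\<^esub> (R #>\<^bsub>F\<^esub> b)"
      using ab q.hom_mult[of a "- b"] q.hom_inv[of b] by simp
    then show "P (R #>\<^bsub>F\<^esub> (a - b))" using ab div q.hom_closed by simp
  next
    fix p assume "p \<in> carrier M \<times> carrier N"
    then show "P (R #>\<^bsub>F\<^esub> frag_of p)" using pure by (auto simp: pure_tensor_def)
  qed
  then show ?thesis using c by simp
qed

lemma hom_eqI:
  assumes h: "h \<in> hom T H" and h': "h' \<in> hom T H" and H: "group H"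
    and eq: "\<And>u x. u \<in> carrier M \<Longrightarrow> x \<in> carrier N \<Longrightarrow> h (pure u x) = h' (pure u x)"
    and X: "X \<in> carrier T"
  shows "h X = h' X"
proof -
  interpret h: group_hom T H h
    by (intro group_hom.intro group_hom_axioms.intro T.is_group h H)
  interpret h': group_hom T H h'
    by (intro group_hom.intro group_hom_axioms.intro T.is_group h' H)
  show ?thesis using X by (induction rule: tensor_induct) (simp_all add: eq)
qed

lemma universal:
  assumes H: "comm_group H"
    and closed: "\<And>u x. u \<in> carrier M \<Longrightarrow> x \<in> carrier N \<Longrightarrow> f u x \<in> carrier H"
    and left: "\<And>u v x. u \<in> carrier M \<Longrightarrow> v \<in> carrier M \<Longrightarrow> x \<in> carrier N \<Longrightarrow>
      f (u \<otimes>\<^bsub>M\<^esub> v) x = f u x \<otimes>\<^bsub>H\<^esub> f v x"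
    and right: "\<And>u x y. u \<in> carrier M \<Longrightarrow> x \<in> carrier N \<Longrightarrow> y \<in> carrier N \<Longrightarrow>
      f u (x \<otimes>\<^bsub>N\<^esub> y) = f u x \<otimes>\<^bsub>H\<^esub> f u y"
    and balanced: "\<And>u g x. u \<in> carrier M \<Longrightarrow> g \<in> G \<Longrightarrow> x \<in> carrier N \<Longrightarrow>
      f (ract u g) x = f u (lact g x)"
  obtains h where "h \<in> hom T H" "\<And>u x. u \<in> carrier M \<Longrightarrow> x \<in> carrier N \<Longrightarrow> h (pure u x) = f u x"
proof -
  interpret H: comm_group H by (rule H)
  have "(\<lambda>(u, x). f u x) ` (carrier M \<times> carrier N) \<subseteq> carrier H"
    using closed by auto
  then obtain k where k: "k \<in> hom F H"
      "\<And>p. p \<in> carrier M \<times> carrier N \<Longrightarrow> k (frag_of p) = (\<lambda>(u, x). f u x) p"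
    by (rule H.free_Abelian_group_universal) (rule that)
  interpret k: group_hom F H k
    by (intro group_hom.intro group_hom_axioms.intro F.is_group H.is_group k(1))
  have diff: "k (a - b) = k a \<otimes>\<^bsub>H\<^esub> inv\<^bsub>H\<^esub> (k b)" if "a \<in> carrier F" "b \<in> carrier F" for a b
    using that k.hom_mult[of a "- b"] k.hom_inv[of b] by simp
  have kf: "k (frag_of (u, x)) = f u x" if "u \<in> carrier M" "x \<in> carrier N" for u x
    using k(2)[of "(u, x)"] that by simp
  have "relators \<subseteq> kernel F H k"
  proof
    fix r assume r: "r \<in> relators"
    have cancel: "a \<otimes>\<^bsub>H\<^esub> b \<otimes>\<^bsub>H\<^esub> inv\<^bsub>H\<^esub> a \<otimes>\<^bsub>H\<^esub> inv\<^bsub>H\<^esub> b = \<one>\<^bsub>H\<^esub>"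
      if "a \<in> carrier H" "b \<in> carrier H" for a b
      using that by (metis H.inv_closed H.m_assoc H.m_closed H.m_comm H.r_inv H.r_one)
    from r have "k r = \<one>\<^bsub>H\<^esub>"
      unfolding relators_def
      by (auto simp: diff kf left right balanced closed cancel ract_closed lact_closed
          F_diff_closed frag_closed simp del: carrier_free_Abelian_group_iff)
    then show "r \<in> kernel F H k"
      using r relators_closed by (auto simp: kernel_def simp del: carrier_free_Abelian_group_iff)
  qed
  then have sub: "R \<subseteq> kernel F H k"
    unfolding R_generate using k.subgroup_kernel by (rule F.generate_subgroup_incl)
  have "k a = k b" if "a \<in> carrier F" "b \<in> carrier F" "R #>\<^bsub>F\<^esub> a = R #>\<^bsub>F\<^esub> b" for a b
  proof -
    have "a \<in> R #>\<^bsub>F\<^esub> b" using F.rcos_self[OF that(1) subgroup_R] that(3) by simp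
    then obtain r where "r \<in> R" "a = r + b" by (auto simp: r_coset_def)
    then show ?thesis using sub that(2) k.hom_mult[of r b] by (auto simp: kernel_def)
  qed
  then obtain h where h: "h \<in> hom (F Mod R) H" "\<And>a. a \<in> carrier F \<Longrightarrow> h (R #>\<^bsub>F\<^esub> a) = k a"
    using FactGroup_universal[OF k(1) normal_R] by blast
  show ?thesis
    by (rule that[of h]) (use h kf in \<open>simp_all add: tensor_product_def pure_tensor_def\<close>)
qed

end

text \<open>
  An equivariant pair of homomorphisms sends relators to relators, hence the subgroup of relations into
  the subgroup of relations, and the image of a coset spans a single coset.
\<close>

lemma tensor_map_properties:
  assumes T: "tensor G M ract N lact" and T': "tensor G M ract N' lact'"
    and f: "f \<in> hom M M" "\<And>g u. g \<in> G \<Longrightarrow> u \<in> carrier M \<Longrightarrow> f (ract u g) = ract (f u) g"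
    and h: "h \<in> hom N N'" "\<And>g x. g \<in> G \<Longrightarrow> x \<in> carrier N \<Longrightarrow> h (lact g x) = lact' g (h x)"
  shows "tensor_map G M ract N' lact' f h \<in> hom (tensor_product G M ract N lact) (tensor_product G M ract N' lact')"
    and "\<And>u x. u \<in> carrier M \<Longrightarrow> x \<in> carrier N \<Longrightarrow>
      tensor_map G M ract N' lact' f h (pure_tensor G M ract N lact u x) = pure_tensor G M ract N' lact' (f u) (h x)"
proof -
  interpret A: tensor G M ract N lact by (rule T)
  interpret B: tensor G M ract N' lact' by (rule T')
  define \<Phi> where "\<Phi> = frag_extend (\<lambda>(u, x). frag_of (f u, h x))"
  have fu: "f u \<in> carrier M" if "u \<in> carrier M" for u using that f(1) by (rule hom_in_carrier[rotated])
  have hx: "h x \<in> carrier N'" if "x \<in> carrier N" for x using that h(1) by (rule hom_in_carrier[rotated])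
  have of: "\<Phi> (frag_of (u, x)) = frag_of (f u, h x)" for u x by (simp add: \<Phi>_def)
  have add: "\<Phi> (a + b) = \<Phi> a + \<Phi> b" and diff: "\<Phi> (a - b) = \<Phi> a - \<Phi> b" for a b
    by (simp_all add: \<Phi>_def frag_extend_add frag_extend_diff)
  have closed: "\<Phi> c \<in> carrier B.F" if "c \<in> carrier A.F" for c
  proof -
    have "Poly_Mapping.keys c \<subseteq> carrier M \<times> carrier N" using that by simp
    then show ?thesis
    proof (rule free_Abelian_group_induct)
      show "\<Phi> 0 \<in> carrier B.F" by (simp add: \<Phi>_def)
      show "\<Phi> (a - b) \<in> carrier B.F" if "\<Phi> a \<in> carrier B.F" "\<Phi> b \<in> carrier B.F" for a b
        unfolding diff using that by (rule B.F_diff_closed)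
      show "\<Phi> (frag_of p) \<in> carrier B.F" if "p \<in> carrier M \<times> carrier N" for p
        using that by (auto simp: of fu hx)
    qed
  qed
  have \<Phi>_hom: "\<Phi> \<in> hom A.F B.F"
    by (rule homI) (use closed in \<open>simp_all add: add\<close>)
  interpret \<Phi>: group_hom A.F B.F \<Phi> using \<Phi>_hom by unfold_locales
  have "\<Phi> r \<in> B.R" if "r \<in> A.relators" for r
    by (rule B.relator_R)
      (use that in \<open>auto simp: A.relators_def B.relators_def diff of f(2) h(2) hom_mult[OF f(1)] hom_mult[OF h(1)];
        blast intro: fu hx\<close>)
  then have "A.relators \<subseteq> {c \<in> carrier A.F. \<Phi> c \<in> B.R}"
    using A.relators_closed by blast
  moreover have "subgroup {c \<in> carrier A.F. \<Phi> c \<in> B.R} A.F"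
  proof (rule A.F.subgroupI)
    show "{c \<in> carrier A.F. \<Phi> c \<in> B.R} \<noteq> {}"
      using A.F.one_closed \<Phi>.hom_one subgroup.one_closed[OF B.subgroup_R] by auto
  qed (use \<Phi>.hom_mult \<Phi>.hom_inv B.subgroup_R A.F.m_closed A.F.inv_closed in
      \<open>auto simp: subgroup.m_closed subgroup.m_inv_closed
        simp del: carrier_free_Abelian_group_iff mult_free_Abelian_group inv_free_Abelian_group\<close>)
  ultimately have R: "\<Phi> r \<in> B.R" if "r \<in> A.R" for r
    using A.F.generate_subgroup_incl that unfolding A.R_generate by blast
  have coset: "tensor_map G M ract N' lact' f h (A.R #>\<^bsub>A.F\<^esub> c) = B.R #>\<^bsub>B.F\<^esub> \<Phi> c" (is "?L = _") for c
  proof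
    have "r' + \<Phi> (r + c) \<in> B.R #>\<^bsub>B.F\<^esub> \<Phi> c" if "r' \<in> B.R" "r \<in> A.R" for r r'
    proof -
      have "r' + \<Phi> r \<in> B.R"
        using subgroup.m_closed[OF B.subgroup_R that(1) R[OF that(2)]] by simp
      then show ?thesis by (force simp: r_coset_def add add.assoc)
    qed
    then show "?L \<subseteq> B.R #>\<^bsub>B.F\<^esub> \<Phi> c"
      by (auto simp: tensor_map_def set_mult_def r_coset_def[of A.F] \<Phi>_def[symmetric])
    have "0 \<in> A.R" using subgroup.one_closed[OF A.subgroup_R] by simp
    then show "B.R #>\<^bsub>B.F\<^esub> \<Phi> c \<subseteq> ?L"
      by (force simp: tensor_map_def set_mult_def r_coset_def \<Phi>_def[symmetric])
  qed
  show "tensor_map G M ract N' lact' f h \<in> hom A.T B.T"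
  proof (rule homI)
    fix X Y assume "X \<in> carrier A.T" "Y \<in> carrier A.T"
    then obtain a b where ab: "a \<in> carrier A.F" "X = A.R #>\<^bsub>A.F\<^esub> a" "b \<in> carrier A.F" "Y = A.R #>\<^bsub>A.F\<^esub> b"
      unfolding tensor_product_def carrier_FactGroup by blast
    show "tensor_map G M ract N' lact' f h X \<in> carrier B.T"
      unfolding ab coset using closed[OF ab(1)] B.coset_hom by (rule hom_in_carrier[rotated])
    show "tensor_map G M ract N' lact' f h (X \<otimes>\<^bsub>A.T\<^esub> Y) =
        tensor_map G M ract N' lact' f h X \<otimes>\<^bsub>B.T\<^esub> tensor_map G M ract N' lact' f h Y"
      unfolding ab A.coset_add[OF ab(1,3), symmetric] coset add
      by (rule B.coset_add[OF closed closed]) (use ab in auto)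
  qed
  show "tensor_map G M ract N' lact' f h (A.pure u x) = B.pure (f u) (h x)"
    if "u \<in> carrier M" "x \<in> carrier N" for u x
    by (simp add: pure_tensor_def coset of)
qed

section \<open>The knot group and its action on cellular chains\<close>

lemma fundamental_group_carrierI:
  assumes "path p" "path_image p \<subseteq> S" "pathstart p = a" "pathfinish p = a"
  shows "{q. homotopic_paths S p q} \<in> carrier (fundamental_group S a)"
  using assms by (auto simp: fundamental_group_def)

text \<open>
  The product of two classes is the class of the concatenation, because concatenation respects
  homotopies.
\<close>

lemma fundamental_group_mult:
  assumes "path p" "path_image p \<subseteq> S" "path q" "path_image q \<subseteq> S" "pathfinish p = pathstart q"
  shows "{r. homotopic_paths S p r} \<otimes>\<^bsub>fundamental_group S a\<^esub> {r. homotopic_paths S q r} =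
    {r. homotopic_paths S (p +++ q) r}"
proof -
  have refl: "homotopic_paths S p p" "homotopic_paths S q q"
    using assms by simp_all
  have "homotopic_paths S (p +++ q) r"
    if "homotopic_paths S p p'" "homotopic_paths S q q'" "homotopic_paths S (p' +++ q') r" for p' q' r
    using homotopic_paths_trans[OF homotopic_paths_join[OF that(1,2) assms(5)] that(3)] .
  then have "{r. \<exists>p'\<in>{r. homotopic_paths S p r}. \<exists>q'\<in>{r. homotopic_paths S q r}. homotopic_paths S (p' +++ q') r} =
      {r. homotopic_paths S (p +++ q) r}"
    using refl by (metis (mono_tags, lifting) mem_Collect_eq)
  then show ?thesis
    by (simp add: fundamental_group_def)
qed

lemma fundamental_group_mult_closed:
  assumes "A \<in> carrier (fundamental_group S a)" "B \<in> carrier (fundamental_group S a)"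
  shows "A \<otimes>\<^bsub>fundamental_group S a\<^esub> B \<in> carrier (fundamental_group S a)"
proof -
  obtain p where p: "A = {r. homotopic_paths S p r}" "path p" "path_image p \<subseteq> S" "pathstart p = a" "pathfinish p = a"
    using assms(1) by (auto simp: fundamental_group_def)
  obtain q where q: "B = {r. homotopic_paths S q r}" "path q" "path_image q \<subseteq> S" "pathstart q = a" "pathfinish q = a"
    using assms(2) by (auto simp: fundamental_group_def)
  have "A \<otimes>\<^bsub>fundamental_group S a\<^esub> B = {r. homotopic_paths S (p +++ q) r}"
    unfolding p(1) q(1) using p q by (intro fundamental_group_mult) auto
  also have "\<dots> \<in> carrier (fundamental_group S a)"
    using p q by (intro fundamental_group_carrierI) (auto simp: path_image_join)
  finally show ?thesis .
qed

lemma constant_path: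
  assumes "a \<in> S"
  shows "path (\<lambda>u. a)" "path_image (\<lambda>u. a) \<subseteq> S" "pathstart (\<lambda>u. a) = a" "pathfinish (\<lambda>u. a) = a"
  using assms by (auto simp: path_def path_image_def pathstart_def pathfinish_def)

lemma fundamental_group_one_closed:
  "a \<in> S \<Longrightarrow> \<one>\<^bsub>fundamental_group S a\<^esub> \<in> carrier (fundamental_group S a)"
  using fundamental_group_carrierI[OF constant_path] by (simp add: fundamental_group_def)

text \<open>
  Concatenating the constant path with itself gives the same function, so the product with the constant class is evaluated without a homotopy.
\<close>

lemma fundamental_group_one_mult_one:
  assumes "a \<in> S"
  shows "\<one>\<^bsub>fundamental_group S a\<^esub> \<otimes>\<^bsub>fundamental_group S a\<^esub> \<one>\<^bsub>fundamental_group S a\<^esub> = \<one>\<^bsub>fundamental_group S a\<^esub>"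
proof -
  have "(\<lambda>u. a) +++ (\<lambda>u. a) = (\<lambda>u::real. a)" by (simp add: joinpaths_def)
  then show ?thesis
    using fundamental_group_mult[OF constant_path(1,2)[OF assms] constant_path(1,2)[OF assms], of a]
      constant_path(3,4)[OF assms]
    by (simp add: fundamental_group_def[of S a])
qed

lemma cell_chain_comm_group: "comm_group (cell_chain M k)"
  by (simp add: cell_chain_def)

lemma cell_chain_negative: "k < 0 \<Longrightarrow> carrier (cell_chain M k) = {\<one>\<^bsub>cell_chain M k\<^esub>}"
  using trivial_relative_homology_group[of k] unfolding cell_chain_def trivial_group_def by blast

lemma cell_boundary_hom: "cell_boundary M k \<in> hom (cell_chain M k) (cell_chain M (k - 1))"
proof -
  have "k - 1 - 1 = k - 2" by simp
  then show ?thesis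
    unfolding cell_boundary_def cell_chain_def
    by (simp only:) (rule hom_compose[OF hom_boundary_hom hom_induced_hom])
qed

lemma cover_skeleton_mono: "k \<le> l \<Longrightarrow> cover_skeleton M k \<subseteq> cover_skeleton M l"
proof -
  assume "k \<le> l"
  then have "skeleton M k \<subseteq> skeleton M l"
    unfolding skeleton_def by (intro UN_mono) auto
  then show ?thesis by (auto simp: cover_skeleton_def)
qed

lemma subtopology_cover_skeleton:
  "subtopology (top_of_set (cover_skeleton M k)) (cover_skeleton M (k - 1)) = top_of_set (cover_skeleton M (k - 1))"
proof -
  have "cover_skeleton M (k - 1) \<subseteq> cover_skeleton M k" by (rule cover_skeleton_mono) simp
  then show ?thesis unfolding subtopology_subtopology by (simp only: Int_absorb1)
qed

text \<open>
  The composite of two boundary maps of triples contains the composite of two consecutive maps in the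
  long exact sequence of the pair of skeleta in degree \<open>k - 1\<close>.
\<close>

lemma cell_boundary_boundary:
  assumes "x \<in> carrier (cell_chain M k)"
  shows "cell_boundary M (k - 1) (cell_boundary M k x) = \<one>\<^bsub>cell_chain M (k - 2)\<^esub>"
proof -
  let ?X = "\<lambda>k. cover_skeleton M k"
  note sub = subtopology_cover_skeleton[of M k]
  define y where "y = hom_boundary k (top_of_set (?X k)) (?X (k - 1)) x"
  have y: "y \<in> carrier (homology_group (k - 1) (top_of_set (?X (k - 1))))"
    using hom_boundary_carrier[of k "top_of_set (?X k)" "?X (k - 1)" x] by (simp add: y_def sub)
  have "hom_boundary (k - 1) (top_of_set (?X (k - 1))) (?X (k - 2))
      (hom_induced (k - 1) (top_of_set (?X (k - 1))) {} (top_of_set (?X (k - 1))) (?X (k - 2)) id y)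
      = \<one>\<^bsub>homology_group (k - 1 - 1) (subtopology (top_of_set (?X (k - 1))) (?X (k - 2)))\<^esub>"
  proof -
    have "hom_induced (k - 1) (top_of_set (?X (k - 1))) {} (top_of_set (?X (k - 1))) (?X (k - 2)) id `
        carrier (homology_group (k - 1) (top_of_set (?X (k - 1)))) =
      kernel (relative_homology_group (k - 1) (top_of_set (?X (k - 1))) (?X (k - 2)))
        (homology_group (k - 1 - 1) (subtopology (top_of_set (?X (k - 1))) (?X (k - 2))))
        (hom_boundary (k - 1) (top_of_set (?X (k - 1))) (?X (k - 2)))"
      using homology_exactness_axiom_1[of "k - 1" "top_of_set (?X (k - 1))" "?X (k - 2)"]
      unfolding exact_seq_cons_iff by (elim conjE) (erule sym)
    moreover have "hom_induced (k - 1) (top_of_set (?X (k - 1))) {} (top_of_set (?X (k - 1))) (?X (k - 2)) id y \<in>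
        hom_induced (k - 1) (top_of_set (?X (k - 1))) {} (top_of_set (?X (k - 1))) (?X (k - 2)) id `
        carrier (homology_group (k - 1) (top_of_set (?X (k - 1))))"
      using y by (rule imageI)
    ultimately show ?thesis by (simp add: kernel_def)
  qed
  moreover have "hom_induced (k - 2) (subtopology (top_of_set (?X (k - 1))) (?X (k - 2))) {}
       (top_of_set (?X (k - 2))) (?X (k - 3)) id
       \<one>\<^bsub>homology_group (k - 2) (subtopology (top_of_set (?X (k - 1))) (?X (k - 2)))\<^esub>
      = \<one>\<^bsub>relative_homology_group (k - 2) (top_of_set (?X (k - 2))) (?X (k - 3))\<^esub>"
    by (rule hom_one[OF hom_induced_hom]) simp_all
  moreover have "k - 1 - 1 = k - 2" "k - 1 - 2 = k - 3" "k - 2 - 1 = k - 3" by simp_all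
  ultimately show ?thesis
    unfolding cell_boundary_def cell_chain_def o_apply y_def[symmetric] sub by (simp only:)
qed

lemma cell_act_hom: "cell_act M k g \<in> hom (cell_chain M k) (cell_chain M k)"
  unfolding cell_act_def cell_chain_def by (rule hom_induced_hom)

lemma cell_act_default: "x \<notin> carrier (cell_chain M k) \<Longrightarrow> cell_act M k g x = \<one>\<^bsub>cell_chain M k\<^esub>"
  unfolding cell_act_def cell_chain_def by (rule hom_induced_default) simp

context
  fixes K :: "real \<Rightarrow> real^4" and M :: "('a::topological_space, 'b::topological_space) cw_model"
  assumes model: "complement_model K M"
begin

abbreviation (input) "\<pi> \<equiv> knot_group K (base_pt M)"

lemma deck_homeomorphism:
  assumes "g \<in> carrier \<pi>"
  obtains f where "homeomorphism (cover M) (cover M) (deck M g) f"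
    "\<And>x. x \<in> cover M \<Longrightarrow> cover_proj M (deck M g x) = cover_proj M x"
proof -
  have "deck_action K M" using model by (simp add: complement_model_def)
  then show ?thesis using assms that unfolding deck_action_def by (elim ballE[of _ _ g]) auto
qed

lemma deck_mult:
  assumes "g \<in> carrier \<pi>" "h \<in> carrier \<pi>" "x \<in> cover M"
  shows "deck M (g \<otimes>\<^bsub>\<pi>\<^esub> h) x = deck M g (deck M h x)"
proof -
  have "deck_action K M" using model by (simp add: complement_model_def)
  then show ?thesis using assms unfolding deck_action_def by (elim ballE[of _ _ g]) auto
qed

lemma deck_preserves_skeleton:
  assumes "g \<in> carrier \<pi>"
  shows "continuous_map (top_of_set (cover_skeleton M k)) (top_of_set (cover_skeleton M k)) (deck M g)"
    and "deck M g \<in> cover_skeleton M k \<rightarrow> cover_skeleton M k"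
proof -
  obtain f where f: "homeomorphism (cover M) (cover M) (deck M g) f"
      "\<And>x. x \<in> cover M \<Longrightarrow> cover_proj M (deck M g x) = cover_proj M x"
    by (rule deck_homeomorphism[OF assms]) (rule that)
  show "deck M g \<in> cover_skeleton M k \<rightarrow> cover_skeleton M k"
    using f by (auto simp: cover_skeleton_def homeomorphism_def)
  moreover have "continuous_on (cover_skeleton M k) (deck M g)"
    using f(1) by (rule continuous_on_subset[OF homeomorphism_cont1]) (auto simp: cover_skeleton_def)
  ultimately show "continuous_map (top_of_set (cover_skeleton M k)) (top_of_set (cover_skeleton M k)) (deck M g)"
    by (simp add: continuous_map_subtopology_eu)
qed

lemma cell_act_mult:
  assumes "g \<in> carrier \<pi>" "h \<in> carrier \<pi>"
  shows "cell_act M k (g \<otimes>\<^bsub>\<pi>\<^esub> h) x = cell_act M k g (cell_act M k h x)"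
proof -
  have "deck M (g \<otimes>\<^bsub>\<pi>\<^esub> h) x = (deck M g \<circ> deck M h) x" if "x \<in> cover M" for x
    using deck_mult[OF assms that] by simp
  then have "cell_act M k (g \<otimes>\<^bsub>\<pi>\<^esub> h) = hom_induced k (top_of_set (cover_skeleton M k)) (cover_skeleton M (k - 1))
       (top_of_set (cover_skeleton M k)) (cover_skeleton M (k - 1)) (deck M g \<circ> deck M h)"
    unfolding cell_act_def by (intro hom_induced_eq) (auto simp: cover_skeleton_def)
  then show ?thesis
    unfolding cell_act_def using assms
    by (simp add: hom_induced_compose[OF deck_preserves_skeleton deck_preserves_skeleton])
qed

lemma base_pt_complement: "base_pt M \<in> knot_complement K"
  using model by (simp add: complement_model_def)

text \<open>
  The deck transformation of the unit is idempotent and injective, hence the identity.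
\<close>

lemma cell_act_one:
  assumes "x \<in> carrier (cell_chain M k)"
  shows "cell_act M k \<one>\<^bsub>\<pi>\<^esub> x = x"
proof -
  note one = fundamental_group_one_closed[OF base_pt_complement]
  obtain f where f: "homeomorphism (cover M) (cover M) (deck M \<one>\<^bsub>\<pi>\<^esub>) f"
    by (rule deck_homeomorphism[OF one]) (rule that)
  have "deck M \<one>\<^bsub>\<pi>\<^esub> x = x" if "x \<in> cover M" for x
  proof -
    have "deck M \<one>\<^bsub>\<pi>\<^esub> x \<in> cover M" using f that by (auto simp: homeomorphism_def)
    moreover have "deck M \<one>\<^bsub>\<pi>\<^esub> (deck M \<one>\<^bsub>\<pi>\<^esub> x) = deck M \<one>\<^bsub>\<pi>\<^esub> x"
      using deck_mult[OF one one that] fundamental_group_one_mult_one[OF base_pt_complement] by simp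
    ultimately show ?thesis
      using homeomorphism_apply1[OF f that] homeomorphism_apply1[OF f, of "deck M \<one>\<^bsub>\<pi>\<^esub> x"] by simp
  qed
  then show ?thesis
    using assms deck_preserves_skeleton(1)[OF one] unfolding cell_act_def cell_chain_def
    by (intro hom_induced_id_gen) (auto simp: cover_skeleton_def)
qed

text \<open>
  Naturality of the connecting homomorphism under deck transformations, which preserve all skeleta.
\<close>

lemma cell_boundary_act:
  assumes "g \<in> carrier \<pi>"
  shows "cell_boundary M k (cell_act M k g x) = cell_act M (k - 1) g (cell_boundary M k x)"
proof -
  let ?X = "\<lambda>k. cover_skeleton M k"
  note sub = subtopology_cover_skeleton[of M k]
  note cont = deck_preserves_skeleton[OF assms]
  define y where "y = hom_boundary k (top_of_set (?X k)) (?X (k - 1)) x"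
  have nat: "hom_boundary k (top_of_set (?X k)) (?X (k - 1)) (cell_act M k g x) =
      hom_induced (k - 1) (top_of_set (?X (k - 1))) {} (top_of_set (?X (k - 1))) {} (deck M g) y"
    using fun_cong[OF naturality_hom_induced[OF cont(1)[of k] cont(2)[of "k - 1"], of k], of x]
    by (simp add: cell_act_def sub y_def)
  have "hom_induced (k - 1) (top_of_set (?X (k - 1))) {} (top_of_set (?X (k - 1))) (?X (k - 2)) id
      (hom_induced (k - 1) (top_of_set (?X (k - 1))) {} (top_of_set (?X (k - 1))) {} (deck M g) y) =
    hom_induced (k - 1) (top_of_set (?X (k - 1))) {} (top_of_set (?X (k - 1))) (?X (k - 2)) (id \<circ> deck M g) y"
    by (rule hom_induced_compose'[OF cont(1)]) auto
  also have "\<dots> = hom_induced (k - 1) (top_of_set (?X (k - 1))) {} (top_of_set (?X (k - 1))) (?X (k - 2)) (deck M g \<circ> id) y"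
    by simp
  also have "\<dots> = hom_induced (k - 1) (top_of_set (?X (k - 1))) (?X (k - 2)) (top_of_set (?X (k - 1))) (?X (k - 2)) (deck M g)
      (hom_induced (k - 1) (top_of_set (?X (k - 1))) {} (top_of_set (?X (k - 1))) (?X (k - 2)) id y)"
    by (rule hom_induced_compose'[symmetric]) (use cont in auto)
  finally show ?thesis
    unfolding cell_boundary_def o_apply nat sub y_def[symmetric]
    by (simp add: cell_act_def)
qed

end

section \<open>Based modules over a group ring\<close>

lemma hom_finprod:
  assumes "comm_group G" "comm_group H" "h \<in> hom G H" "f \<in> I \<rightarrow> carrier G"
  shows "h (finprod G f I) = finprod H (\<lambda>i. h (f i)) I"
proof -
  interpret G: comm_group G by fact
  interpret H: comm_group H by fact
  interpret h: group_hom G H h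
    by (intro group_hom.intro group_hom_axioms.intro G.is_group H.is_group assms(3))
  show ?thesis
    using assms(4) by (induction I rule: infinite_finite_induct) (auto simp: Pi_iff)
qed

text \<open>
  A left \<open>\<int>\<Gamma>\<close>-module with a finite basis \<open>b\<close>. The action is total: outside the module it takes the value
  one, as induced maps in homology do.
\<close>

locale group_ring_basis =
  fixes \<Gamma> :: "('g, 'w) monoid_scheme" and N :: "('c, 'z) monoid_scheme"
    and act :: "'g \<Rightarrow> 'c \<Rightarrow> 'c" and b :: "nat \<Rightarrow> 'c" and m :: nat
  assumes N: "comm_group N"
    and mult_closed: "\<And>g h. g \<in> carrier \<Gamma> \<Longrightarrow> h \<in> carrier \<Gamma> \<Longrightarrow> g \<otimes>\<^bsub>\<Gamma>\<^esub> h \<in> carrier \<Gamma>"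
    and one_closed: "\<one>\<^bsub>\<Gamma>\<^esub> \<in> carrier \<Gamma>"
    and act_hom: "\<And>g. g \<in> carrier \<Gamma> \<Longrightarrow> act g \<in> hom N N"
    and act_default: "\<And>g x. g \<in> carrier \<Gamma> \<Longrightarrow> x \<notin> carrier N \<Longrightarrow> act g x = \<one>\<^bsub>N\<^esub>"
    and act_mult: "\<And>g h x. g \<in> carrier \<Gamma> \<Longrightarrow> h \<in> carrier \<Gamma> \<Longrightarrow> act (g \<otimes>\<^bsub>\<Gamma>\<^esub> h) x = act g (act h x)"
    and act_one: "\<And>x. x \<in> carrier N \<Longrightarrow> act \<one>\<^bsub>\<Gamma>\<^esub> x = x"
    and basis: "\<And>x. x \<in> carrier N \<Longrightarrow>
      \<exists>!a. a \<in> {..<m} \<rightarrow>\<^sub>E {a. Poly_Mapping.keys a \<subseteq> carrier \<Gamma>} \<and>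
           x = finprod N (\<lambda>i. group_ring_act N act (a i) (b i)) {..<m}"
begin

sublocale N: comm_group N by (rule N)

abbreviation "gact \<equiv> group_ring_act N act"

lemma act_closed [simp]: "g \<in> carrier \<Gamma> \<Longrightarrow> act g x \<in> carrier N"
  using act_hom[of g] act_default[of g x] by (cases "x \<in> carrier N") (auto simp: hom_def)

lemma gact_superset:
  assumes "finite S" "Poly_Mapping.keys a \<subseteq> S" "S \<subseteq> carrier \<Gamma>"
  shows "gact a x = finprod N (\<lambda>g. act g x [^]\<^bsub>N\<^esub> Poly_Mapping.lookup a g) S"
  unfolding group_ring_act_def
  by (rule N.finprod_mono_neutral_cong_left) (use assms in \<open>auto simp: in_keys_iff\<close>)

lemma gact_hom: "(\<lambda>a. gact a x) \<in> hom (free_Abelian_group (carrier \<Gamma>)) N"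
proof (rule homI)
  fix a c assume "a \<in> carrier (free_Abelian_group (carrier \<Gamma>))" "c \<in> carrier (free_Abelian_group (carrier \<Gamma>))"
  then have keys: "Poly_Mapping.keys a \<subseteq> carrier \<Gamma>" "Poly_Mapping.keys c \<subseteq> carrier \<Gamma>" by simp_all
  define S where "S = Poly_Mapping.keys a \<union> Poly_Mapping.keys c"
  have S: "finite S" "S \<subseteq> carrier \<Gamma>" using keys by (auto simp: S_def)
  then have cl: "\<And>g. g \<in> S \<Longrightarrow> act g x \<in> carrier N" by auto
  have "gact (a + c) x = finprod N (\<lambda>g. act g x [^]\<^bsub>N\<^esub> (Poly_Mapping.lookup a g + Poly_Mapping.lookup c g)) S"
    using S keys_add[of a c] by (subst gact_superset[of S]) (auto simp: S_def lookup_add)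
  also have "\<dots> = finprod N (\<lambda>g. act g x [^]\<^bsub>N\<^esub> Poly_Mapping.lookup a g \<otimes>\<^bsub>N\<^esub> act g x [^]\<^bsub>N\<^esub> Poly_Mapping.lookup c g) S"
    using cl by (intro N.finprod_cong') (auto simp: N.int_pow_mult)
  also have "\<dots> = gact a x \<otimes>\<^bsub>N\<^esub> gact c x"
    using S cl by (simp add: gact_superset[of S] S_def Pi_iff)
  finally show "gact (a \<otimes>\<^bsub>free_Abelian_group (carrier \<Gamma>)\<^esub> c) x = gact a x \<otimes>\<^bsub>N\<^esub> gact c x" by simp
qed (auto simp: group_ring_act_def intro!: N.finprod_closed)

lemma gact_closed: "Poly_Mapping.keys a \<subseteq> carrier \<Gamma> \<Longrightarrow> gact a x \<in> carrier N"
  using hom_in_carrier[OF gact_hom, of a x] by simp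

lemma gact_zero [simp]: "gact 0 x = \<one>\<^bsub>N\<^esub>"
  by (simp add: group_ring_act_def)

lemma gact_frag_of: "g \<in> carrier \<Gamma> \<Longrightarrow> gact (frag_of g) x = act g x"
  by (simp add: group_ring_act_def)

lemma gact_add:
  assumes "Poly_Mapping.keys a \<subseteq> carrier \<Gamma>" "Poly_Mapping.keys c \<subseteq> carrier \<Gamma>"
  shows "gact (a + c) x = gact a x \<otimes>\<^bsub>N\<^esub> gact c x"
  using hom_mult[OF gact_hom, of a c x] assms by simp

lemma gact_diff:
  assumes "Poly_Mapping.keys a \<subseteq> carrier \<Gamma>" "Poly_Mapping.keys c \<subseteq> carrier \<Gamma>"
  shows "gact (a - c) x = gact a x \<otimes>\<^bsub>N\<^esub> inv\<^bsub>N\<^esub> gact c x"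
proof -
  have "Poly_Mapping.keys (a - c) \<subseteq> carrier \<Gamma>" using keys_diff[of a c] assms by blast
  then have "gact a x = gact (a - c) x \<otimes>\<^bsub>N\<^esub> gact c x"
    using gact_add[of "a - c" c x] assms by simp
  moreover have "gact (a - c) x \<in> carrier N" "gact c x \<in> carrier N"
    using \<open>Poly_Mapping.keys (a - c) \<subseteq> carrier \<Gamma>\<close> assms by (simp_all add: gact_closed)
  ultimately show ?thesis by (simp add: N.m_assoc)
qed

text \<open>
  Left multiplication by \<open>h\<close> in the group ring.
\<close>

definition shift :: "'g \<Rightarrow> 'g frag \<Rightarrow> 'g frag" where
  "shift h = frag_extend (\<lambda>g. frag_of (h \<otimes>\<^bsub>\<Gamma>\<^esub> g))"

lemma shift_closed:
  "h \<in> carrier \<Gamma> \<Longrightarrow> Poly_Mapping.keys a \<subseteq> carrier \<Gamma> \<Longrightarrow> Poly_Mapping.keys (shift h a) \<subseteq> carrier \<Gamma>"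
  using keys_frag_extend[of "\<lambda>g. frag_of (h \<otimes>\<^bsub>\<Gamma>\<^esub> g)" a] mult_closed unfolding shift_def by fastforce

lemma shift_diff: "shift h (a - c) = shift h a - shift h c"
  by (simp add: shift_def frag_extend_diff)

lemma act_gact:
  assumes h: "h \<in> carrier \<Gamma>" and a: "Poly_Mapping.keys a \<subseteq> carrier \<Gamma>"
  shows "act h (gact a x) = gact (shift h a) x"
proof -
  interpret h: group_hom N N "act h"
    by (intro group_hom.intro group_hom_axioms.intro N.is_group act_hom h)
  have "Poly_Mapping.keys a \<subseteq> carrier \<Gamma> \<and> act h (gact a x) = gact (shift h a) x"
    using a
  proof (rule free_Abelian_group_induct)
    fix a c
    assume *: "Poly_Mapping.keys a \<subseteq> carrier \<Gamma>" "Poly_Mapping.keys c \<subseteq> carrier \<Gamma>"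
      "Poly_Mapping.keys a \<subseteq> carrier \<Gamma> \<and> act h (gact a x) = gact (shift h a) x"
      "Poly_Mapping.keys c \<subseteq> carrier \<Gamma> \<and> act h (gact c x) = gact (shift h c) x"
    then show "Poly_Mapping.keys (a - c) \<subseteq> carrier \<Gamma> \<and> act h (gact (a - c) x) = gact (shift h (a - c)) x"
      using keys_diff[of a c] shift_closed[OF h] by (auto simp: gact_diff shift_diff gact_closed)
  qed (use h in \<open>auto simp: shift_def gact_frag_of act_mult mult_closed\<close>)
  then show ?thesis by simp
qed

text \<open>
  Outside the module the action is trivial, so a basis vector that did not lie in the module could be given
  any coefficient, against uniqueness of coordinates.
\<close>

lemma basis_closed:
  assumes i: "i < m"
  shows "b i \<in> carrier N"
proof (rule ccontr)
  assume b: "b i \<notin> carrier N"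
  define P where "P a \<longleftrightarrow> a \<in> {..<m} \<rightarrow>\<^sub>E {a. Poly_Mapping.keys a \<subseteq> carrier \<Gamma>} \<and>
    \<one>\<^bsub>N\<^esub> = finprod N (\<lambda>i. gact (a i) (b i)) {..<m}" for a
  have "\<exists>!a. P a"
    unfolding P_def by (rule basis[OF N.one_closed])
  then obtain a where "P a" and "\<forall>a'. P a' \<longrightarrow> a' = a"
    by (rule ex1E) (rule that)
  then have unique: "\<And>a'. P a' \<Longrightarrow> a' = a" by blast
  have a: "a \<in> {..<m} \<rightarrow>\<^sub>E {a. Poly_Mapping.keys a \<subseteq> carrier \<Gamma>}"
    using \<open>P a\<close> unfolding P_def by (rule conjunct1)
  have a_sum: "\<one>\<^bsub>N\<^esub> = finprod N (\<lambda>i. gact (a i) (b i)) {..<m}"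
    using \<open>P a\<close> unfolding P_def by (rule conjunct2)
  have trivial: "gact c (b i) = \<one>\<^bsub>N\<^esub>" if "Poly_Mapping.keys c \<subseteq> carrier \<Gamma>" for c
    unfolding group_ring_act_def using that b
    by (intro N.finprod_one_eqI) (auto simp: act_default subset_iff)
  have "a(i := c) = a" if c: "Poly_Mapping.keys c \<subseteq> carrier \<Gamma>" for c
  proof (intro unique, unfold P_def, intro conjI)
    show "a(i := c) \<in> {..<m} \<rightarrow>\<^sub>E {a. Poly_Mapping.keys a \<subseteq> carrier \<Gamma>}"
      using a c i by (auto simp: PiE_iff extensional_def)
    have "Poly_Mapping.keys (a j) \<subseteq> carrier \<Gamma>" if "j < m" for j using a that by auto
    then show "\<one>\<^bsub>N\<^esub> = finprod N (\<lambda>j. gact ((a(i := c)) j) (b j)) {..<m}"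
      by (subst a_sum, intro N.finprod_cong') (use trivial c i in \<open>auto simp: gact_closed\<close>)
  qed
  from fun_cong[OF this[of 0], of i] fun_cong[OF this[of "frag_of \<one>\<^bsub>\<Gamma>\<^esub>"], of i]
  have "a i = 0" "a i = frag_of \<one>\<^bsub>\<Gamma>\<^esub>"
    using one_closed by simp_all
  then show False by simp
qed

definition coeff :: "'c \<Rightarrow> nat \<Rightarrow> 'g frag" where
  "coeff x = (THE a. a \<in> {..<m} \<rightarrow>\<^sub>E {a. Poly_Mapping.keys a \<subseteq> carrier \<Gamma>} \<and>
     x = finprod N (\<lambda>i. gact (a i) (b i)) {..<m})"

lemma coeff:
  assumes "x \<in> carrier N"
  shows "coeff x \<in> {..<m} \<rightarrow>\<^sub>E {a. Poly_Mapping.keys a \<subseteq> carrier \<Gamma>}"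
    and "x = finprod N (\<lambda>i. gact (coeff x i) (b i)) {..<m}"
  using theI'[OF basis[OF assms]] unfolding coeff_def by simp_all

lemma coeff_keys: "x \<in> carrier N \<Longrightarrow> i < m \<Longrightarrow> Poly_Mapping.keys (coeff x i) \<subseteq> carrier \<Gamma>"
  using coeff(1)[of x] by auto

lemma coeff_eqI:
  assumes keys: "\<And>i. i < m \<Longrightarrow> Poly_Mapping.keys (a i) \<subseteq> carrier \<Gamma>"
    and x: "x = finprod N (\<lambda>i. gact (a i) (b i)) {..<m}" and i: "i < m"
  shows "coeff x i = a i"
proof -
  have "x \<in> carrier N"
    unfolding x by (rule N.finprod_closed) (use keys in \<open>auto simp: gact_closed\<close>)
  moreover have "restrict a {..<m} \<in> {..<m} \<rightarrow>\<^sub>E {a. Poly_Mapping.keys a \<subseteq> carrier \<Gamma>}"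
    using keys by auto
  moreover have "x = finprod N (\<lambda>i. gact (restrict a {..<m} i) (b i)) {..<m}"
    unfolding x using keys by (intro N.finprod_cong') (auto simp: gact_closed)
  ultimately have "coeff x = restrict a {..<m}"
    unfolding coeff_def by (intro the1_equality[OF basis] conjI)
  then show ?thesis using i by simp
qed

lemma coeff_mult:
  assumes "x \<in> carrier N" "y \<in> carrier N" "i < m"
  shows "coeff (x \<otimes>\<^bsub>N\<^esub> y) i = coeff x i + coeff y i"
proof (rule coeff_eqI[OF _ _ assms(3)])
  show "Poly_Mapping.keys (coeff x i + coeff y i) \<subseteq> carrier \<Gamma>" if "i < m" for i
    using keys_add[of "coeff x i" "coeff y i"] coeff_keys assms that by blast
  have "x \<otimes>\<^bsub>N\<^esub> y = finprod N (\<lambda>i. gact (coeff x i) (b i)) {..<m} \<otimes>\<^bsub>N\<^esub> finprod N (\<lambda>i. gact (coeff y i) (b i)) {..<m}"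
    using coeff(2) assms by simp
  also have "\<dots> = finprod N (\<lambda>i. gact (coeff x i) (b i) \<otimes>\<^bsub>N\<^esub> gact (coeff y i) (b i)) {..<m}"
    by (rule N.finprod_multf[symmetric]) (use assms in \<open>auto intro!: gact_closed dest: coeff_keys\<close>)
  also have "\<dots> = finprod N (\<lambda>i. gact (coeff x i + coeff y i) (b i)) {..<m}"
    using assms by (intro N.finprod_cong') (auto simp: gact_add coeff_keys gact_closed)
  finally show "x \<otimes>\<^bsub>N\<^esub> y = finprod N (\<lambda>i. gact (coeff x i + coeff y i) (b i)) {..<m}" .
qed

lemma coeff_act:
  assumes "h \<in> carrier \<Gamma>" "x \<in> carrier N" "i < m"
  shows "coeff (act h x) i = shift h (coeff x i)"
proof (rule coeff_eqI[OF _ _ assms(3)])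
  show "Poly_Mapping.keys (shift h (coeff x i)) \<subseteq> carrier \<Gamma>" if "i < m" for i
    using shift_closed coeff_keys assms that by simp
  have "act h x = act h (finprod N (\<lambda>i. gact (coeff x i) (b i)) {..<m})"
    using coeff(2)[OF assms(2)] by simp
  also have "\<dots> = finprod N (\<lambda>i. act h (gact (coeff x i) (b i))) {..<m}"
    by (rule hom_finprod[OF N N act_hom[OF assms(1)]]) (use assms in \<open>auto simp: gact_closed coeff_keys\<close>)
  also have "\<dots> = finprod N (\<lambda>i. gact (shift h (coeff x i)) (b i)) {..<m}"
    using assms by (intro N.finprod_cong') (auto simp: act_gact coeff_keys shift_closed gact_closed)
  finally show "act h x = finprod N (\<lambda>i. gact (shift h (coeff x i)) (b i)) {..<m}" .
qed

lemma coeff_basis: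
  assumes "i < m" "j < m"
  shows "coeff (b j) i = (if i = j then frag_of \<one>\<^bsub>\<Gamma>\<^esub> else 0)"
proof (rule coeff_eqI[OF _ _ assms(1)])
  show "Poly_Mapping.keys (if i = j then frag_of \<one>\<^bsub>\<Gamma>\<^esub> else 0) \<subseteq> carrier \<Gamma>" for i
    using one_closed by simp
  have "b j = finprod N (\<lambda>i. if j = i then b i else \<one>\<^bsub>N\<^esub>) {..<m}"
    using assms by (intro N.finprod_singleton[symmetric]) (auto simp: basis_closed)
  also have "\<dots> = finprod N (\<lambda>i. gact (if i = j then frag_of \<one>\<^bsub>\<Gamma>\<^esub> else 0) (b i)) {..<m}"
    using one_closed
    by (intro N.finprod_cong') (auto simp: gact_frag_of act_one basis_closed)
  finally show "b j = finprod N (\<lambda>i. gact (if i = j then frag_of \<one>\<^bsub>\<Gamma>\<^esub> else 0) (b i)) {..<m}" .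
qed

end

section \<open>Column vectors and blocks of indices\<close>

lemma comm_group_col_vectors: "comm_group (col_vectors n :: 'r::comm_ring_1 Matrix.vec monoid)"
proof (rule comm_groupI)
  fix x :: "'r Matrix.vec" assume "x \<in> carrier (col_vectors n)"
  then show "\<exists>y\<in>carrier (col_vectors n). y \<otimes>\<^bsub>col_vectors n\<^esub> x = \<one>\<^bsub>col_vectors n\<^esub>"
    by (intro bexI[of _ "- x"]) (auto simp: col_vectors_def)
qed (auto simp: col_vectors_def comm_add_vec intro!: assoc_add_vec)

lemma col_vectors_simps [simp]:
  "carrier (col_vectors n) = carrier_vec n"
  "u \<otimes>\<^bsub>col_vectors n\<^esub> v = u + v"
  "\<one>\<^bsub>col_vectors n\<^esub> = 0\<^sub>v n"
  by (simp_all add: col_vectors_def)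

lemma inv_col_vectors: "u \<in> carrier_vec n \<Longrightarrow> inv\<^bsub>col_vectors n\<^esub> u = - (u :: 'r::comm_ring_1 Matrix.vec)"
  by (rule group.inv_equality[OF comm_group.axioms(2)[OF comm_group_col_vectors]]) auto

lemma finprod_col_vectors_closed:
  "f \<in> I \<rightarrow> carrier_vec n \<Longrightarrow> finprod (col_vectors n) f I \<in> (carrier_vec n :: 'r::comm_ring_1 Matrix.vec set)"
  using comm_monoid.finprod_closed[OF comm_group.axioms(1)[OF comm_group_col_vectors], of f I] by simp

lemma finprod_col_vectors_index:
  fixes f :: "'i \<Rightarrow> 'r::comm_ring_1 Matrix.vec"
  assumes "f \<in> I \<rightarrow> carrier_vec n" "j < n"
  shows "finprod (col_vectors n) f I $ j = (\<Sum>i\<in>I. f i $ j)"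
proof -
  interpret V: comm_group "col_vectors n :: 'r Matrix.vec monoid" by (rule comm_group_col_vectors)
  show ?thesis
    using assms(1)
  proof (induction I rule: infinite_finite_induct)
    case (insert i I)
    then have "f \<in> I \<rightarrow> carrier_vec n" by auto
    then show ?case
      using insert assms(2) finprod_col_vectors_closed[of f I n] by (auto simp: Pi_iff)
  qed (use assms(2) in auto)
qed

text \<open>
  Coordinates of twisted chains are numbered by \<open>i * n + j\<close>, where \<open>i\<close> is the number of a cell and
  \<open>j < n\<close>.
\<close>

lemma sum_block:
  fixes f :: "nat \<Rightarrow> 'a::comm_monoid_add"
  assumes "i < m"
  shows "(\<Sum>q<m * n. if q div n = i then f q else 0) = (\<Sum>j<n. f (i * n + j))"
proof -
  have "(\<Sum>j<n. f (i * n + j)) = sum f ((\<lambda>j. i * n + j) ` {..<n})"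
    by (rule sum.reindex[symmetric, unfolded o_def]) (simp add: inj_on_def)
  also have "(\<lambda>j. i * n + j) ` {..<n} = {q. q < m * n \<and> q div n = i}"
  proof safe
    fix j assume "j < n"
    then have "i * n + j < Suc i * n" by simp
    also have "\<dots> \<le> m * n" using assms by (intro mult_le_mono1) simp
    finally show "i * n + j < m * n" .
    show "(i * n + j) div n = i" using \<open>j < n\<close> by simp
  next
    fix q assume "q < m * n" "i = q div n"
    then have "q = q div n * n + q mod n" "q mod n < n" by (simp, cases n) auto
    then show "q \<in> (\<lambda>j. q div n * n + j) ` {..<n}" by blast
  qed
  also have "sum f \<dots> = (\<Sum>q<m * n. if q div n = i then f q else 0)"
    by (rule sum.mono_neutral_cong_left) auto
  finally show ?thesis ..
qed

lemma block_index:
  fixes i j m n :: nat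
  assumes "i < m" "j < n"
  shows "i * n + j < m * n" "(i * n + j) div n = i" "(i * n + j) mod n = j"
proof -
  have "i * n + j < Suc i * n" using assms by simp
  also have "\<dots> \<le> m * n" using assms by (intro mult_le_mono1) simp
  finally show "i * n + j < m * n" .
qed (use assms in auto)

lemma block_div_mod:
  fixes p m n :: nat
  assumes "p < m * n"
  shows "p div n < m" "p mod n < n" "p div n * n + p mod n = p"
  using assms by (simp_all add: less_mult_imp_div_less) (cases n; simp)

section \<open>Twisted chains in coordinates\<close>

text \<open>
  The linear extension of a matrix representation to the group ring.
\<close>

definition evaluate :: "nat \<Rightarrow> ('g \<Rightarrow> 'r::comm_ring_1 Matrix.mat) \<Rightarrow> 'g frag \<Rightarrow> 'r Matrix.mat" where
  "evaluate n A a = Matrix.mat n n (\<lambda>(i, j). \<Sum>g\<in>Poly_Mapping.keys a. of_int (Poly_Mapping.lookup a g) * A g $$ (i, j))"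

lemma evaluate_carrier [simp]: "evaluate n A a \<in> carrier_mat n n"
  by (simp add: evaluate_def)

lemma dim_evaluate [simp]: "dim_row (evaluate n A a) = n" "dim_col (evaluate n A a) = n"
  by (simp_all add: evaluate_def)

lemma evaluate_superset:
  assumes "finite S" "Poly_Mapping.keys a \<subseteq> S" "i < n" "j < n"
  shows "evaluate n A a $$ (i, j) = (\<Sum>g\<in>S. of_int (Poly_Mapping.lookup a g) * A g $$ (i, j))"
  using assms unfolding evaluate_def
  by (auto intro!: sum.mono_neutral_left simp: in_keys_iff)

lemma evaluate_add: "evaluate n A (a + c) = evaluate n A a + evaluate n A c"
proof (rule eq_matI)
  fix i j assume "i < dim_row (evaluate n A a + evaluate n A c)" "j < dim_col (evaluate n A a + evaluate n A c)"
  then have ij: "i < n" "j < n" by (simp_all add: evaluate_def)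
  let ?S = "Poly_Mapping.keys a \<union> Poly_Mapping.keys c"
  have eq: "evaluate n A d $$ (i, j) = (\<Sum>g\<in>?S. of_int (Poly_Mapping.lookup d g) * A g $$ (i, j))"
    if "Poly_Mapping.keys d \<subseteq> ?S" for d
    using that ij by (intro evaluate_superset) auto
  have "evaluate n A (a + c) $$ (i, j) = evaluate n A a $$ (i, j) + evaluate n A c $$ (i, j)"
    using keys_add[of a c] by (simp add: eq lookup_add ring_distribs sum.distrib)
  then show "evaluate n A (a + c) $$ (i, j) = (evaluate n A a + evaluate n A c) $$ (i, j)"
    using ij by (simp add: evaluate_def)
qed (simp_all add: evaluate_def)

lemma evaluate_zero: "evaluate n A 0 = 0\<^sub>m n n"
  by (rule eq_matI) (simp_all add: evaluate_def)

lemma evaluate_diff: "evaluate n A (a - c) = evaluate n A a - evaluate n A c"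
proof -
  have "evaluate n A a = evaluate n A (a - c) + evaluate n A c"
    using evaluate_add[of n A "a - c" c] by simp
  then show ?thesis
    by (intro eq_matI) (simp_all add: evaluate_def)
qed

lemma evaluate_frag_of: "A g \<in> carrier_mat n n \<Longrightarrow> evaluate n A (frag_of g) = A g"
  by (rule eq_matI) (auto simp: evaluate_def)

lemma (in comm_ring_hom) map_evaluate:
  assumes "\<And>g. g \<in> Poly_Mapping.keys a \<Longrightarrow> A g \<in> carrier_mat n n"
  shows "map_mat hom (evaluate n A a) = evaluate n (\<lambda>g. map_mat hom (A g)) a"
proof (rule eq_matI)
  fix i j assume "i < dim_row (evaluate n (\<lambda>g. map_mat hom (A g)) a)"
    "j < dim_col (evaluate n (\<lambda>g. map_mat hom (A g)) a)"
  then have ij: "i < n" "j < n" by (simp_all add: evaluate_def)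
  have "hom (A g $$ (i, j)) = map_mat hom (A g) $$ (i, j)" if "g \<in> Poly_Mapping.keys a" for g
    using assms[OF that] ij by auto
  then show "map_mat hom (evaluate n A a) $$ (i, j) = evaluate n (\<lambda>g. map_mat hom (A g)) a $$ (i, j)"
    using ij by (auto simp: evaluate_def hom_sum hom_mult hom_of_int intro!: sum.cong)
qed (simp_all add: evaluate_def)

lemma mult_mat_vec_smult:
  fixes A :: "'a::comm_ring_1 Matrix.mat"
  assumes "A \<in> carrier_mat n k" "v \<in> carrier_vec k"
  shows "A *\<^sub>v (s \<cdot>\<^sub>v v) = s \<cdot>\<^sub>v (A *\<^sub>v v)"
  using assms by (intro eq_vecI) (auto simp: scalar_prod_smult_distrib[of _ k])

text \<open>
  Coefficients in column vectors, on which \<open>\<Gamma>\<close> acts from the right through the antihomomorphism \<open>A\<close>.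
\<close>

locale twisted_basis = group_ring_basis \<Gamma> N act b m
  for \<Gamma> :: "('g, 'w) monoid_scheme" and N :: "('c, 'z) monoid_scheme"
    and act :: "'g \<Rightarrow> 'c \<Rightarrow> 'c" and b :: "nat \<Rightarrow> 'c" and m :: nat +
  fixes n :: nat and A :: "'g \<Rightarrow> 'r::comm_ring_1 Matrix.mat"
  assumes A_carrier: "\<And>g. g \<in> carrier \<Gamma> \<Longrightarrow> A g \<in> carrier_mat n n"
    and A_mult: "\<And>g h. g \<in> carrier \<Gamma> \<Longrightarrow> h \<in> carrier \<Gamma> \<Longrightarrow> A (g \<otimes>\<^bsub>\<Gamma>\<^esub> h) = A h * A g"
    and A_one: "A \<one>\<^bsub>\<Gamma>\<^esub> = 1\<^sub>m n"
begin

abbreviation "ev \<equiv> evaluate n A"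

text \<open>
  As \<open>A\<close> reverses products, left multiplication in the group ring becomes right multiplication.
\<close>

lemma evaluate_shift:
  assumes h: "h \<in> carrier \<Gamma>" and a: "Poly_Mapping.keys a \<subseteq> carrier \<Gamma>"
  shows "ev (shift h a) = ev a * A h"
  using a
proof (rule free_Abelian_group_induct)
  show "ev (shift h 0) = ev 0 * A h"
    using A_carrier[OF h] by (simp add: shift_def evaluate_zero)
  show "ev (shift h (a - c)) = ev (a - c) * A h"
    if "ev (shift h a) = ev a * A h" "ev (shift h c) = ev c * A h" for a c
    unfolding shift_diff evaluate_diff that
    by (rule minus_mult_distrib_mat[OF evaluate_carrier evaluate_carrier A_carrier[OF h], symmetric])
  show "ev (shift h (frag_of g)) = ev (frag_of g) * A h" if "g \<in> carrier \<Gamma>" for g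
    using evaluate_frag_of[of A "h \<otimes>\<^bsub>\<Gamma>\<^esub> g", OF A_carrier[OF mult_closed[OF h that]]]
      evaluate_frag_of[of A g, OF A_carrier[OF that]]
    by (simp add: shift_def A_mult[OF h that])
qed

sublocale tensor "carrier \<Gamma>" "col_vectors n" "\<lambda>v g. A g *\<^sub>v v" N act
  by (rule tensor.intro)
    (auto intro!: mult_mat_vec_carrier[OF A_carrier] comm_group_col_vectors N)

lemma scale_hom: "(\<lambda>v :: 'r Matrix.vec. s \<cdot>\<^sub>v v) \<in> hom (col_vectors k) (col_vectors k)"
  by (rule homI) (auto simp: smult_add_distrib_vec)

text \<open>
  If \<open>x = \<Sum>\<^sub>i a\<^sub>i b\<^sub>i\<close>, then \<open>v \<otimes> x = \<Sum>\<^sub>i (v \<cdot> a\<^sub>i) \<otimes> b\<^sub>i\<close>, so block number \<open>i\<close> of the coordinate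
  vector is \<open>A(a\<^sub>i) v\<close>.
\<close>

definition coords_pure :: "'r Matrix.vec \<Rightarrow> 'c \<Rightarrow> 'r Matrix.vec" where
  "coords_pure v x = Matrix.vec (m * n) (\<lambda>p. (ev (coeff x (p div n)) *\<^sub>v v) $ (p mod n))"

text \<open>
  The formula for pure tensors is biadditive and balanced; the universal property extends it.
\<close>

lemma coords_exist:
  "\<exists>h. h \<in> hom T (col_vectors (m * n)) \<and>
    (\<forall>v\<in>carrier_vec n. \<forall>x\<in>carrier N. h (pure v x) = coords_pure v x)"
proof -
  obtain h where "h \<in> hom T (col_vectors (m * n))"
      "\<And>(v :: 'r Matrix.vec) x. v \<in> carrier (col_vectors n) \<Longrightarrow> x \<in> carrier N \<Longrightarrow> h (pure v x) = coords_pure v x"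
  proof (rule universal[OF comm_group_col_vectors, of coords_pure "m * n"])
    fix u v :: "'r Matrix.vec" and x y :: 'c
    assume u: "u \<in> carrier (col_vectors n)" and x: "x \<in> carrier N"
    show "coords_pure u x \<in> carrier (col_vectors (m * n))" by (simp add: coords_pure_def)
    show "coords_pure (u \<otimes>\<^bsub>col_vectors n\<^esub> v) x = coords_pure u x \<otimes>\<^bsub>col_vectors (m * n)\<^esub> coords_pure v x"
      if "v \<in> carrier (col_vectors n)"
      using u that block_div_mod[of _ m n]
      by (intro eq_vecI)
        (simp_all add: coords_pure_def mult_add_distrib_mat_vec[OF evaluate_carrier] del: index_mult_mat_vec)
    show "coords_pure u (x \<otimes>\<^bsub>N\<^esub> y) = coords_pure u x \<otimes>\<^bsub>col_vectors (m * n)\<^esub> coords_pure u y"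
      if "y \<in> carrier N"
      using u x that block_div_mod[of _ m n]
      by (intro eq_vecI)
        (simp_all add: coords_pure_def coeff_mult evaluate_add
          add_mult_distrib_mat_vec[OF evaluate_carrier evaluate_carrier] del: index_mult_mat_vec)
    show "coords_pure (A g *\<^sub>v u) x = coords_pure u (act g x)" if "g \<in> carrier \<Gamma>" for g
      using u x that block_div_mod[of _ m n]
      by (intro eq_vecI)
        (simp_all add: coords_pure_def coeff_act evaluate_shift coeff_keys
          assoc_mult_mat_vec[OF evaluate_carrier A_carrier] del: index_mult_mat_vec)
  qed (rule that)
  then show ?thesis by auto
qed

definition coords :: "('r Matrix.vec \<times> 'c) frag set \<Rightarrow> 'r Matrix.vec" where
  "coords = (SOME h. h \<in> hom T (col_vectors (m * n)) \<and>
    (\<forall>v\<in>carrier_vec n. \<forall>x\<in>carrier N. h (pure v x) = coords_pure v x))"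

lemma coords_spec:
  "coords \<in> hom T (col_vectors (m * n)) \<and>
    (\<forall>v\<in>carrier_vec n. \<forall>x\<in>carrier N. coords (pure v x) = coords_pure v x)"
  unfolding coords_def by (rule someI_ex[OF coords_exist])

lemma coords_hom: "coords \<in> hom T (col_vectors (m * n))"
  using coords_spec by (rule conjunct1)

lemma coords_pure:
  fixes v :: "'r Matrix.vec"
  assumes "v \<in> carrier_vec n" "x \<in> carrier N"
  shows "coords (pure v x) = coords_pure v x"
  using conjunct2[OF coords_spec] assms by simp

lemma coords_closed: "X \<in> carrier T \<Longrightarrow> coords X \<in> carrier_vec (m * n)"
  using hom_in_carrier[OF coords_hom] by simp

lemma coords_pure_basis:
  assumes "v \<in> carrier_vec n" "i < m" "p < m * n"
  shows "coords (pure v (b i)) $ p = (if p div n = i then v $ (p mod n) else 0)"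
  using assms one_closed block_div_mod[OF assms(3)]
  by (auto simp: coords_pure basis_closed coords_pure_def coeff_basis evaluate_zero evaluate_frag_of
      A_carrier A_one)

definition block :: "'r Matrix.vec \<Rightarrow> nat \<Rightarrow> 'r Matrix.vec" where
  "block w i = Matrix.vec n (\<lambda>j. w $ (i * n + j))"

definition from_coords :: "'r Matrix.vec \<Rightarrow> ('r Matrix.vec \<times> 'c) frag set" where
  "from_coords w = finprod T (\<lambda>i. pure (block w i) (b i)) {..<m}"

lemma block_carrier [simp]: "block w i \<in> carrier_vec n"
  by (simp add: block_def)

lemma from_coords_closed: "from_coords w \<in> carrier T"
  unfolding from_coords_def by (rule T.finprod_closed) (auto simp: basis_closed)

lemma from_coords_hom: "from_coords \<in> hom (col_vectors (m * n)) T"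
proof (rule homI)
  fix u w :: "'r Matrix.vec"
  assume uw: "u \<in> carrier (col_vectors (m * n))" "w \<in> carrier (col_vectors (m * n))"
  have "block (u + w) i = block u i + block w i" if "i < m" for i
    using uw block_index(1)[OF that] by (intro eq_vecI) (auto simp: block_def)
  then have "from_coords (u + w) = finprod T (\<lambda>i. pure (block u i) (b i) \<otimes>\<^bsub>T\<^esub> pure (block w i) (b i)) {..<m}"
    unfolding from_coords_def
    by (intro T.finprod_cong') (auto simp: basis_closed pure_mult_left[simplified])
  also have "\<dots> = from_coords u \<otimes>\<^bsub>T\<^esub> from_coords w"
    unfolding from_coords_def by (rule T.finprod_multf) (auto simp: basis_closed)
  finally show "from_coords (u \<otimes>\<^bsub>col_vectors (m * n)\<^esub> w) = from_coords u \<otimes>\<^bsub>T\<^esub> from_coords w" by simp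
qed (rule from_coords_closed)

text \<open>
  Balancing over the group ring follows from balancing over the group, since both sides are additive in \<open>a\<close>.
\<close>

lemma pure_evaluate:
  assumes v: "v \<in> carrier_vec n" and y: "y \<in> carrier N" and a: "Poly_Mapping.keys a \<subseteq> carrier \<Gamma>"
  shows "pure (ev a *\<^sub>v v) y = pure v (group_ring_act N act a y)"
proof -
  interpret l: group_hom "col_vectors n" T "\<lambda>u. pure u y"
    by (intro group_hom.intro group_hom_axioms.intro M.is_group T.is_group pure_hom_left y)
  interpret r: group_hom N T "pure v"
    by (intro group_hom.intro group_hom_axioms.intro N.is_group T.is_group pure_hom_right) (simp add: v)
  have "Poly_Mapping.keys a \<subseteq> carrier \<Gamma> \<and> pure (ev a *\<^sub>v v) y = pure v (group_ring_act N act a y)"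
    using a
  proof (rule free_Abelian_group_induct)
    have "ev 0 *\<^sub>v v = 0\<^sub>v n" using v by (intro eq_vecI) (auto simp: evaluate_zero)
    then show "Poly_Mapping.keys 0 \<subseteq> carrier \<Gamma> \<and> pure (ev 0 *\<^sub>v v) y = pure v (group_ring_act N act 0 y)"
      using l.hom_one r.hom_one by simp
  next
    fix a c
    assume *: "Poly_Mapping.keys a \<subseteq> carrier \<Gamma>" "Poly_Mapping.keys c \<subseteq> carrier \<Gamma>"
      "Poly_Mapping.keys a \<subseteq> carrier \<Gamma> \<and> pure (ev a *\<^sub>v v) y = pure v (group_ring_act N act a y)"
      "Poly_Mapping.keys c \<subseteq> carrier \<Gamma> \<and> pure (ev c *\<^sub>v v) y = pure v (group_ring_act N act c y)"
    have cl: "ev d *\<^sub>v v \<in> carrier_vec n" for d by (rule mult_mat_vec_carrier[OF evaluate_carrier v])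
    have "ev (a - c) *\<^sub>v v = ev a *\<^sub>v v + - (ev c *\<^sub>v v)"
      unfolding evaluate_diff minus_mult_distrib_mat_vec[OF evaluate_carrier evaluate_carrier v]
      by (rule minus_add_uminus_vec[OF cl cl])
    then have "pure (ev (a - c) *\<^sub>v v) y = pure (ev a *\<^sub>v v) y \<otimes>\<^bsub>T\<^esub> inv\<^bsub>T\<^esub> pure (ev c *\<^sub>v v) y"
      using l.hom_mult[of "ev a *\<^sub>v v" "- (ev c *\<^sub>v v)"] l.hom_inv[of "ev c *\<^sub>v v"] cl
      by (simp add: inv_col_vectors)
    also have "\<dots> = pure v (group_ring_act N act (a - c) y)"
      using * r.hom_mult[of "gact a y" "inv\<^bsub>N\<^esub> gact c y"] r.hom_inv[of "gact c y"]
      by (simp add: gact_diff gact_closed)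
    finally show "Poly_Mapping.keys (a - c) \<subseteq> carrier \<Gamma> \<and>
        pure (ev (a - c) *\<^sub>v v) y = pure v (group_ring_act N act (a - c) y)"
      using keys_diff[of a c] * by auto
  qed (use v y pure_balanced[simplified] in \<open>auto simp: evaluate_frag_of A_carrier gact_frag_of\<close>)
  then show ?thesis by simp
qed

text \<open>
  Both sides are homomorphisms, so it suffices to move the coefficients of \<open>x\<close> across a pure tensor.
\<close>

lemma from_coords_coords:
  assumes "X \<in> carrier T"
  shows "from_coords (coords X) = X"
proof -
  have "(from_coords \<circ> coords) X = id X"
  proof (rule hom_eqI[OF _ _ T.is_group _ assms])
    show "from_coords \<circ> coords \<in> hom T T" by (rule hom_compose[OF coords_hom from_coords_hom])
    show "id \<in> hom T T" by (simp add: hom_def)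
    fix v :: "'r Matrix.vec" and x assume v: "v \<in> carrier (col_vectors n)" and x: "x \<in> carrier N"
    have "block (coords (pure v x)) i = ev (coeff x i) *\<^sub>v v" if "i < m" for i
      using v x block_index[OF that]
      by (intro eq_vecI) (auto simp: block_def coords_pure coords_pure_def evaluate_def)
    then have "from_coords (coords (pure v x)) = finprod T (\<lambda>i. pure (ev (coeff x i) *\<^sub>v v) (b i)) {..<m}"
      unfolding from_coords_def using v
      by (intro T.finprod_cong') (auto simp: basis_closed mult_mat_vec_carrier[OF evaluate_carrier])
    also have "\<dots> = finprod T (\<lambda>i. pure v (group_ring_act N act (coeff x i) (b i))) {..<m}"
      using v x by (intro T.finprod_cong') (auto simp: pure_evaluate basis_closed coeff_keys gact_closed)
    also have "\<dots> = pure v (finprod N (\<lambda>i. group_ring_act N act (coeff x i) (b i)) {..<m})"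
      using v x by (intro hom_finprod[symmetric, OF N comm_group_T pure_hom_right]) (auto simp: gact_closed coeff_keys)
    also have "\<dots> = pure v x" using coeff(2)[OF x] by simp
    finally show "(from_coords \<circ> coords) (pure v x) = id (pure v x)" by simp
  qed
  then show ?thesis by simp
qed

lemma coords_from_coords:
  assumes w: "w \<in> carrier_vec (m * n)"
  shows "coords (from_coords w) = w"
proof (rule eq_vecI)
  have cl: "(\<lambda>i. coords (pure (block w i) (b i))) \<in> {..<m} \<rightarrow> carrier_vec (m * n)"
    by (intro funcsetI coords_closed pure_closed) (simp_all add: basis_closed)
  have "(\<lambda>i. pure (block w i) (b i)) \<in> {..<m} \<rightarrow> carrier T"
    by (intro funcsetI pure_closed) (simp_all add: basis_closed)
  note hom_finprod[OF comm_group_T comm_group_col_vectors coords_hom this]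
  then have eq: "coords (from_coords w) = finprod (col_vectors (m * n)) (\<lambda>i. coords (pure (block w i) (b i))) {..<m}"
    unfolding from_coords_def .
  fix p assume "p < dim_vec w"
  then have p: "p < m * n" using w by simp
  have "coords (from_coords w) $ p = (\<Sum>i<m. coords (pure (block w i) (b i)) $ p)"
    unfolding eq by (rule finprod_col_vectors_index[OF cl p])
  also have "\<dots> = (\<Sum>i<m. if i = p div n then w $ p else 0)"
  proof (rule sum.cong)
    fix i assume "i \<in> {..<m}"
    then have "coords (pure (block w i) (b i)) $ p = (if p div n = i then block w i $ (p mod n) else 0)"
      by (intro coords_pure_basis[OF block_carrier _ p]) simp
    moreover have "block w (p div n) $ (p mod n) = w $ p"
      unfolding block_def index_vec[OF block_div_mod(2)[OF p]] block_div_mod(3)[OF p] ..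
    ultimately show "coords (pure (block w i) (b i)) $ p = (if i = p div n then w $ p else 0)"
      by (cases "p div n = i") simp_all
  qed simp
  also have "\<dots> = w $ p" using block_div_mod(1)[OF p] by (simp add: sum.delta)
  finally show "coords (from_coords w) $ p = w $ p" .
qed (use w coords_closed[OF from_coords_closed, of w] in simp)

lemma coords_inject:
  assumes "X \<in> carrier T" "Y \<in> carrier T" "coords X = coords Y"
  shows "X = Y"
  using arg_cong[OF assms(3), of from_coords] unfolding from_coords_coords[OF assms(1)] from_coords_coords[OF assms(2)] .

abbreviation scale :: "'r \<Rightarrow> ('r Matrix.vec \<times> 'c) frag set \<Rightarrow> ('r Matrix.vec \<times> 'c) frag set" where
  "scale s \<equiv> tensor_map (carrier \<Gamma>) (col_vectors n) (\<lambda>v g. A g *\<^sub>v v) N act (\<lambda>v. s \<cdot>\<^sub>v v) id"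

lemma scale_tensor_map:
  "scale s \<in> hom T T"
  "v \<in> carrier_vec n \<Longrightarrow> x \<in> carrier N \<Longrightarrow> scale s (pure v x) = pure (s \<cdot>\<^sub>v v) x"
  for v :: "'r Matrix.vec"
proof -
  have id: "id \<in> hom N N" by (simp add: hom_def)
  have comm: "s \<cdot>\<^sub>v (A g *\<^sub>v u) = A g *\<^sub>v (s \<cdot>\<^sub>v u)" if "g \<in> carrier \<Gamma>" "u \<in> carrier (col_vectors n)" for g u
    using mult_mat_vec_smult[OF A_carrier[OF that(1)], of u s] that(2) by simp
  note p = tensor_map_properties[OF tensor_axioms tensor_axioms scale_hom comm id]
  show "scale s \<in> hom T T" by (rule p(1)) auto
  show "scale s (pure v x) = pure (s \<cdot>\<^sub>v v) x" if "v \<in> carrier_vec n" "x \<in> carrier N"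
    using p(2)[of v x] that by simp
qed

lemma coords_scale:
  assumes "X \<in> carrier T"
  shows "coords (scale s X) = s \<cdot>\<^sub>v coords X"
proof -
  have "(coords \<circ> scale s) X = ((\<lambda>v. s \<cdot>\<^sub>v v) \<circ> coords) X"
  proof (rule hom_eqI[of "coords \<circ> scale s" "col_vectors (m * n)" "(\<lambda>v. s \<cdot>\<^sub>v v) \<circ> coords", OF _ _ _ _ assms])
    show "coords \<circ> scale s \<in> hom T (col_vectors (m * n))"
      by (rule hom_compose[OF scale_tensor_map(1) coords_hom])
    show "(\<lambda>v. s \<cdot>\<^sub>v v) \<circ> coords \<in> hom T (col_vectors (m * n))"
      by (rule hom_compose[OF coords_hom scale_hom])
    show "group (col_vectors (m * n) :: 'r Matrix.vec monoid)"
      by (rule comm_group.axioms(2)[OF comm_group_col_vectors])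
    fix v :: "'r Matrix.vec" and x assume "v \<in> carrier (col_vectors n)" "x \<in> carrier N"
    then have vx: "v \<in> carrier_vec n" "x \<in> carrier N" by simp_all
    have "coords_pure (s \<cdot>\<^sub>v v) x = s \<cdot>\<^sub>v coords_pure v x"
      using block_div_mod(2)[of _ m n]
      by (intro eq_vecI)
        (simp_all add: coords_pure_def mult_mat_vec_smult[OF evaluate_carrier vx(1)] del: index_mult_mat_vec)
    then show "(coords \<circ> scale s) (pure v x) = ((\<lambda>v. s \<cdot>\<^sub>v v) \<circ> coords) (pure v x)"
      using vx by (simp add: scale_tensor_map coords_pure)
  qed
  then show ?thesis by simp
qed

lemma coords_standard_basis:
  assumes "i < m" "j < n"
  shows "coords (pure (unit_vec n j) (b i)) = unit_vec (m * n) (i * n + j)"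
proof (rule eq_vecI)
  fix p assume "p < dim_vec (unit_vec (m * n) (i * n + j) :: 'r Matrix.vec)"
  then have p: "p < m * n" by simp
  have index: "p = i * n + j \<longleftrightarrow> p div n = i \<and> p mod n = j"
  proof
    assume "p div n = i \<and> p mod n = j"
    then show "p = i * n + j" using block_div_mod(3)[OF p] by (elim conjE) (simp only:)
  qed (use block_index(2,3)[OF assms] in simp)
  have u1: "unit_vec (m * n) (i * n + j) $ p = (if p div n = i \<and> p mod n = j then 1 else 0 :: 'r)"
    unfolding index_unit_vec(1)[OF block_index(1)[OF assms] p] index ..
  have u2: "unit_vec n j $ (p mod n) = (if p mod n = j then 1 else 0 :: 'r)"
    by (rule index_unit_vec(1)[OF assms(2) block_div_mod(2)[OF p]])
  show "coords (pure (unit_vec n j) (b i)) $ p = unit_vec (m * n) (i * n + j) $ p"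
    unfolding coords_pure_basis[OF unit_vec_carrier assms(1) p] u1 u2 by simp
next
  have "coords (pure (unit_vec n j) (b i)) \<in> carrier_vec (m * n)"
    using assms by (intro coords_closed pure_closed) (simp_all add: basis_closed)
  then show "dim_vec (coords (pure (unit_vec n j) (b i))) = dim_vec (unit_vec (m * n) (i * n + j) :: 'r Matrix.vec)"
    by simp
qed

end

section \<open>Boundary maps as matrices\<close>

text \<open>
  An equivariant map between two based modules, and the map that it induces on twisted chains.
\<close>

locale twisted_boundary_map =
  C: twisted_basis \<Gamma> N act b m n A + C': twisted_basis \<Gamma> N' act' b' m' n A
  for \<Gamma> :: "('g, 'w) monoid_scheme"
    and N :: "('c, 'z) monoid_scheme" and act and b and m
    and N' :: "('c, 'z') monoid_scheme" and act' and b' and m'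
    and n :: nat and A :: "'g \<Rightarrow> 'r::comm_ring_1 Matrix.mat" +
  fixes bd :: "'c \<Rightarrow> 'c"
  assumes bd_hom: "bd \<in> hom N N'"
    and bd_act: "\<And>g x. g \<in> carrier \<Gamma> \<Longrightarrow> x \<in> carrier N \<Longrightarrow> bd (act g x) = act' g (bd x)"
begin

abbreviation "d \<equiv> tensor_map (carrier \<Gamma>) (col_vectors n) (\<lambda>v g. A g *\<^sub>v v) N' act' id bd"

definition boundary_matrix :: "'r Matrix.mat" where
  "boundary_matrix = Matrix.mat (m' * n) (m * n)
     (\<lambda>(p, q). evaluate n A (C'.coeff (bd (b (q div n))) (p div n)) $$ (p mod n, q mod n))"

lemma boundary_matrix_carrier [simp]: "boundary_matrix \<in> carrier_mat (m' * n) (m * n)"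
  by (simp add: boundary_matrix_def)

lemma d_tensor_map:
  "d \<in> hom C.T C'.T"
  "v \<in> carrier_vec n \<Longrightarrow> x \<in> carrier N \<Longrightarrow> d (C.pure v x) = C'.pure v (bd x)"
proof -
  have id: "id \<in> hom (col_vectors n :: 'r Matrix.vec monoid) (col_vectors n)" by (simp add: hom_def)
  show "d \<in> hom C.T C'.T"
    by (rule tensor_map_properties(1)[OF C.tensor_axioms C'.tensor_axioms])
      (simp_all add: id bd_hom bd_act)
  show "d (C.pure v x) = C'.pure v (bd x)" if "v \<in> carrier_vec n" "x \<in> carrier N"
  proof -
    have "d (C.pure v x) = C'.pure (id v) (bd x)"
      by (rule tensor_map_properties(2)[OF C.tensor_axioms C'.tensor_axioms])
        (simp_all add: id bd_hom bd_act that)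
    then show ?thesis by simp
  qed
qed

text \<open>
  Chains are sums of pure tensors \<open>v \<otimes> b\<^sub>i\<close>, for which the entries of the matrix can be read off.
\<close>

lemma coords_d:
  assumes X: "X \<in> carrier C.T"
  shows "C'.coords (d X) = boundary_matrix *\<^sub>v C.coords X"
proof -
  have left: "C'.coords \<circ> d \<in> hom C.T (col_vectors (m' * n))"
    by (rule hom_compose[OF d_tensor_map(1) C'.coords_hom])
  have "(\<lambda>v. boundary_matrix *\<^sub>v v) \<in> hom (col_vectors (m * n)) (col_vectors (m' * n))"
    by (rule homI)
      (simp_all add: mult_add_distrib_mat_vec[OF boundary_matrix_carrier]
        mult_mat_vec_carrier[OF boundary_matrix_carrier])
  then have right: "(\<lambda>v. boundary_matrix *\<^sub>v v) \<circ> C.coords \<in> hom C.T (col_vectors (m' * n))"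
    by (rule hom_compose[OF C.coords_hom])
  let ?x = "\<lambda>i. C.pure (C.block (C.coords X) i) (b i)"
  have closed: "?x \<in> {..<m} \<rightarrow> carrier C.T"
    by (intro funcsetI C.pure_closed) (simp_all add: C.basis_closed)
  have gen: "C'.coords (d (C.pure v (b i))) = boundary_matrix *\<^sub>v C.coords (C.pure v (b i))"
    if v: "v \<in> carrier_vec n" and i: "i < m" for v :: "'r Matrix.vec" and i
  proof (rule eq_vecI)
    have bi: "b i \<in> carrier N" using i by (rule C.basis_closed)
    have dbi: "bd (b i) \<in> carrier N'" using bd_hom bi by (rule hom_in_carrier)
    have cl: "C.coords (C.pure v (b i)) \<in> carrier_vec (m * n)"
      using v bi by (intro C.coords_closed) simp
    fix p assume "p < dim_vec (boundary_matrix *\<^sub>v C.coords (C.pure v (b i)))"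
    then have p: "p < m' * n" by (simp add: boundary_matrix_def)
    have "C'.coords (d (C.pure v (b i))) $ p = (evaluate n A (C'.coeff (bd (b i)) (p div n)) *\<^sub>v v) $ (p mod n)"
      using p v by (simp add: d_tensor_map bi C'.coords_pure dbi C'.coords_pure_def)
    also have "\<dots> = (\<Sum>j<n. evaluate n A (C'.coeff (bd (b i)) (p div n)) $$ (p mod n, j) * v $ j)"
      by (rule mult_vec_entry[OF evaluate_carrier v block_div_mod(2)[OF p]])
    also have "\<dots> = (\<Sum>j<n. boundary_matrix $$ (p, i * n + j) * v $ ((i * n + j) mod n))"
      using p block_index[OF i] by (intro sum.cong) (auto simp: boundary_matrix_def)
    also have "\<dots> = (\<Sum>q<m * n. if q div n = i then boundary_matrix $$ (p, q) * v $ (q mod n) else 0)"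
      by (rule sum_block[OF i, symmetric])
    also have "\<dots> = (\<Sum>q<m * n. boundary_matrix $$ (p, q) * C.coords (C.pure v (b i)) $ q)"
      using v i by (intro sum.cong) (auto simp: C.coords_pure_basis)
    also have "\<dots> = (boundary_matrix *\<^sub>v C.coords (C.pure v (b i))) $ p"
      by (rule mult_vec_entry[OF boundary_matrix_carrier cl p, symmetric])
    finally show "C'.coords (d (C.pure v (b i))) $ p = (boundary_matrix *\<^sub>v C.coords (C.pure v (b i))) $ p" .
  next
    have "C.pure v (b i) \<in> carrier C.T" using v i by (simp add: C.basis_closed)
    then have "C'.coords (d (C.pure v (b i))) \<in> carrier_vec (m' * n)"
      by (intro C'.coords_closed hom_in_carrier[OF d_tensor_map(1)])
    then show "dim_vec (C'.coords (d (C.pure v (b i)))) = dim_vec (boundary_matrix *\<^sub>v C.coords (C.pure v (b i)))"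
      by (simp add: boundary_matrix_def)
  qed
  have X_eq: "finprod C.T ?x {..<m} = X"
    using C.from_coords_coords[OF X] by (simp add: C.from_coords_def)
  have "C'.coords (d X) = finprod (col_vectors (m' * n)) (\<lambda>i. C'.coords (d (?x i))) {..<m}"
    using hom_finprod[OF C.comm_group_T comm_group_col_vectors left closed] by (simp add: X_eq)
  also have "\<dots> = finprod (col_vectors (m' * n)) (\<lambda>i. boundary_matrix *\<^sub>v C.coords (?x i)) {..<m}"
  proof (rule comm_monoid.finprod_cong'[OF comm_group.axioms(1)[OF comm_group_col_vectors]])
    show "(\<lambda>i. boundary_matrix *\<^sub>v C.coords (?x i)) \<in> {..<m} \<rightarrow> carrier (col_vectors (m' * n))"
      using closed unfolding col_vectors_simps
      by (intro funcsetI mult_mat_vec_carrier[OF boundary_matrix_carrier] C.coords_closed) (erule funcset_mem)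
  qed (simp_all add: gen)
  also have "\<dots> = boundary_matrix *\<^sub>v C.coords (finprod C.T ?x {..<m})"
    using hom_finprod[OF C.comm_group_T comm_group_col_vectors right closed] by simp
  also have "\<dots> = boundary_matrix *\<^sub>v C.coords X" by (simp only: X_eq)
  finally show ?thesis .
qed

end

section \<open>Representations over Laurent series and rational functions\<close>

text \<open>
  The matrix of the unit is idempotent and has determinant one.
\<close>

lemma right_SL_representation_one:
  fixes \<rho> :: "'g \<Rightarrow> 'r::comm_ring_1 Matrix.mat"
  assumes rep: "right_SL_representation \<Gamma> n \<rho>" and one: "\<one>\<^bsub>\<Gamma>\<^esub> \<in> carrier \<Gamma>" "\<one>\<^bsub>\<Gamma>\<^esub> \<otimes>\<^bsub>\<Gamma>\<^esub> \<one>\<^bsub>\<Gamma>\<^esub> = \<one>\<^bsub>\<Gamma>\<^esub>"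
  shows "\<rho> \<one>\<^bsub>\<Gamma>\<^esub> = 1\<^sub>m n"
proof -
  have P: "\<rho> \<one>\<^bsub>\<Gamma>\<^esub> \<in> carrier_mat n n" "Determinant.det (\<rho> \<one>\<^bsub>\<Gamma>\<^esub>) = 1"
    using rep one(1) by (auto simp: right_SL_representation_def)
  have idem: "\<rho> \<one>\<^bsub>\<Gamma>\<^esub> * \<rho> \<one>\<^bsub>\<Gamma>\<^esub> = \<rho> \<one>\<^bsub>\<Gamma>\<^esub>"
    using rep one unfolding right_SL_representation_def by metis
  obtain Q where Q: "Q \<in> carrier_mat n n" "Q * \<rho> \<one>\<^bsub>\<Gamma>\<^esub> = 1\<^sub>m n"
    using det_unit_imp_invertible[OF P(1)] P(2) by auto
  have "Q * (\<rho> \<one>\<^bsub>\<Gamma>\<^esub> * \<rho> \<one>\<^bsub>\<Gamma>\<^esub>) = \<rho> \<one>\<^bsub>\<Gamma>\<^esub>"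
    using assoc_mult_mat[OF Q(1) P(1) P(1)] Q(2) left_mult_one_mat[OF P(1)] by simp
  then show ?thesis unfolding idem Q(2) by simp
qed

lemma (in comm_ring_hom) scaled_representation_mult:
  fixes P Q :: "'a Matrix.mat"
  assumes "P \<in> carrier_mat n n" "Q \<in> carrier_mat n n"
  shows "(c * d) \<cdot>\<^sub>m map_mat hom (P * Q) = (c \<cdot>\<^sub>m map_mat hom P) * (d \<cdot>\<^sub>m map_mat hom Q)"
proof -
  have carr: "map_mat hom P \<in> carrier_mat n n" "map_mat hom Q \<in> carrier_mat n n"
    using assms by simp_all
  have "(c \<cdot>\<^sub>m map_mat hom P) * (d \<cdot>\<^sub>m map_mat hom Q) = c \<cdot>\<^sub>m (map_mat hom P * (d \<cdot>\<^sub>m map_mat hom Q))"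
    by (rule mult_smult_assoc_mat) (use carr in auto)
  also have "map_mat hom P * (d \<cdot>\<^sub>m map_mat hom Q) = d \<cdot>\<^sub>m (map_mat hom P * map_mat hom Q)"
    by (rule mult_smult_distrib) (use carr in auto)
  also have "map_mat hom P * map_mat hom Q = map_mat hom (P * Q)"
    by (rule mat_hom_mult[symmetric]) (use assms in auto)
  finally show ?thesis by (auto intro!: eq_matI simp: mult.assoc)
qed

text \<open>
  Twisting a representation by the character \<open>g \<mapsto> c (- \<xi> g)\<close> gives a representation. The Novikov and
  the Alexander representation are the cases in which \<open>c k\<close> is the power \<open>t\<^sup>k\<close> in \<open>\<int>((t))\<close> and in \<open>F(t)\<close>.
\<close>

lemma twisted_representation_properties:
  fixes \<rho> :: "'g \<Rightarrow> 'a::comm_ring_1 Matrix.mat" and c :: "int \<Rightarrow> 'r::comm_ring_1"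
  assumes rep: "right_SL_representation \<Gamma> n \<rho>"
    and one: "\<one>\<^bsub>\<Gamma>\<^esub> \<in> carrier \<Gamma>" "\<one>\<^bsub>\<Gamma>\<^esub> \<otimes>\<^bsub>\<Gamma>\<^esub> \<one>\<^bsub>\<Gamma>\<^esub> = \<one>\<^bsub>\<Gamma>\<^esub>"
    and \<xi>: "\<xi> \<in> hom \<Gamma> integer_group" and f: "comm_ring_hom f"
    and c: "\<And>j k. c (j + k) = c j * c k" "c 0 = 1"
    and A: "\<And>g. A g = c (- \<xi> g) \<cdot>\<^sub>m map_mat f (\<rho> g)"
  shows "\<And>g. g \<in> carrier \<Gamma> \<Longrightarrow> A g \<in> carrier_mat n n"
    and "\<And>g h. g \<in> carrier \<Gamma> \<Longrightarrow> h \<in> carrier \<Gamma> \<Longrightarrow> A (g \<otimes>\<^bsub>\<Gamma>\<^esub> h) = A h * A g"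
    and "A \<one>\<^bsub>\<Gamma>\<^esub> = 1\<^sub>m n"
proof -
  interpret f: comm_ring_hom f by (rule f)
  have \<xi>_mult: "\<xi> (g \<otimes>\<^bsub>\<Gamma>\<^esub> h) = \<xi> g + \<xi> h" if "g \<in> carrier \<Gamma>" "h \<in> carrier \<Gamma>" for g h
    using hom_mult[OF \<xi> that] by simp
  have \<rho>: "\<rho> g \<in> carrier_mat n n" if "g \<in> carrier \<Gamma>" for g
    using rep that by (simp add: right_SL_representation_def)
  show "A g \<in> carrier_mat n n" if "g \<in> carrier \<Gamma>" for g
    using \<rho>[OF that] by (simp add: A)
  show "A (g \<otimes>\<^bsub>\<Gamma>\<^esub> h) = A h * A g" if "g \<in> carrier \<Gamma>" "h \<in> carrier \<Gamma>" for g h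
  proof -
    have "- \<xi> (g \<otimes>\<^bsub>\<Gamma>\<^esub> h) = - \<xi> h + - \<xi> g" by (simp add: \<xi>_mult[OF that])
    moreover have "\<rho> (g \<otimes>\<^bsub>\<Gamma>\<^esub> h) = \<rho> h * \<rho> g" using rep that by (simp add: right_SL_representation_def)
    ultimately show ?thesis
      unfolding A using f.scaled_representation_mult[OF \<rho>[OF that(2)] \<rho>[OF that(1)]] by (simp only: c(1))
  qed
  have "\<xi> \<one>\<^bsub>\<Gamma>\<^esub> = 0" using \<xi>_mult[OF one(1) one(1)] one(2) by simp
  then show "A \<one>\<^bsub>\<Gamma>\<^esub> = 1\<^sub>m n"
    unfolding A right_SL_representation_one[OF rep one]
    by (auto simp: c(2) f.mat_hom_one intro!: eq_matI)
qed

lemma fls_const_ring_hom: "comm_ring_hom (fls_const :: 'a::comm_ring_1 \<Rightarrow> 'a fls)"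
  by unfold_locales (simp_all add: fls_plus_const)

lemma ratfun_const_ring_hom: "comm_ring_hom (\<lambda>a. Fract [:a:] 1 :: 'f::field poly fract)"
  by unfold_locales (simp_all add: One_fract_def Zero_fract_def eq_fract one_pCons)

lemma ratfun_t_nonzero: "ratfun_t \<noteq> 0"
  unfolding ratfun_t_def by (simp add: Zero_fract_def eq_fract)

lemma novikov_rep_properties:
  assumes "right_SL_representation \<Gamma> n \<rho>"
    and "\<one>\<^bsub>\<Gamma>\<^esub> \<in> carrier \<Gamma>" "\<one>\<^bsub>\<Gamma>\<^esub> \<otimes>\<^bsub>\<Gamma>\<^esub> \<one>\<^bsub>\<Gamma>\<^esub> = \<one>\<^bsub>\<Gamma>\<^esub>" "\<xi> \<in> hom \<Gamma> integer_group"
  shows "\<And>g. g \<in> carrier \<Gamma> \<Longrightarrow> novikov_rep \<xi> \<rho> g \<in> carrier_mat n n"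
    and "\<And>g h. g \<in> carrier \<Gamma> \<Longrightarrow> h \<in> carrier \<Gamma> \<Longrightarrow>
      novikov_rep \<xi> \<rho> (g \<otimes>\<^bsub>\<Gamma>\<^esub> h) = novikov_rep \<xi> \<rho> h * novikov_rep \<xi> \<rho> g"
    and "novikov_rep \<xi> \<rho> \<one>\<^bsub>\<Gamma>\<^esub> = 1\<^sub>m n"
proof -
  have c: "(fls_X_intpow (j + k) :: int fls) = fls_X_intpow j * fls_X_intpow k"
    "(fls_X_intpow 0 :: int fls) = 1" for j k
    by (simp_all add: fls_X_intpow_times_fls_X_intpow)
  note properties = twisted_representation_properties[OF assms fls_const_ring_hom c, of "novikov_rep \<xi> \<rho>", OF novikov_rep_def]
  show "\<And>g. g \<in> carrier \<Gamma> \<Longrightarrow> novikov_rep \<xi> \<rho> g \<in> carrier_mat n n"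
    and "\<And>g h. g \<in> carrier \<Gamma> \<Longrightarrow> h \<in> carrier \<Gamma> \<Longrightarrow>
      novikov_rep \<xi> \<rho> (g \<otimes>\<^bsub>\<Gamma>\<^esub> h) = novikov_rep \<xi> \<rho> h * novikov_rep \<xi> \<rho> g"
    and "novikov_rep \<xi> \<rho> \<one>\<^bsub>\<Gamma>\<^esub> = 1\<^sub>m n"
    by (fact properties)+
qed

lemma alexander_rep_properties:
  fixes \<rho> :: "'g \<Rightarrow> 'f::field Matrix.mat"
  assumes "right_SL_representation \<Gamma> n \<rho>"
    and "\<one>\<^bsub>\<Gamma>\<^esub> \<in> carrier \<Gamma>" "\<one>\<^bsub>\<Gamma>\<^esub> \<otimes>\<^bsub>\<Gamma>\<^esub> \<one>\<^bsub>\<Gamma>\<^esub> = \<one>\<^bsub>\<Gamma>\<^esub>" "\<xi> \<in> hom \<Gamma> integer_group"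
  shows "\<And>g. g \<in> carrier \<Gamma> \<Longrightarrow> alexander_rep \<xi> \<rho> g \<in> carrier_mat n n"
    and "\<And>g h. g \<in> carrier \<Gamma> \<Longrightarrow> h \<in> carrier \<Gamma> \<Longrightarrow>
      alexander_rep \<xi> \<rho> (g \<otimes>\<^bsub>\<Gamma>\<^esub> h) = alexander_rep \<xi> \<rho> h * alexander_rep \<xi> \<rho> g"
    and "alexander_rep \<xi> \<rho> \<one>\<^bsub>\<Gamma>\<^esub> = 1\<^sub>m n"
proof -
  have c: "(ratfun_t powi (j + k) :: 'f poly fract) = ratfun_t powi j * ratfun_t powi k"
    "(ratfun_t powi 0 :: 'f poly fract) = 1" for j k
    by (simp_all add: power_int_add ratfun_t_nonzero)
  note properties = twisted_representation_properties[OF assms ratfun_const_ring_hom c, of "alexander_rep \<xi> \<rho>", OF alexander_rep_def]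
  show "\<And>g. g \<in> carrier \<Gamma> \<Longrightarrow> alexander_rep \<xi> \<rho> g \<in> carrier_mat n n"
    and "\<And>g h. g \<in> carrier \<Gamma> \<Longrightarrow> h \<in> carrier \<Gamma> \<Longrightarrow>
      alexander_rep \<xi> \<rho> (g \<otimes>\<^bsub>\<Gamma>\<^esub> h) = alexander_rep \<xi> \<rho> h * alexander_rep \<xi> \<rho> g"
    and "alexander_rep \<xi> \<rho> \<one>\<^bsub>\<Gamma>\<^esub> = 1\<^sub>m n"
    by (fact properties)+
qed

lemma fls_X_powi: "(fls_X :: 'f::field fls) powi k = fls_X_intpow k"
proof -
  have nat: "(fls_X :: 'f fls) ^ j = fls_X_intpow (int j)" for j
    by (rule fls_eqI) auto
  have "inverse (fls_X_intpow (int j) :: 'f fls) = fls_X_intpow (- int j)" for j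
    by (rule inverse_unique) (use fls_X_intpow_times_fls_X_intpow[of "int j" "- int j", where 'a = 'f] in simp)
  then have "(fls_X :: 'f fls) powi (- int j) = fls_X_intpow (- int j)" for j
    by (simp add: power_int_minus nat)
  then show ?thesis
    using nat by (cases k rule: int_cases2) (simp_all only: power_int_of_nat)
qed

text \<open>
  This is why the torsion over \<open>F(t)\<close> can be computed from the complex over \<open>\<int>((t))\<close>.
\<close>

lemma alexander_rep_novikov_rep:
  fixes \<rho> :: "'g \<Rightarrow> 'f::field Matrix.mat"
  assumes "\<rho> g = map_mat of_int (\<rho>0 g)"
  shows "map_mat fls_of_ratfun (alexander_rep \<xi> \<rho> g) = map_mat fls_of_int_fls (novikov_rep \<xi> \<rho>0 g)"
proof -
  interpret \<phi>: field_hom "fls_of_ratfun :: 'f poly fract \<Rightarrow> 'f fls" by (rule field_hom_fls_of_ratfun)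
  interpret \<psi>: comm_ring_hom "fls_of_int_fls :: int fls \<Rightarrow> 'f fls" by (rule ring_hom_fls_of_int_fls)
  have t: "fls_of_ratfun (ratfun_t powi k) = (fls_of_int_fls (fls_X_intpow k) :: 'f fls)" for k
    unfolding fls_of_ratfun_power_int fls_of_ratfun_ratfun_t fls_X_powi by (rule fls_eqI) simp
  have c: "fls_of_ratfun (Fract [:of_int z:] 1) = (fls_of_int_fls (fls_const z) :: 'f fls)" for z
    by (rule fls_eqI) (simp add: fls_of_ratfun_Fract fps_of_poly_const)
  show ?thesis
    unfolding alexander_rep_def novikov_rep_def assms
    by (rule eq_matI) (simp_all add: t c \<phi>.hom_mult \<psi>.hom_mult)
qed

section \<open>Linear algebra in coordinates\<close>

text \<open>
  The order in which the list comprehension enumerates the standard basis of the twisted chains.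
\<close>

lemma nth_concat_blocks:
  assumes "p < m * n"
  shows "concat (map (\<lambda>i. map (f i) [0..<n]) [0..<m]) ! p = f (p div n) (p mod n)"
  using assms
proof (induction m)
  case (Suc m)
  have len: "length (concat (map (\<lambda>i. map (f i) [0..<n]) [0..<m])) = m * n"
    by (induction m) simp_all
  show ?case
  proof (cases "p < m * n")
    case True
    then show ?thesis using Suc.IH len by (simp add: nth_append)
  next
    case False
    then obtain j where j: "p = m * n + j" by (metis le_add_diff_inverse not_less)
    then have "j < n" using Suc.prems by simp
    then show ?thesis using j len by (simp add: nth_append)
  qed
qed simp

lemma length_concat_blocks: "length (concat (map (\<lambda>i. map (f i) [0..<n]) [0..<m])) = m * n"
  by (induction m) simp_all

lemma mat_of_cols_append:
  "mat_of_cols N (xs @ ys) = beside (mat_of_cols N xs) (mat_of_cols N ys)"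
  by (rule eq_matI) (auto simp: beside_def mat_of_cols_index nth_append)

lemma mult_mat_of_cols:
  assumes "D \<in> carrier_mat M N" "set xs \<subseteq> carrier_vec N"
  shows "D * mat_of_cols N xs = mat_of_cols M (map (\<lambda>x. D *\<^sub>v x) xs)"
proof (rule eq_matI)
  fix i j assume "i < dim_row (mat_of_cols M (map (\<lambda>x. D *\<^sub>v x) xs))" "j < dim_col (mat_of_cols M (map (\<lambda>x. D *\<^sub>v x) xs))"
  then have ij: "i < M" "j < length xs" by simp_all
  moreover have "xs ! j \<in> carrier_vec N" using assms(2) ij(2) by auto
  ultimately show "(D * mat_of_cols N xs) $$ (i, j) = mat_of_cols M (map (\<lambda>x. D *\<^sub>v x) xs) $$ (i, j)"
    using assms(1) by (simp add: mat_of_cols_index)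
qed (use assms(1) in auto)

lemma mat_eq_by_columns:
  fixes A B :: "'r::comm_ring_1 Matrix.mat"
  assumes "A \<in> carrier_mat n k" "B \<in> carrier_mat n k"
    and "\<And>j. j < k \<Longrightarrow> A *\<^sub>v unit_vec k j = B *\<^sub>v unit_vec k j"
  shows "A = B"
proof (rule eq_matI)
  fix i j assume "i < dim_row B" "j < dim_col B"
  then have ij: "i < n" "j < k" using assms(2) by simp_all
  then show "A $$ (i, j) = B $$ (i, j)"
    using assms(3)[OF ij(2)] mult_unit_vec_entry[OF assms(1) ij] mult_unit_vec_entry[OF assms(2) ij] by simp
qed (use assms in auto)

lemma mult_zero_vec:
  "A \<in> carrier_mat n k \<Longrightarrow> A *\<^sub>v 0\<^sub>v k = (0\<^sub>v n :: 'r::comm_ring_1 Matrix.vec)"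
  by (intro eq_vecI) auto

lemma zero_mult_vec:
  "v \<in> carrier_vec k \<Longrightarrow> 0\<^sub>m n k *\<^sub>v v = (0\<^sub>v n :: 'r::comm_ring_1 Matrix.vec)"
  by (intro eq_vecI) auto

text \<open>
  The matrix \<open>Y\<close> sends a vector \<open>y\<close> to the coordinates of \<open>D y\<close> in the basis of the image formed by the columns of
  \<open>D * B\<close>. Uniqueness of coordinates gives the remaining equations.
\<close>

lemma basis_of_image_section:
  fixes D B :: "'s::comm_ring_1 Matrix.mat"
  assumes D: "D \<in> carrier_mat n N" and B: "B \<in> carrier_mat N l"
    and basis: "\<And>y. y \<in> carrier_vec N \<Longrightarrow> \<exists>!v. v \<in> carrier_vec l \<and> D *\<^sub>v y = (D * B) *\<^sub>v v"
  obtains Y where "Y \<in> carrier_mat l N" "D * B * Y = D" "Y * B = 1\<^sub>m l"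
    "\<And>E q. E \<in> carrier_mat N q \<Longrightarrow> D * E = 0\<^sub>m n q \<Longrightarrow> Y * E = 0\<^sub>m l q"
proof -
  have DB: "D * B \<in> carrier_mat n l" using D B by simp
  have inj: "v = w" if v: "v \<in> carrier_vec l" and w: "w \<in> carrier_vec l" and eq: "(D * B) *\<^sub>v v = (D * B) *\<^sub>v w" for v w
  proof -
    have Dv: "D *\<^sub>v (B *\<^sub>v v) = (D * B) *\<^sub>v v" by (rule assoc_mult_mat_vec[OF D B v, symmetric])
    note ex1 = basis[OF mult_mat_vec_carrier[OF B v]]
    show ?thesis
      using the1_equality[OF ex1 conjI[OF v Dv]] the1_equality[OF ex1 conjI[OF w Dv[unfolded eq]]] by (rule trans[OF sym])
  qed
  have "\<exists>v. v \<in> carrier_vec l \<and> D *\<^sub>v unit_vec N j = (D * B) *\<^sub>v v" for j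
    using basis[OF unit_vec_carrier[of N j]] by blast
  then obtain y where y: "\<And>j. y j \<in> carrier_vec l" "\<And>j. D *\<^sub>v unit_vec N j = (D * B) *\<^sub>v y j"
    by metis
  define Y where "Y = Matrix.mat l N (\<lambda>(i, j). y j $ i)"
  have Y: "Y \<in> carrier_mat l N" by (simp add: Y_def)
  have Yj: "Y *\<^sub>v unit_vec N j = y j" if "j < N" for j
    using that y(1)[of j] by (intro eq_vecI) (auto simp: Y_def)
  have DBY: "D * B * Y = D"
  proof (rule mat_eq_by_columns[OF mult_carrier_mat[OF DB Y] D])
    fix j assume "j < N"
    then show "(D * B * Y) *\<^sub>v unit_vec N j = D *\<^sub>v unit_vec N j"
      using assoc_mult_mat_vec[OF DB Y, of "unit_vec N j"] Yj y(2) by simp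
  qed
  have kill: "Y *\<^sub>v x = 0\<^sub>v l" if x: "x \<in> carrier_vec N" and Dx: "D *\<^sub>v x = 0\<^sub>v n" for x
  proof (rule inj)
    show "(D * B) *\<^sub>v (Y *\<^sub>v x) = (D * B) *\<^sub>v 0\<^sub>v l"
      using assoc_mult_mat_vec[OF DB Y x] unfolding DBY Dx mult_zero_vec[OF DB] by (rule sym)
  qed (use Y x in auto)
  show ?thesis
  proof (rule that[OF Y DBY])
    show "Y * B = 1\<^sub>m l"
    proof (rule mat_eq_by_columns[OF mult_carrier_mat[OF Y B] one_carrier_mat])
      fix j assume j: "j < l"
      let ?e = "unit_vec l j :: 's Matrix.vec"
      have "(Y * B) *\<^sub>v ?e = ?e"
      proof (rule inj)
        have "(D * B) *\<^sub>v ((Y * B) *\<^sub>v ?e) = (D * B * (Y * B)) *\<^sub>v ?e"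
          by (rule assoc_mult_mat_vec[OF DB mult_carrier_mat[OF Y B], symmetric]) simp
        also have "D * B * (Y * B) = D * B"
          using assoc_mult_mat[OF DB Y B] DBY by simp
        finally show "(D * B) *\<^sub>v ((Y * B) *\<^sub>v ?e) = (D * B) *\<^sub>v ?e" .
      qed (use mult_mat_vec_carrier[OF mult_carrier_mat[OF Y B]] in auto)
      then show "(Y * B) *\<^sub>v ?e = 1\<^sub>m l *\<^sub>v ?e" by simp
    qed
    show "Y * E = 0\<^sub>m l q" if E: "E \<in> carrier_mat N q" and DE: "D * E = 0\<^sub>m n q" for E q
    proof (rule mat_eq_by_columns[OF mult_carrier_mat[OF Y E] zero_carrier_mat])
      fix j assume j: "j < q"
      let ?e = "unit_vec q j :: 's Matrix.vec"
      have "D *\<^sub>v (E *\<^sub>v ?e) = 0\<^sub>v n"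
        using assoc_mult_mat_vec[OF D E unit_vec_carrier[of q j]]
        unfolding DE zero_mult_vec[OF unit_vec_carrier] by (rule sym)
      then have "Y *\<^sub>v (E *\<^sub>v ?e) = 0\<^sub>v l"
        by (intro kill mult_mat_vec_carrier[OF E]) simp_all
      then show "(Y * E) *\<^sub>v ?e = 0\<^sub>m l q *\<^sub>v ?e"
        using assoc_mult_mat_vec[OF Y E unit_vec_carrier[of q j]]
        unfolding zero_mult_vec[OF unit_vec_carrier] by simp
    qed
  qed
qed

text \<open>
  In the trivial quotient the coset of the cycle \<open>x\<close> is the subgroup of boundaries itself.
\<close>

lemma trivial_homology_exact:
  assumes trivial: "trivial_group (complex_homology C d k)"
    and one: "\<one>\<^bsub>C k\<^esub> \<in> d (k + 1) ` carrier (C (k + 1))" and monoid: "Group.monoid (C k)"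
    and x: "x \<in> carrier (C k)" "d k x = \<one>\<^bsub>C (k - 1)\<^esub>"
  shows "x \<in> d (k + 1) ` carrier (C (k + 1))"
proof -
  let ?H = "d (k + 1) ` carrier (C (k + 1))"
  let ?G = "(C k)\<lparr>carrier := kernel (C k) (C (k - 1)) (d k)\<rparr>"
  have "x \<in> carrier ?G" using x by (simp add: kernel_def)
  then have "?H #>\<^bsub>?G\<^esub> x \<in> carrier (complex_homology C d k)"
    by (auto simp: complex_homology_def FactGroup_def RCOSETS_def)
  then have "?H #>\<^bsub>?G\<^esub> x = ?H"
    using trivial by (auto simp: trivial_group_def complex_homology_def)
  moreover have "\<one>\<^bsub>C k\<^esub> \<otimes>\<^bsub>C k\<^esub> x \<in> ?H #>\<^bsub>?G\<^esub> x"
    using one unfolding r_coset_def by auto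
  ultimately show ?thesis using monoid.l_one[OF monoid x(1)] by simp
qed

section \<open>The twisted complex of the complement as a complex of matrices\<close>

text \<open>
  The matrix of the boundary map from degree \<open>Suc k\<close> to degree \<open>k\<close>. The formula is uniform in the coefficient ring,
  which makes the matrices over \<open>\<int>((t))\<close> and \<open>F(t)\<close> comparable.
\<close>

definition cellular_matrix :: "(real \<Rightarrow> real^4) \<Rightarrow> ('a, 'b::topological_space) cw_model \<Rightarrow>
    (nat \<Rightarrow> nat \<Rightarrow> 'b chain set) \<Rightarrow> nat \<Rightarrow> ((real \<Rightarrow> real^4) set \<Rightarrow> 'r::comm_ring_1 Matrix.mat) \<Rightarrow>
    nat \<Rightarrow> 'r Matrix.mat" where
  "cellular_matrix K M b n A k = Matrix.mat (ncells M k * n) (ncells M (Suc k) * n)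
     (\<lambda>(p, q). evaluate n A
       (group_ring_basis.coeff (knot_group K (base_pt M)) (cell_chain M (int k)) (cell_act M (int k)) (b k) (ncells M k)
         (cell_boundary M (int (Suc k)) (b (Suc k) (q div n))) (p div n)) $$ (p mod n, q mod n))"

locale twisted_complex =
  fixes K :: "real \<Rightarrow> real^4" and M :: "('a::topological_space, 'b::topological_space) cw_model"
    and b :: "nat \<Rightarrow> nat \<Rightarrow> 'b chain set" and n :: nat
    and A :: "(real \<Rightarrow> real^4) set \<Rightarrow> 'r::comm_ring_1 Matrix.mat"
  assumes model: "complement_model K M" and cells: "cell_basis K M b"
    and A_carrier: "\<And>g. g \<in> carrier (knot_group K (base_pt M)) \<Longrightarrow> A g \<in> carrier_mat n n"
    and A_mult: "\<And>g h. g \<in> carrier (knot_group K (base_pt M)) \<Longrightarrow> h \<in> carrier (knot_group K (base_pt M)) \<Longrightarrow>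
      A (g \<otimes>\<^bsub>knot_group K (base_pt M)\<^esub> h) = A h * A g"
    and A_one: "A \<one>\<^bsub>knot_group K (base_pt M)\<^esub> = 1\<^sub>m n"
begin

abbreviation "\<Gamma> \<equiv> knot_group K (base_pt M)"
abbreviation "tchain \<equiv> twisted_chain K M n A"
abbreviation "tboundary \<equiv> twisted_boundary K M n A"
abbreviation "tscale \<equiv> twisted_scale K M n A"
abbreviation "rk k \<equiv> ncells M k * n"

lemma one_closed: "\<one>\<^bsub>\<Gamma>\<^esub> \<in> carrier \<Gamma>"
  by (rule fundamental_group_one_closed[OF base_pt_complement[OF model]])

lemma basis_in_degree: "twisted_basis \<Gamma> (cell_chain M (int k)) (cell_act M (int k)) (b k) (ncells M k) n A"
proof (intro twisted_basis.intro group_ring_basis.intro twisted_basis_axioms.intro)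
  show "comm_group (cell_chain M (int k))" by (rule cell_chain_comm_group)
  show "g \<otimes>\<^bsub>\<Gamma>\<^esub> h \<in> carrier \<Gamma>" if "g \<in> carrier \<Gamma>" "h \<in> carrier \<Gamma>" for g h
    using that by (rule fundamental_group_mult_closed)
  show "\<one>\<^bsub>\<Gamma>\<^esub> \<in> carrier \<Gamma>" by (rule one_closed)
  show "cell_act M (int k) g \<in> hom (cell_chain M (int k)) (cell_chain M (int k))" for g
    by (rule cell_act_hom)
  show "cell_act M (int k) g x = \<one>\<^bsub>cell_chain M (int k)\<^esub>" if "x \<notin> carrier (cell_chain M (int k))" for g x
    using that by (rule cell_act_default)
  show "cell_act M (int k) (g \<otimes>\<^bsub>\<Gamma>\<^esub> h) x = cell_act M (int k) g (cell_act M (int k) h x)"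
    if "g \<in> carrier \<Gamma>" "h \<in> carrier \<Gamma>" for g h x
    using that by (rule cell_act_mult[OF model])
  show "cell_act M (int k) \<one>\<^bsub>\<Gamma>\<^esub> x = x" if "x \<in> carrier (cell_chain M (int k))" for x
    using that by (rule cell_act_one[OF model])
  show "\<exists>!a. a \<in> {..<ncells M k} \<rightarrow>\<^sub>E {a. Poly_Mapping.keys a \<subseteq> carrier \<Gamma>} \<and>
      x = finprod (cell_chain M (int k))
        (\<lambda>i. group_ring_act (cell_chain M (int k)) (cell_act M (int k)) (a i) (b k i)) {..<ncells M k}"
    if "x \<in> carrier (cell_chain M (int k))" for x
    by (rule bspec[OF spec[OF conjunct2[OF cells[unfolded cell_basis_def]]] that])
qed (use A_carrier A_mult A_one in auto)

lemma tensor_in_degree: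
  "tensor (carrier \<Gamma>) (col_vectors n) (\<lambda>v g. A g *\<^sub>v v) (cell_chain M k) (cell_act M k)"
proof (rule tensor.intro)
  show "comm_group (col_vectors n :: 'r Matrix.vec monoid)" by (rule comm_group_col_vectors)
  show "comm_group (cell_chain M k)" by (rule cell_chain_comm_group)
  show "A g *\<^sub>v u \<in> carrier (col_vectors n)" if "g \<in> carrier \<Gamma>" "u \<in> carrier (col_vectors n)" for g u
    using mult_mat_vec_carrier[OF A_carrier[OF that(1)], of u] that(2) by simp
  show "cell_act M k g x \<in> carrier (cell_chain M k)" if "x \<in> carrier (cell_chain M k)" for g x
    using cell_act_hom that by (rule hom_in_carrier)
qed

lemma chain_comm_group: "comm_group (tchain k)"
  unfolding twisted_chain_def by (rule tensor.comm_group_T[OF tensor_in_degree])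

lemma boundary_hom: "tboundary k \<in> hom (tchain k) (tchain (k - 1))"
  unfolding twisted_boundary_def twisted_chain_def
  by (rule tensor_map_properties(1)[OF tensor_in_degree tensor_in_degree])
    (simp_all add: hom_def[of "col_vectors n"] cell_boundary_hom cell_boundary_act[OF model])

lemma boundary_tensor:
  assumes "v \<in> carrier_vec n" "x \<in> carrier (cell_chain M k)"
  shows "tboundary k (twisted_tensor K M n A k v x) = twisted_tensor K M n A (k - 1) v (cell_boundary M k x)"
proof -
  have "tboundary k (twisted_tensor K M n A k v x) = twisted_tensor K M n A (k - 1) (id v) (cell_boundary M k x)"
    unfolding twisted_boundary_def twisted_tensor_def
    by (rule tensor_map_properties(2)[OF tensor_in_degree tensor_in_degree])
      (simp_all add: hom_def[of "col_vectors n"] cell_boundary_hom cell_boundary_act[OF model] assms)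
  then show ?thesis by simp
qed

lemma scale_hom: "tscale k s \<in> hom (tchain k) (tchain k)"
proof -
  have "s \<cdot>\<^sub>v (A g *\<^sub>v u) = A g *\<^sub>v (s \<cdot>\<^sub>v u)" if "g \<in> carrier \<Gamma>" "u \<in> carrier_vec n" for g u
    by (rule mult_mat_vec_smult[OF A_carrier[OF that(1)] that(2), symmetric])
  then show ?thesis
    unfolding twisted_scale_def twisted_chain_def
    by (intro tensor_map_properties(1)[OF tensor_in_degree tensor_in_degree])
      (simp_all add: hom_def smult_add_distrib_vec)
qed

lemma boundary_boundary:
  assumes X: "X \<in> carrier (tchain k)"
  shows "tboundary (k - 1) (tboundary k X) = \<one>\<^bsub>tchain (k - 2)\<^esub>"
proof -
  interpret T: tensor "carrier \<Gamma>" "col_vectors n" "\<lambda>v g. A g *\<^sub>v v" "cell_chain M k" "cell_act M k"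
    by (rule tensor_in_degree)
  interpret T2: tensor "carrier \<Gamma>" "col_vectors n" "\<lambda>v g. A g *\<^sub>v v" "cell_chain M (k - 2)" "cell_act M (k - 2)"
    by (rule tensor_in_degree)
  have k: "k - 1 - 1 = k - 2" by simp
  have hom: "tboundary (k - 1) \<circ> tboundary k \<in> hom (tchain k) (tchain (k - 2))"
    using hom_compose[OF boundary_hom[of k] boundary_hom[of "k - 1"]] unfolding k .
  have "(tboundary (k - 1) \<circ> tboundary k) X = (\<lambda>_. \<one>\<^bsub>tchain (k - 2)\<^esub>) X"
  proof (rule T.hom_eqI[of "tboundary (k - 1) \<circ> tboundary k" "tchain (k - 2)" "\<lambda>_. \<one>\<^bsub>tchain (k - 2)\<^esub>"])
    show "tboundary (k - 1) \<circ> tboundary k \<in> hom T.T (tchain (k - 2))"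
      using hom unfolding twisted_chain_def .
    show "(\<lambda>_. \<one>\<^bsub>tchain (k - 2)\<^esub>) \<in> hom T.T (tchain (k - 2))"
      by (rule homI) (simp_all add: twisted_chain_def)
    show "group (tchain (k - 2))" by (rule comm_group.axioms(2)[OF chain_comm_group])
    show "X \<in> carrier T.T" using X unfolding twisted_chain_def .
    fix v :: "'r Matrix.vec" and x
    assume "v \<in> carrier (col_vectors n)" and x: "x \<in> carrier (cell_chain M k)"
    then have v: "v \<in> carrier_vec n" by simp
    have dx: "cell_boundary M k x \<in> carrier (cell_chain M (k - 1))"
      using cell_boundary_hom x by (rule hom_in_carrier)
    have "tboundary (k - 1) (tboundary k (twisted_tensor K M n A k v x)) =
        twisted_tensor K M n A (k - 2) v (cell_boundary M (k - 1) (cell_boundary M k x))"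
      using boundary_tensor[OF v dx] boundary_tensor[OF v x] unfolding k by simp
    also have "\<dots> = twisted_tensor K M n A (k - 2) v \<one>\<^bsub>cell_chain M (k - 2)\<^esub>"
      unfolding cell_boundary_boundary[OF x] ..
    also have "\<dots> = \<one>\<^bsub>tchain (k - 2)\<^esub>"
      unfolding twisted_tensor_def twisted_chain_def
      by (rule hom_one[OF T2.pure_hom_right]) (simp_all add: v)
    finally show "(tboundary (k - 1) \<circ> tboundary k) (T.pure v x) = \<one>\<^bsub>tchain (k - 2)\<^esub>"
      by (simp add: twisted_tensor_def)
  qed
  then show ?thesis by simp
qed

text \<open>
  In particular all chains of degree \<open>0\<close> are cycles.
\<close>

lemma chain_negative:
  assumes "k < 0"
  shows "carrier (tchain k) = {\<one>\<^bsub>tchain k\<^esub>}"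
proof -
  interpret T: tensor "carrier \<Gamma>" "col_vectors n" "\<lambda>v g. A g *\<^sub>v v" "cell_chain M k" "cell_act M k"
    by (rule tensor_in_degree)
  have "X = \<one>\<^bsub>T.T\<^esub>" if "X \<in> carrier T.T" for X
    using that
  proof (induction rule: T.tensor_induct)
    case (pure u x)
    then have "x = \<one>\<^bsub>cell_chain M k\<^esub>" using cell_chain_negative[OF assms] by auto
    then show ?case
      using hom_one[OF T.pure_hom_right[OF pure(1)] T.N.is_group T.T.is_group] by simp
  qed simp_all
  then show ?thesis unfolding twisted_chain_def using T.T.one_closed by blast
qed

lemma cellular_matrix_carrier [simp]: "cellular_matrix K M b n A k \<in> carrier_mat (rk k) (rk (Suc k))"
  by (simp add: cellular_matrix_def)

text \<open>
  The passage from tensor products to matrices: the tensors of unit vectors with cells form a basis in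
  every degree, and the boundary maps act on coordinates by the cellular matrices.
\<close>

lemma coordinates_exist:
  obtains \<Phi> where
    "\<And>k. \<Phi> k \<in> hom (tchain (int k)) (col_vectors (rk k))"
    "\<And>k X Y. X \<in> carrier (tchain (int k)) \<Longrightarrow> Y \<in> carrier (tchain (int k)) \<Longrightarrow> \<Phi> k X = \<Phi> k Y \<Longrightarrow> X = Y"
    "\<And>k w. w \<in> carrier_vec (rk k) \<Longrightarrow> \<exists>X\<in>carrier (tchain (int k)). \<Phi> k X = w"
    "\<And>k s X. X \<in> carrier (tchain (int k)) \<Longrightarrow> \<Phi> k (tscale (int k) s X) = s \<cdot>\<^sub>v \<Phi> k X"
    "\<And>k i j. i < ncells M k \<Longrightarrow> j < n \<Longrightarrow>
      twisted_tensor K M n A (int k) (unit_vec n j) (b k i) \<in> carrier (tchain (int k)) \<and>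
      \<Phi> k (twisted_tensor K M n A (int k) (unit_vec n j) (b k i)) = unit_vec (rk k) (i * n + j)"
    "\<And>k X. X \<in> carrier (tchain (int (Suc k))) \<Longrightarrow>
      \<Phi> k (tboundary (int (Suc k)) X) = cellular_matrix K M b n A k *\<^sub>v \<Phi> (Suc k) X"
proof -
  interpret C: twisted_basis \<Gamma> "cell_chain M (int k)" "cell_act M (int k)" "b k" "ncells M k" n A for k
    by (rule basis_in_degree)
  have tchain_eq: "tchain (int k) = C.T k" for k by (simp add: twisted_chain_def)
  have k1: "int (Suc k) - 1 = int k" for k by simp
  show ?thesis
  proof (rule that[of "\<lambda>k. C.coords k"])
    fix k
    show "C.coords k \<in> hom (tchain (int k)) (col_vectors (rk k))"
      unfolding tchain_eq by (rule C.coords_hom)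
    show "X = Y" if "X \<in> carrier (tchain (int k))" "Y \<in> carrier (tchain (int k))" "C.coords k X = C.coords k Y" for X Y
      using that unfolding tchain_eq by (rule C.coords_inject)
    show "\<exists>X\<in>carrier (tchain (int k)). C.coords k X = w" if "w \<in> carrier_vec (rk k)" for w
      unfolding tchain_eq using C.from_coords_closed C.coords_from_coords[OF that] by blast
    show "C.coords k (tscale (int k) s X) = s \<cdot>\<^sub>v C.coords k X" if "X \<in> carrier (tchain (int k))" for s X
      using that unfolding tchain_eq twisted_scale_def by (rule C.coords_scale)
    show "twisted_tensor K M n A (int k) (unit_vec n j) (b k i) \<in> carrier (tchain (int k)) \<and>
        C.coords k (twisted_tensor K M n A (int k) (unit_vec n j) (b k i)) = unit_vec (rk k) (i * n + j)"
      if "i < ncells M k" "j < n" for i j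
      unfolding tchain_eq twisted_tensor_def
      by (intro conjI C.coords_standard_basis that C.pure_closed C.basis_closed) simp
  next
    fix k X assume X: "X \<in> carrier (tchain (int (Suc k)))"
    interpret B: twisted_boundary_map \<Gamma> "cell_chain M (int (Suc k))" "cell_act M (int (Suc k))" "b (Suc k)" "ncells M (Suc k)"
      "cell_chain M (int k)" "cell_act M (int k)" "b k" "ncells M k" n A "cell_boundary M (int (Suc k))"
    proof (intro twisted_boundary_map.intro twisted_boundary_map_axioms.intro basis_in_degree)
      show "cell_boundary M (int (Suc k)) \<in> hom (cell_chain M (int (Suc k))) (cell_chain M (int k))"
        using cell_boundary_hom[of M "int (Suc k)"] unfolding k1 .
      show "cell_boundary M (int (Suc k)) (cell_act M (int (Suc k)) g x) =
          cell_act M (int k) g (cell_boundary M (int (Suc k)) x)" if "g \<in> carrier \<Gamma>" for g x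
        using cell_boundary_act[OF model that, of "int (Suc k)" x] unfolding k1 .
    qed
    have "B.boundary_matrix = cellular_matrix K M b n A k"
      unfolding B.boundary_matrix_def cellular_matrix_def ..
    then show "C.coords k (tboundary (int (Suc k)) X) = cellular_matrix K M b n A k *\<^sub>v C.coords (Suc k) X"
      using B.coords_d[OF X[unfolded tchain_eq]] unfolding twisted_boundary_def k1 by simp
  qed
qed

end

context twisted_complex
begin

lemma cellular_matrix_square_zero:
  "cellular_matrix K M b n A k * cellular_matrix K M b n A (Suc k) = 0\<^sub>m (rk k) (rk (Suc (Suc k)))"
proof -
  obtain \<Phi> where \<Phi>: "\<And>k. \<Phi> k \<in> hom (tchain (int k)) (col_vectors (rk k))"
    "\<And>k w. w \<in> carrier_vec (rk k) \<Longrightarrow> \<exists>X\<in>carrier (tchain (int k)). \<Phi> k X = w"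
    "\<And>k X. X \<in> carrier (tchain (int (Suc k))) \<Longrightarrow>
      \<Phi> k (tboundary (int (Suc k)) X) = cellular_matrix K M b n A k *\<^sub>v \<Phi> (Suc k) X"
    by (rule coordinates_exist) (rule that)
  let ?D = "cellular_matrix K M b n A"
  show ?thesis
  proof (rule mat_eq_by_columns[OF mult_carrier_mat[OF cellular_matrix_carrier cellular_matrix_carrier] zero_carrier_mat])
    fix j
    let ?e = "unit_vec (rk (Suc (Suc k))) j :: 'r Matrix.vec"
    obtain X where X: "X \<in> carrier (tchain (int (Suc (Suc k))))" "\<Phi> (Suc (Suc k)) X = ?e"
      using \<Phi>(2)[OF unit_vec_carrier] by blast
    have ints: "int (Suc (Suc k)) - 1 = int (Suc k)" "int (Suc (Suc k)) - 2 = int k" by simp_all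
    have dX: "tboundary (int (Suc (Suc k))) X \<in> carrier (tchain (int (Suc k)))"
      using hom_in_carrier[OF boundary_hom X(1)] unfolding ints .
    have "(?D k * ?D (Suc k)) *\<^sub>v ?e = ?D k *\<^sub>v (?D (Suc k) *\<^sub>v ?e)"
      by (rule assoc_mult_mat_vec[OF cellular_matrix_carrier cellular_matrix_carrier unit_vec_carrier])
    also have "\<dots> = \<Phi> k (tboundary (int (Suc k)) (tboundary (int (Suc (Suc k))) X))"
      unfolding \<Phi>(3)[OF dX] \<Phi>(3)[OF X(1)] X(2) ..
    also have "\<dots> = \<Phi> k \<one>\<^bsub>tchain (int k)\<^esub>"
      using boundary_boundary[OF X(1)] unfolding ints by simp
    also have "\<dots> = 0\<^sub>v (rk k)"
      using hom_one[OF \<Phi>(1) comm_group.axioms(2)[OF chain_comm_group] comm_group.axioms(2)[OF comm_group_col_vectors]]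
      by simp
    also have "\<dots> = 0\<^sub>m (rk k) (rk (Suc (Suc k))) *\<^sub>v ?e"
      by (rule zero_mult_vec[OF unit_vec_carrier, symmetric])
    finally show "(?D k * ?D (Suc k)) *\<^sub>v ?e = 0\<^sub>m (rk k) (rk (Suc (Suc k))) *\<^sub>v ?e" .
  qed
qed

text \<open>
  The coordinate isomorphisms intertwine the boundary maps with the cellular matrices, so exactness carries over;
    in degree \<open>0\<close> every chain is a cycle, which gives surjectivity.
\<close>

lemma trivial_homology_exact_matrices:
  assumes trivial: "\<And>k. trivial_group (complex_homology tchain tboundary k)"
  shows "{cellular_matrix K M b n A 0 *\<^sub>v x | x. x \<in> carrier_vec (rk 1)} = carrier_vec (rk 0)"
    and "{cellular_matrix K M b n A (Suc k) *\<^sub>v x | x. x \<in> carrier_vec (rk (Suc (Suc k)))} =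
      {x \<in> carrier_vec (rk (Suc k)). cellular_matrix K M b n A k *\<^sub>v x = 0\<^sub>v (rk k)}"
proof -
  obtain \<Phi> where \<Phi>: "\<And>k. \<Phi> k \<in> hom (tchain (int k)) (col_vectors (rk k))"
    "\<And>k X Y. X \<in> carrier (tchain (int k)) \<Longrightarrow> Y \<in> carrier (tchain (int k)) \<Longrightarrow> \<Phi> k X = \<Phi> k Y \<Longrightarrow> X = Y"
    "\<And>k w. w \<in> carrier_vec (rk k) \<Longrightarrow> \<exists>X\<in>carrier (tchain (int k)). \<Phi> k X = w"
    "\<And>k X. X \<in> carrier (tchain (int (Suc k))) \<Longrightarrow>
      \<Phi> k (tboundary (int (Suc k)) X) = cellular_matrix K M b n A k *\<^sub>v \<Phi> (Suc k) X"
    by (rule coordinates_exist) (rule that)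
  let ?D = "cellular_matrix K M b n A"
  have groups: "group (tchain k)" for k by (rule comm_group.axioms(2)[OF chain_comm_group])
  have k1: "int k + 1 = int (Suc k)" "int (Suc k) - 1 = int k" for k by simp_all
  have one: "\<Phi> k \<one>\<^bsub>tchain (int k)\<^esub> = 0\<^sub>v (rk k)" for k
    using hom_one[OF \<Phi>(1) groups comm_group.axioms(2)[OF comm_group_col_vectors]] by simp
  have closed: "\<Phi> k X \<in> carrier_vec (rk k)" if "X \<in> carrier (tchain (int k))" for k X
    using hom_in_carrier[OF \<Phi>(1) that] by simp
  have d_closed: "tboundary k X \<in> carrier (tchain (k - 1))" if "X \<in> carrier (tchain k)" for k X
    using boundary_hom that by (rule hom_in_carrier)
  have d_one: "\<one>\<^bsub>tchain (int k)\<^esub> \<in> tboundary (int k + 1) ` carrier (tchain (int k + 1))" for k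
  proof (rule image_eqI)
    show "\<one>\<^bsub>tchain (int k + 1)\<^esub> \<in> carrier (tchain (int k + 1))"
      using group.is_monoid[OF groups] by (rule monoid.one_closed)
    show "\<one>\<^bsub>tchain (int k)\<^esub> = tboundary (int k + 1) \<one>\<^bsub>tchain (int k + 1)\<^esub>"
      using hom_one[OF boundary_hom[of "int k + 1"] groups groups] by simp
  qed
  have exact: "\<exists>x\<in>carrier_vec (rk (Suc k)). w = ?D k *\<^sub>v x"
    if X: "X \<in> carrier (tchain (int k))" "tboundary (int k) X = \<one>\<^bsub>tchain (int k - 1)\<^esub>" "\<Phi> k X = w" for k X w
  proof -
    have "X \<in> tboundary (int k + 1) ` carrier (tchain (int k + 1))"
      by (rule trivial_homology_exact[OF trivial d_one group.is_monoid[OF groups] X(1,2)])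
    then obtain Z where Z: "Z \<in> carrier (tchain (int (Suc k)))" "X = tboundary (int (Suc k)) Z"
      unfolding k1 by blast
    have "w = ?D k *\<^sub>v \<Phi> (Suc k) Z"
      unfolding X(3)[symmetric] Z(2) by (rule \<Phi>(4)[OF Z(1)])
    then show ?thesis using closed[OF Z(1)] by (rule bexI)
  qed
  show "{?D 0 *\<^sub>v x | x. x \<in> carrier_vec (rk 1)} = carrier_vec (rk 0)"
  proof (intro subset_antisym subsetI)
    fix w assume "w \<in> {?D 0 *\<^sub>v x | x. x \<in> carrier_vec (rk 1)}"
    then show "w \<in> carrier_vec (rk 0)"
      using mult_mat_vec_carrier[OF cellular_matrix_carrier[of 0]] by auto
  next
    fix w :: "'r Matrix.vec" assume "w \<in> carrier_vec (rk 0)"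
    then obtain X where X: "X \<in> carrier (tchain (int 0))" "\<Phi> 0 X = w" using \<Phi>(3) by blast
    have "tboundary (int 0) X = \<one>\<^bsub>tchain (int 0 - 1)\<^esub>"
      using d_closed[OF X(1)] chain_negative[of "int 0 - 1"] by simp
    from exact[OF X(1) this X(2)] show "w \<in> {?D 0 *\<^sub>v x | x. x \<in> carrier_vec (rk 1)}" by auto
  qed
  show "{?D (Suc k) *\<^sub>v x | x. x \<in> carrier_vec (rk (Suc (Suc k)))} =
      {x \<in> carrier_vec (rk (Suc k)). ?D k *\<^sub>v x = 0\<^sub>v (rk k)}"
  proof (intro subset_antisym subsetI)
    fix w assume "w \<in> {?D (Suc k) *\<^sub>v x | x. x \<in> carrier_vec (rk (Suc (Suc k)))}"
    then obtain x where x: "x \<in> carrier_vec (rk (Suc (Suc k)))" "w = ?D (Suc k) *\<^sub>v x" by auto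
    have "?D k *\<^sub>v w = 0\<^sub>v (rk k)"
      using assoc_mult_mat_vec[OF cellular_matrix_carrier cellular_matrix_carrier x(1)]
      unfolding cellular_matrix_square_zero zero_mult_vec[OF x(1)] x(2) by (rule sym)
    then show "w \<in> {x \<in> carrier_vec (rk (Suc k)). ?D k *\<^sub>v x = 0\<^sub>v (rk k)}"
      using mult_mat_vec_carrier[OF cellular_matrix_carrier x(1)] x(2) by simp
  next
    fix w assume "w \<in> {x \<in> carrier_vec (rk (Suc k)). ?D k *\<^sub>v x = 0\<^sub>v (rk k)}"
    then have w: "w \<in> carrier_vec (rk (Suc k))" "?D k *\<^sub>v w = 0\<^sub>v (rk k)" by simp_all
    then obtain X where X: "X \<in> carrier (tchain (int (Suc k)))" "\<Phi> (Suc k) X = w" using \<Phi>(3) by blast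
    have "tboundary (int (Suc k)) X = \<one>\<^bsub>tchain (int (Suc k) - 1)\<^esub>"
      unfolding k1
    proof (rule \<Phi>(2))
      show "tboundary (int (Suc k)) X \<in> carrier (tchain (int k))" using d_closed[OF X(1)] unfolding k1 .
      show "\<one>\<^bsub>tchain (int k)\<^esub> \<in> carrier (tchain (int k))"
        using group.is_monoid[OF groups] by (rule monoid.one_closed)
      show "\<Phi> k (tboundary (int (Suc k)) X) = \<Phi> k \<one>\<^bsub>tchain (int k)\<^esub>"
        unfolding \<Phi>(4)[OF X(1)] X(2) w(2) one ..
    qed
    from exact[OF X(1) this X(2)]
    show "w \<in> {?D (Suc k) *\<^sub>v x | x. x \<in> carrier_vec (rk (Suc (Suc k)))}" by auto
  qed
qed

end

section \<open>Reidemeister torsion in coordinates\<close>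

lemma coords_lin_comb:
  assumes V: "comm_group V" and \<Phi>: "\<Phi> \<in> hom V (col_vectors N)"
    and scl: "\<And>s x. x \<in> carrier V \<Longrightarrow> scl s x \<in> carrier V"
      "\<And>s x. x \<in> carrier V \<Longrightarrow> \<Phi> (scl s x) = s \<cdot>\<^sub>v (\<Phi> x :: 's::comm_ring_1 Matrix.vec)"
    and bs: "set bs \<subseteq> carrier V" and v: "v \<in> carrier_vec (length bs)"
  shows "lin_comb V scl bs v \<in> carrier V"
    and "\<Phi> (lin_comb V scl bs v) = mat_of_cols N (map \<Phi> bs) *\<^sub>v v"
proof -
  interpret V: comm_group V by (rule V)
  have nth: "bs ! i \<in> carrier V" if "i < length bs" for i using bs that by auto
  have fc: "(\<lambda>i. scl (vec_index v i) (bs ! i)) \<in> {..<length bs} \<rightarrow> carrier V"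
    using scl(1) nth by auto
  then show "lin_comb V scl bs v \<in> carrier V" unfolding lin_comb_def by (rule V.finprod_closed)
  have cl: "\<Phi> x \<in> carrier_vec N" if "x \<in> carrier V" for x using hom_in_carrier[OF \<Phi> that] by simp
  have eq: "\<Phi> (lin_comb V scl bs v) = finprod (col_vectors N) (\<lambda>i. \<Phi> (scl (vec_index v i) (bs ! i))) {..<length bs}"
    unfolding lin_comb_def by (rule hom_finprod[OF V comm_group_col_vectors \<Phi> fc])
  have fc': "(\<lambda>i. \<Phi> (scl (vec_index v i) (bs ! i))) \<in> {..<length bs} \<rightarrow> carrier_vec N"
    using fc cl by (intro funcsetI cl) (erule funcset_mem)
  show "\<Phi> (lin_comb V scl bs v) = mat_of_cols N (map \<Phi> bs) *\<^sub>v v"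
  proof (rule eq_vecI)
    fix p assume "p < dim_vec (mat_of_cols N (map \<Phi> bs) *\<^sub>v v)"
    then have p: "p < N" by simp
    have "\<Phi> (lin_comb V scl bs v) $ p = (\<Sum>i<length bs. \<Phi> (scl (vec_index v i) (bs ! i)) $ p)"
      unfolding eq by (rule finprod_col_vectors_index[OF fc' p])
    also have "\<dots> = (\<Sum>i<length bs. mat_of_cols N (map \<Phi> bs) $$ (p, i) * v $ i)"
    proof (rule sum.cong)
      fix i assume "i \<in> {..<length bs}"
      then have i: "i < length bs" by simp
      then show "\<Phi> (scl (vec_index v i) (bs ! i)) $ p = mat_of_cols N (map \<Phi> bs) $$ (p, i) * v $ i"
        using p cl[OF nth[OF i]] by (simp add: scl(2)[OF nth[OF i]] mat_of_cols_index mult.commute)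
    qed simp
    also have "\<dots> = (mat_of_cols N (map \<Phi> bs) *\<^sub>v v) $ p"
      using mult_vec_entry[OF mat_of_cols_carrier(1)[of N "map \<Phi> bs", unfolded length_map] v p] by (rule sym)
    finally show "\<Phi> (lin_comb V scl bs v) $ p = (mat_of_cols N (map \<Phi> bs) *\<^sub>v v) $ p" .
  qed (use cl[OF \<open>lin_comb V scl bs v \<in> carrier V\<close>] in simp)
qed

text \<open>
  In the coordinates defined by \<open>cs\<close> itself, transition matrices have coordinate vectors as columns.
\<close>

lemma transition_det_coords:
  assumes V: "comm_group V" and \<Phi>: "\<Phi> \<in> hom V (col_vectors N)"
    and inj: "\<And>x y. x \<in> carrier V \<Longrightarrow> y \<in> carrier V \<Longrightarrow> \<Phi> x = \<Phi> y \<Longrightarrow> x = y"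
    and scl: "\<And>s x. x \<in> carrier V \<Longrightarrow> scl s x \<in> carrier V"
      "\<And>s x. x \<in> carrier V \<Longrightarrow> \<Phi> (scl s x) = s \<cdot>\<^sub>v (\<Phi> x :: 's::comm_ring_1 Matrix.vec)"
    and cs: "length cs = N" "set cs \<subseteq> carrier V" "\<And>p. p < N \<Longrightarrow> \<Phi> (cs ! p) = unit_vec N p"
    and xs: "set xs \<subseteq> carrier V"
  shows "transition_det V scl xs cs = Determinant.det (mat_of_cols N (map \<Phi> xs))"
proof -
  have id: "mat_of_cols N (map \<Phi> cs) = 1\<^sub>m N"
    using cs by (intro eq_matI) (auto simp: mat_of_cols_index)
  have lc: "lin_comb V scl cs v \<in> carrier V" "\<Phi> (lin_comb V scl cs v) = v" if "v \<in> carrier_vec N" for v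
    using coords_lin_comb[OF V \<Phi> scl cs(2), of v] that unfolding id cs(1) by simp_all
  have "coordinates V scl cs x = \<Phi> x" if x: "x \<in> carrier V" for x
    unfolding coordinates_def cs(1)
  proof (rule the_equality)
    have \<Phi>x: "\<Phi> x \<in> carrier_vec N" using hom_in_carrier[OF \<Phi> x] by simp
    show "\<Phi> x \<in> carrier_vec N \<and> x = lin_comb V scl cs (\<Phi> x)"
      using \<Phi>x inj[OF x lc(1)[OF \<Phi>x]] lc(2)[OF \<Phi>x] by simp
    show "v = \<Phi> x" if "v \<in> carrier_vec N \<and> x = lin_comb V scl cs v" for v
      using that lc(2)[of v] by simp
  qed
  then have eq: "map (coordinates V scl cs) xs = map \<Phi> xs" using xs by auto
  show ?thesis unfolding transition_det_def cs(1) eq ..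
qed

text \<open>
  The sequences of chains in the definition of torsion become the columns of matrices \<open>B k\<close>, and the basis
  property yields the matrices \<open>Y k\<close>. In degree \<open>0\<close> there are no boundaries to lift, because the chain
  group in degree \<open>- 1\<close> is trivial; hence \<open>l 0 = 0\<close>.
\<close>

lemma torsion_in_coordinates:
  fixes A :: "(real \<Rightarrow> real^4) set \<Rightarrow> 's::field Matrix.mat"
    and M :: "('a::topological_space, 'b::topological_space) cw_model"
  assumes tc: "twisted_complex K M b n A"
    and torsion: "is_torsion (twisted_chain K M n A) (twisted_boundary K M n A) (twisted_scale K M n A)
      (\<lambda>k. [twisted_tensor K M n A (int k) (unit_vec n j) (b k i). i \<leftarrow> [0..<ncells M k], j \<leftarrow> [0..<n]]) \<tau>"
  obtains B Y l where
    "\<And>k. B k \<in> carrier_mat (ncells M k * n) (l k)" "\<And>k. Y k \<in> carrier_mat (l k) (ncells M k * n)"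
    "l 0 = 0" "\<And>k. Y k * B k = 1\<^sub>m (l k)"
    "\<And>k. cellular_matrix K M b n A k * B (Suc k) * Y (Suc k) = cellular_matrix K M b n A k"
    "\<And>k. Y k * cellular_matrix K M b n A k = 0\<^sub>m (l k) (ncells M (Suc k) * n)"
    "\<tau> = (\<Prod>k | ncells M k * n \<noteq> 0. Determinant.det (beside (cellular_matrix K M b n A k * B (Suc k)) (B k))
       powi (if even k then - 1 else 1))"
proof -
  interpret twisted_complex K M b n A by (rule tc)
  let ?D = "cellular_matrix K M b n A"
  define cs where "cs k = [twisted_tensor K M n A (int k) (unit_vec n j) (b k i). i \<leftarrow> [0..<ncells M k], j \<leftarrow> [0..<n]]" for k
  obtain \<Phi> where \<Phi>: "\<And>k. \<Phi> k \<in> hom (tchain (int k)) (col_vectors (rk k))"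
    "\<And>k X Y. X \<in> carrier (tchain (int k)) \<Longrightarrow> Y \<in> carrier (tchain (int k)) \<Longrightarrow> \<Phi> k X = \<Phi> k Y \<Longrightarrow> X = Y"
    "\<And>k w. w \<in> carrier_vec (rk k) \<Longrightarrow> \<exists>X\<in>carrier (tchain (int k)). \<Phi> k X = w"
    "\<And>k s X. X \<in> carrier (tchain (int k)) \<Longrightarrow> \<Phi> k (tscale (int k) s X) = s \<cdot>\<^sub>v \<Phi> k X"
    and \<Phi>_cell: "\<And>k i j. i < ncells M k \<Longrightarrow> j < n \<Longrightarrow>
      twisted_tensor K M n A (int k) (unit_vec n j) (b k i) \<in> carrier (tchain (int k)) \<and>
      \<Phi> k (twisted_tensor K M n A (int k) (unit_vec n j) (b k i)) = unit_vec (rk k) (i * n + j)"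
    and \<Phi>_d: "\<And>k X. X \<in> carrier (tchain (int (Suc k))) \<Longrightarrow>
      \<Phi> k (tboundary (int (Suc k)) X) = ?D k *\<^sub>v \<Phi> (Suc k) X"
    by (rule coordinates_exist) (rule that)
  have k1: "int (Suc k) - 1 = int k" "int k + 1 = int (Suc k)" for k by simp_all
  have \<Phi>_closed: "\<Phi> k X \<in> carrier_vec (rk k)" if "X \<in> carrier (tchain (int k))" for k X
    using hom_in_carrier[OF \<Phi>(1) that] by simp
  have d_closed: "tboundary (int (Suc k)) X \<in> carrier (tchain (int k))" if "X \<in> carrier (tchain (int (Suc k)))" for k X
    using hom_in_carrier[OF boundary_hom that] unfolding k1 .
  have scale_closed: "tscale k s X \<in> carrier (tchain k)" if "X \<in> carrier (tchain k)" for k s X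
    using scale_hom that by (rule hom_in_carrier)
  have "\<exists>bb. (\<forall>k. set (bb k) \<subseteq> carrier (tchain k) \<and>
      is_basis (tchain (k - 1)) (tscale (k - 1)) (tboundary k ` carrier (tchain k)) (map (tboundary k) (bb k))) \<and>
    \<tau> = (\<Prod>k | cs k \<noteq> []. transition_det (tchain (int k)) (tscale (int k))
        (map (tboundary (int k + 1)) (bb (int k + 1)) @ bb (int k)) (cs k) powi (if even k then - 1 else 1))"
    using torsion unfolding is_torsion_def cs_def .
  then obtain bb where bb_all: "\<forall>k. set (bb k) \<subseteq> carrier (tchain k) \<and>
      is_basis (tchain (k - 1)) (tscale (k - 1)) (tboundary k ` carrier (tchain k)) (map (tboundary k) (bb k))"
    and \<tau>: "\<tau> = (\<Prod>k | cs k \<noteq> []. transition_det (tchain (int k)) (tscale (int k))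
        (map (tboundary (int k + 1)) (bb (int k + 1)) @ bb (int k)) (cs k) powi (if even k then - 1 else 1))"
    by (elim exE conjE) (rule that)
  have bb: "set (bb k) \<subseteq> carrier (tchain k)"
    "is_basis (tchain (k - 1)) (tscale (k - 1)) (tboundary k ` carrier (tchain k)) (map (tboundary k) (bb k))" for k
    using spec[OF bb_all, of k] by simp_all
  define l where "l k = length (bb (int k))" for k
  define B where "B k = mat_of_cols (rk k) (map (\<Phi> k) (bb (int k)))" for k
  have B: "B k \<in> carrier_mat (rk k) (l k)" for k
    using mat_of_cols_carrier(1)[of "rk k" "map (\<Phi> k) (bb (int k))"] unfolding B_def l_def length_map .
  have DB: "mat_of_cols (rk k) (map (\<Phi> k) (map (tboundary (int (Suc k))) (bb (int (Suc k))))) = ?D k * B (Suc k)" for k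
  proof -
    have "map (\<Phi> k) (map (tboundary (int (Suc k))) (bb (int (Suc k)))) = map (\<lambda>x. ?D k *\<^sub>v x) (map (\<Phi> (Suc k)) (bb (int (Suc k))))"
      using bb(1)[of "int (Suc k)"] \<Phi>_d by auto
    moreover have "set (map (\<Phi> (Suc k)) (bb (int (Suc k)))) \<subseteq> carrier_vec (rk (Suc k))"
      using bb(1)[of "int (Suc k)"] \<Phi>_closed by auto
    ultimately show ?thesis
      unfolding B_def by (simp only: mult_mat_of_cols[OF cellular_matrix_carrier])
  qed
  have l0: "l 0 = 0"
  proof (rule ccontr)
    assume "l 0 \<noteq> 0"
    let ?V = "tchain (-1)" and ?bs = "map (tboundary 0) (bb 0)"
    have V: "carrier ?V = {\<one>\<^bsub>?V\<^esub>}" by (rule chain_negative) simp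
    interpret V: comm_group ?V by (rule chain_comm_group)
    have one0: "\<one>\<^bsub>tchain 0\<^esub> \<in> carrier (tchain 0)"
      using comm_group.axioms(2)[OF chain_comm_group] by (intro monoid.one_closed group.is_monoid)
    have d0: "tboundary 0 X \<in> carrier ?V" if "X \<in> carrier (tchain 0)" for X
      using hom_in_carrier[OF boundary_hom that] by simp
    have ex1: "\<exists>!v. v \<in> carrier_vec (length ?bs) \<and> tboundary 0 \<one>\<^bsub>tchain 0\<^esub> = lin_comb ?V (tscale (-1)) ?bs v"
      using bspec[OF conjunct2[OF bb(2)[of 0, unfolded is_basis_def]] imageI[OF one0, of "tboundary 0"]] by simp
    have all: "tboundary 0 \<one>\<^bsub>tchain 0\<^esub> = lin_comb ?V (tscale (-1)) ?bs v" for v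
    proof -
      have "lin_comb ?V (tscale (-1)) ?bs v \<in> carrier ?V"
        unfolding lin_comb_def
      proof (intro V.finprod_closed funcsetI scale_closed)
        fix i assume "i \<in> {..<length ?bs}"
        then have i: "i < length (bb 0)" by simp
        then have "bb 0 ! i \<in> carrier (tchain 0)" using bb(1)[of 0] nth_mem by blast
        then show "?bs ! i \<in> carrier ?V" using d0 i by simp
      qed
      then show ?thesis using V d0[OF one0] by auto
    qed
    \<comment> \<open>in the trivial group all coordinate vectors represent the same element\<close>
    have "0\<^sub>v (l 0) = (unit_vec (l 0) 0 :: 's Matrix.vec)"
      using the1_equality[OF ex1, of "0\<^sub>v (l 0)"] the1_equality[OF ex1, of "unit_vec (l 0) 0"] all by (simp add: l_def)
    then have "(0\<^sub>v (l 0) :: 's Matrix.vec) $ 0 = unit_vec (l 0) 0 $ 0" by simp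
    then show False using \<open>l 0 \<noteq> 0\<close> by simp
  qed
  have ex1: "\<exists>!v. v \<in> carrier_vec (l (Suc k)) \<and> ?D k *\<^sub>v y = (?D k * B (Suc k)) *\<^sub>v v"
    if y: "y \<in> carrier_vec (rk (Suc k))" for k y
  proof -
    let ?bs = "map (tboundary (int (Suc k))) (bb (int (Suc k)))"
    have bs: "set ?bs \<subseteq> carrier (tchain (int k))" using bb(1)[of "int (Suc k)"] d_closed by auto
    obtain X where X: "X \<in> carrier (tchain (int (Suc k)))" "\<Phi> (Suc k) X = y" using \<Phi>(3)[OF y] by blast
    have "\<exists>!v. v \<in> carrier_vec (length ?bs) \<and> tboundary (int (Suc k)) X = lin_comb (tchain (int k)) (tscale (int k)) ?bs v"
      using bspec[OF conjunct2[OF bb(2)[of "int (Suc k)", unfolded is_basis_def]]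
          imageI[OF X(1), of "tboundary (int (Suc k))"]] unfolding k1 .
    moreover have "tboundary (int (Suc k)) X = lin_comb (tchain (int k)) (tscale (int k)) ?bs v \<longleftrightarrow>
        ?D k *\<^sub>v y = (?D k * B (Suc k)) *\<^sub>v v" if v: "v \<in> carrier_vec (length ?bs)" for v
    proof -
      have lc: "lin_comb (tchain (int k)) (tscale (int k)) ?bs v \<in> carrier (tchain (int k))"
        by (rule coords_lin_comb(1)[OF chain_comm_group \<Phi>(1) _ _ bs v]) (fact scale_closed \<Phi>(4))+
      have lc_eq: "\<Phi> k (lin_comb (tchain (int k)) (tscale (int k)) ?bs v) =
          mat_of_cols (rk k) (map (\<Phi> k) ?bs) *\<^sub>v v"
        by (rule coords_lin_comb(2)[OF chain_comm_group \<Phi>(1) _ _ bs v]) (fact scale_closed \<Phi>(4))+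
      have "tboundary (int (Suc k)) X = lin_comb (tchain (int k)) (tscale (int k)) ?bs v \<longleftrightarrow>
          \<Phi> k (tboundary (int (Suc k)) X) = \<Phi> k (lin_comb (tchain (int k)) (tscale (int k)) ?bs v)"
        using \<Phi>(2)[OF d_closed[OF X(1)] lc] by (intro iffI) simp_all
      then show ?thesis unfolding lc_eq DB \<Phi>_d[OF X(1)] X(2) .
    qed
    ultimately show ?thesis by (simp add: l_def cong: conj_cong)
  qed
  have "\<exists>Y. Y \<in> carrier_mat (l (Suc k)) (rk (Suc k)) \<and> ?D k * B (Suc k) * Y = ?D k \<and> Y * B (Suc k) = 1\<^sub>m (l (Suc k)) \<and>
      Y * ?D (Suc k) = 0\<^sub>m (l (Suc k)) (rk (Suc (Suc k)))" for k
  proof -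
    obtain Y where "Y \<in> carrier_mat (l (Suc k)) (rk (Suc k))" "?D k * B (Suc k) * Y = ?D k" "Y * B (Suc k) = 1\<^sub>m (l (Suc k))"
      "\<And>E q. E \<in> carrier_mat (rk (Suc k)) q \<Longrightarrow> ?D k * E = 0\<^sub>m (rk k) q \<Longrightarrow> Y * E = 0\<^sub>m (l (Suc k)) q"
      by (rule basis_of_image_section[OF cellular_matrix_carrier B ex1]) (assumption, rule that)
    then show ?thesis using cellular_matrix_square_zero[of k] cellular_matrix_carrier[of "Suc k"] by blast
  qed
  then obtain Y' where Y': "\<And>k. Y' k \<in> carrier_mat (l (Suc k)) (rk (Suc k)) \<and> ?D k * B (Suc k) * Y' k = ?D k \<and>
      Y' k * B (Suc k) = 1\<^sub>m (l (Suc k)) \<and> Y' k * ?D (Suc k) = 0\<^sub>m (l (Suc k)) (rk (Suc (Suc k)))"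
    by metis
  \<comment> \<open>in degree \<open>0\<close> the matrix has no rows, as \<open>l 0 = 0\<close>\<close>
  define Y where "Y k = (case k of 0 \<Rightarrow> 0\<^sub>m 0 (rk 0) | Suc j \<Rightarrow> Y' j)" for k
  have cs_len: "length (cs k) = rk k" for k unfolding cs_def by (rule length_concat_blocks)
  have cs_nth: "cs k ! p \<in> carrier (tchain (int k)) \<and> \<Phi> k (cs k ! p) = unit_vec (rk k) p" if "p < rk k" for k p
  proof -
    have "cs k ! p = twisted_tensor K M n A (int k) (unit_vec n (p mod n)) (b k (p div n))"
      unfolding cs_def by (rule nth_concat_blocks[OF that])
    then show ?thesis
      using \<Phi>_cell[OF block_div_mod(1,2)[OF that]] unfolding block_div_mod(3)[OF that] by simp
  qed
  have det: "transition_det (tchain (int k)) (tscale (int k)) (map (tboundary (int k + 1)) (bb (int k + 1)) @ bb (int k)) (cs k) =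
      Determinant.det (beside (?D k * B (Suc k)) (B k))" for k
  proof -
    have "transition_det (tchain (int k)) (tscale (int k)) (map (tboundary (int (Suc k))) (bb (int (Suc k))) @ bb (int k)) (cs k) =
        Determinant.det (mat_of_cols (rk k) (map (\<Phi> k) (map (tboundary (int (Suc k))) (bb (int (Suc k))) @ bb (int k))))"
    proof (rule transition_det_coords[OF chain_comm_group \<Phi>(1) \<Phi>(2) scale_closed \<Phi>(4) cs_len])
      show "set (cs k) \<subseteq> carrier (tchain (int k))"
        using cs_nth cs_len by (auto simp: in_set_conv_nth)
      show "\<Phi> k (cs k ! p) = unit_vec (rk k) p" if "p < rk k" for p using cs_nth[OF that] by simp
      show "set (map (tboundary (int (Suc k))) (bb (int (Suc k))) @ bb (int k)) \<subseteq> carrier (tchain (int k))"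
        using bb(1)[of "int k"] bb(1)[of "int (Suc k)"] d_closed by auto
    qed
    also have "mat_of_cols (rk k) (map (\<Phi> k) (map (tboundary (int (Suc k))) (bb (int (Suc k))) @ bb (int k))) =
        beside (?D k * B (Suc k)) (B k)"
      unfolding map_append mat_of_cols_append DB B_def[of k] ..
    finally show ?thesis unfolding k1 .
  qed
  show ?thesis
  proof (rule that[of B l Y])
    show "B k \<in> carrier_mat (rk k) (l k)" for k by (rule B)
    show "Y k \<in> carrier_mat (l k) (rk k)" for k
      using Y' l0 by (cases k) (simp_all add: Y_def)
    show "l 0 = 0" by (rule l0)
    show "Y k * B k = 1\<^sub>m (l k)" for k
      using Y' l0 B[of 0] by (cases k) (auto simp: Y_def)
    show "?D k * B (Suc k) * Y (Suc k) = ?D k" for k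
      using Y' by (simp add: Y_def)
    show "Y k * ?D k = 0\<^sub>m (l k) (rk (Suc k))" for k
    proof (cases k)
      case 0
      then show ?thesis
        using left_mult_zero_mat[OF cellular_matrix_carrier[of 0], of 0] l0 by (simp add: Y_def)
    next
      case (Suc j)
      then show ?thesis using Y'[of j] by (simp add: Y_def)
    qed
    have "{k. cs k \<noteq> []} = {k. rk k \<noteq> 0}" using cs_len by (metis length_0_conv)
    then show "\<tau> = (\<Prod>k | rk k \<noteq> 0. Determinant.det (beside (?D k * B (Suc k)) (B k)) powi (if even k then - 1 else 1))"
      unfolding \<tau> det by simp
  qed
qed

section \<open>The twisted Alexander invariant is monic\<close>

theorem proposition7p2:
  fixes K :: "real \<Rightarrow> real^4"
    and M :: "('a::topological_space, 'b::topological_space) cw_model"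
    and \<xi> :: "(real \<Rightarrow> real^4) set \<Rightarrow> int"
    and n :: nat
    and \<rho>0 :: "(real \<Rightarrow> real^4) set \<Rightarrow> int Matrix.mat"
    and \<rho> :: "(real \<Rightarrow> real^4) set \<Rightarrow> 'f::field Matrix.mat"
  assumes "oriented_knot K"
    and "complement_model K M"
    and "meridian_hom K (base_pt M) \<xi>"
    and "right_SL_representation (knot_group K (base_pt M)) n \<rho>0"
    and "right_SL_representation (knot_group K (base_pt M)) n \<rho>"
    and "\<And>g. g \<in> carrier (knot_group K (base_pt M)) \<Longrightarrow> \<rho> g = map_mat of_int (\<rho>0 g)"
    and "twisted_alexander_complex_acyclic K M n \<xi> \<rho>"
    and "\<And>k. trivial_group (twisted_novikov_homology K M n \<xi> \<rho>0 k)"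
  shows "\<forall>\<tau>\<in>twisted_alexander_invariant K M n \<xi> \<rho>. monic_fls (fls_of_ratfun \<tau>)"
proof
  let ?\<Gamma> = "knot_group K (base_pt M)"
  fix \<tau>' assume "\<tau>' \<in> twisted_alexander_invariant K M n \<xi> \<rho>"
  then obtain \<sigma> e \<tau> b where \<tau>': "\<tau>' = \<sigma> * ratfun_t powi e * \<tau>" and \<sigma>: "\<sigma> \<in> {1, - 1}"
    and b: "cell_basis K M b"
    and torsion: "is_torsion (twisted_chain K M n (alexander_rep \<xi> \<rho>))
             (twisted_boundary K M n (alexander_rep \<xi> \<rho>))
             (twisted_scale K M n (alexander_rep \<xi> \<rho>))
             (\<lambda>k. [twisted_tensor K M n (alexander_rep \<xi> \<rho>) (int k) (unit_vec n j) (b k i).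
                     i \<leftarrow> [0..<ncells M k], j \<leftarrow> [0..<n]])
             \<tau>"
    unfolding twisted_alexander_invariant_def by blast
  note base = base_pt_complement[OF assms(2)]
  note one = fundamental_group_one_closed[OF base] fundamental_group_one_mult_one[OF base]
  have \<xi>: "\<xi> \<in> hom ?\<Gamma> integer_group" using assms(3) by (simp add: meridian_hom_def)
  have novikov: "twisted_complex K M b n (novikov_rep \<xi> \<rho>0)"
    by (intro twisted_complex.intro assms(2) b novikov_rep_properties[OF assms(4) one \<xi>])
  have alexander: "twisted_complex K M b n (alexander_rep \<xi> \<rho>)"
    by (intro twisted_complex.intro assms(2) b alexander_rep_properties[OF assms(5) one \<xi>])
  define N where "N k = ncells M k * n" for k
  define D0 where "D0 = cellular_matrix K M b n (novikov_rep \<xi> \<rho>0)"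
  define D where "D = cellular_matrix K M b n (alexander_rep \<xi> \<rho>)"
  have carr: "D0 k \<in> carrier_mat (N k) (N (Suc k))" "D k \<in> carrier_mat (N k) (N (Suc k))" for k
    unfolding N_def D0_def D_def
    by (rule twisted_complex.cellular_matrix_carrier[OF novikov] twisted_complex.cellular_matrix_carrier[OF alexander])+
  have trivial: "trivial_group (complex_homology (twisted_chain K M n (novikov_rep \<xi> \<rho>0))
      (twisted_boundary K M n (novikov_rep \<xi> \<rho>0)) k)" for k
    using assms(8)[of k] unfolding twisted_novikov_homology_def .
  note exact = twisted_complex.trivial_homology_exact_matrices[OF novikov trivial, folded N_def D0_def]
  obtain B Y l where BY: "\<And>k. B k \<in> carrier_mat (N k) (l k)" "\<And>k. Y k \<in> carrier_mat (l k) (N k)"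
    "l 0 = 0" "\<And>k. Y k * B k = 1\<^sub>m (l k)" "\<And>k. D k * B (Suc k) * Y (Suc k) = D k"
    "\<And>k. Y k * D k = 0\<^sub>m (l k) (N (Suc k))"
    and \<tau>: "\<tau> = (\<Prod>k | N k \<noteq> 0. Determinant.det (beside (D k * B (Suc k)) (B k)) powi (if even k then - 1 else 1))"
    by (rule torsion_in_coordinates[OF alexander torsion, folded N_def D_def]) (rule that)
  have D_D0: "map_mat fls_of_ratfun (D k) = (map_mat fls_of_int_fls (D0 k) :: 'f fls Matrix.mat)" for k
  proof -
    interpret \<phi>: field_hom "fls_of_ratfun :: 'f poly fract \<Rightarrow> 'f fls" by (rule field_hom_fls_of_ratfun)
    interpret \<psi>: comm_ring_hom "fls_of_int_fls :: int fls \<Rightarrow> 'f fls" by (rule ring_hom_fls_of_int_fls)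
    interpret C: twisted_basis ?\<Gamma> "cell_chain M (int k)" "cell_act M (int k)" "b k" "ncells M k" n "alexander_rep \<xi> \<rho>"
      by (rule twisted_complex.basis_in_degree[OF alexander])
    interpret C1: twisted_basis ?\<Gamma> "cell_chain M (int (Suc k))" "cell_act M (int (Suc k))" "b (Suc k)" "ncells M (Suc k)" n "alexander_rep \<xi> \<rho>"
      by (rule twisted_complex.basis_in_degree[OF alexander])
    have entry: "fls_of_ratfun (evaluate n (alexander_rep \<xi> \<rho>) a $$ (i, j)) =
        fls_of_int_fls (evaluate n (novikov_rep \<xi> \<rho>0) a $$ (i, j))"
      if a: "Poly_Mapping.keys a \<subseteq> carrier ?\<Gamma>" and ij: "i < n" "j < n" for a i j
    proof -
      have g: "g \<in> carrier ?\<Gamma>" if "g \<in> Poly_Mapping.keys a" for g using a that by blast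
      have "map_mat fls_of_ratfun (evaluate n (alexander_rep \<xi> \<rho>) a) = evaluate n (\<lambda>g. map_mat fls_of_ratfun (alexander_rep \<xi> \<rho> g)) a"
        by (rule \<phi>.map_evaluate) (rule alexander_rep_properties(1)[OF assms(5) one \<xi> g])
      also have "\<dots> = evaluate n (\<lambda>g. map_mat fls_of_int_fls (novikov_rep \<xi> \<rho>0 g)) a"
      proof -
        have "map_mat fls_of_ratfun (alexander_rep \<xi> \<rho> g) = (map_mat fls_of_int_fls (novikov_rep \<xi> \<rho>0 g) :: 'f fls Matrix.mat)"
          if "g \<in> Poly_Mapping.keys a" for g
          by (rule alexander_rep_novikov_rep[of \<rho> g \<rho>0]) (rule assms(6)[OF g[OF that]])
        then show ?thesis unfolding evaluate_def by (intro eq_matI) (auto intro!: sum.cong)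
      qed
      also have "\<dots> = map_mat fls_of_int_fls (evaluate n (novikov_rep \<xi> \<rho>0) a)"
        by (rule \<psi>.map_evaluate[symmetric]) (rule novikov_rep_properties(1)[OF assms(4) one \<xi> g])
      finally have eq: "map_mat fls_of_ratfun (evaluate n (alexander_rep \<xi> \<rho>) a) $$ (i, j) =
          map_mat fls_of_int_fls (evaluate n (novikov_rep \<xi> \<rho>0) a) $$ (i, j)" by simp
      then show ?thesis using ij by simp
    qed
    show ?thesis
    proof (rule eq_matI)
      fix p q assume "p < dim_row (map_mat fls_of_int_fls (D0 k) :: 'f fls Matrix.mat)" "q < dim_col (map_mat fls_of_int_fls (D0 k) :: 'f fls Matrix.mat)"
      then have p: "p < ncells M k * n" and q: "q < ncells M (Suc k) * n" using carr(1)[of k] by (simp_all add: N_def)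
      have "cell_boundary M (int (Suc k)) (b (Suc k) (q div n)) \<in> carrier (cell_chain M (int k))"
        using hom_in_carrier[OF cell_boundary_hom C1.basis_closed[OF block_div_mod(1)[OF q]]] by simp
      from entry[OF C.coeff_keys[OF this block_div_mod(1)[OF p]] block_div_mod(2)[OF p] block_div_mod(2)[OF q]]
      show "map_mat fls_of_ratfun (D k) $$ (p, q) = (map_mat fls_of_int_fls (D0 k) :: 'f fls Matrix.mat) $$ (p, q)"
        using p q by (simp add: D_def D0_def cellular_matrix_def)
    qed (use carr[of k] in auto)
  qed
  have "finite {k. ncells M k \<noteq> 0}"
    using assms(2) by (simp add: complement_model_def finite_CW_complex_def)
  then have "finite {k. N k \<noteq> 0}" by (rule rev_finite_subset) (auto simp: N_def)
  then obtain m where m: "\<And>k. N k \<noteq> 0 \<Longrightarrow> k \<le> m"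
    unfolding finite_nat_set_iff_bounded_le by auto
  then have fin: "N (Suc m) = 0" by (metis Suc_n_not_le_n)
  note main = torsion_is_monic[OF carr(1) exact fin carr(2) D_D0 BY]
  \<comment> \<open>degrees without cells contribute determinants of empty matrices\<close>
  have "\<tau> = (\<Prod>k\<le>m. Determinant.det (beside (D k * B (Suc k)) (B k)) powi (if even k then - 1 else 1))"
    unfolding \<tau>
  proof (rule prod.mono_neutral_left)
    show "\<forall>k\<in>{..m} - {k. N k \<noteq> 0}. Determinant.det (beside (D k * B (Suc k)) (B k)) powi (if even k then - 1 else 1) = 1"
    proof
      fix k assume "k \<in> {..m} - {k. N k \<noteq> 0}"
      then have "beside (D k * B (Suc k)) (B k) \<in> carrier_mat 0 0"
        using beside_carrier[OF mult_carrier_mat[OF carr(2) BY(1)] BY(1), of k] main(1)[of k] by simp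
      then show "Determinant.det (beside (D k * B (Suc k)) (B k)) powi (if even k then - 1 else 1) = 1"
        by (simp add: det_dim_zero)
    qed
  qed (use m in auto)
  then have monic: "monic_fls (fls_of_ratfun \<tau>)" using main(2) by simp
  interpret \<phi>: field_hom "fls_of_ratfun :: 'f poly fract \<Rightarrow> 'f fls" by (rule field_hom_fls_of_ratfun)
  have "monic_fls (fls_of_ratfun \<sigma>)" using \<sigma> by (auto simp: monic_fls_def \<phi>.hom_uminus)
  moreover have "fls_of_ratfun (ratfun_t powi e) = (fls_of_ratfun ratfun_t powi e :: 'f fls)"
    by (rule fls_of_ratfun_power_int)
  then have "monic_fls (fls_of_ratfun (ratfun_t powi e) :: 'f fls)"
    using monic_fls_powi[OF monic_fls_of_ratfun_t] by simp
  ultimately show "monic_fls (fls_of_ratfun \<tau>')"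
    unfolding \<tau>' \<phi>.hom_mult using monic by (intro monic_fls_mult)
qed

end
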